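(* For $n=6$ the $L$-type partition of the cone $\mathfrak{P}(6)$ of positive quadratic forms in $6$ indeterminates is not a refinement of the partition of this cone into perfect cones. That is, it is not true that every cone of the perfect partition of $\mathfrak{P}(6)$ is the union of finitely many convex $L$-domains.
   Context: A positive quadratic form (PQF) in $n$ indeterminates is a positive semidefinite real quadratic form on $\mathbb{R}^n$; $\mathfrak{P}(n)\subset Sym(n,\mathbb{R})$ is the closed cone of all PQFs. Delaunay cells. A convex polyhedron $P\subset\mathbb{R}^n$ is a Delaunay cell of $\mathbb{Z}^n$ with respect to a PQF $\varphi$ if (1) every face $F$ of $P$ satisfies $F=\mathrm{conv}(F\cap\mathbb{Z}^n)$, and (2) there are $c\in\mathbb{R}$, $\mathbf{p}\in\mathbb{R}^n$ such that $f(\mathbf{x})=c+\mathbf{p}\cdot\mathbf{x}+\varphi(\mathbf{x})$ is nonnegative on $\mathbb{Z}^n$ and its zero set in $\mathbb{Z}^n$ is exactly $P\cap\mathbb{Z}^n$ (the quadric $f=0$ is circumscribed about $P$ and contains no lattice points inside). For positive definite $\varphi$ these cells are all the faces of the classical Delaunay tiling of $\mathbb{Z}^n$ for the metric $\varphi$. $L$-type partition. Two PQFs belong to the same convex $L$-domain if their Delaunay tilings of $\mathbb{Z}^n$ (collections of Delaunay cells) are identical. The convex $L$-domains are the cones of the $L$-type partition. Perfect partition. For a positive definite form $f$, its arithmetic minimum is $m=\min\{f(\mathbf{z}):\mathbf{z}\in\mathbb{Z}^n\setminus\{\mathbf{0}\}\}$ and its minimal vectors are the $\mathbf{v}\in\mathbb{Z}^n$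 with $f(\mathbf{v})=m$. The form $f$ is perfect if it is the only quadratic form taking the value $m$ on all of its minimal vectors. The perfect domain of a perfect form $f$ is the polyhedral cone $\{\sum_{\mathbf{v}}\omega_{\mathbf{v}}(\mathbf{v}\cdot\mathbf{x})^2:\omega_{\mathbf{v}}\ge 0\}$, the sum being over the minimal vectors of $f$. The cones of the perfect partition are the relative interiors of the faces (of all dimensions) of the perfect domains of all perfect forms in $n$ indeterminates. *)

theory Defs
  imports "HOL-Analysis.Analysis"
begin

(* Quadratic forms in n indeterminates are represented by their symmetric coefficient
   matrices; the cones live in the matrix space real^'n^'n, with n = CARD('n). *)

definition sym_matrices :: "(real^'n^'n) set" where
  "sym_matrices = {A. transpose A = A}"

definition qform :: "real^'n^'n \<Rightarrow> real^'n \<Rightarrow> real" where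
  "qform A x = x \<bullet> (A *v x)"

definition pqf :: "(real^'n^'n) set" where
  "pqf = {A \<in> sym_matrices. \<forall>x. 0 \<le> qform A x}"

definition positive_definite :: "real^'n^'n \<Rightarrow> bool" where
  "positive_definite A \<longleftrightarrow> A \<in> sym_matrices \<and> (\<forall>x. x \<noteq> 0 \<longrightarrow> 0 < qform A x)"

definition int_lattice :: "(real^'n) set" where
  "int_lattice = {x. \<forall>i. x $ i \<in> \<int>}"

(* Cells may be unbounded (when A is degenerate).  The empty polyhedron satisfies the
   conditions for every A, so it plays no role in comparing tilings. *)
definition delaunay_cell :: "real^'n^'n \<Rightarrow> (real^'n) set \<Rightarrow> bool" where
  "delaunay_cell A P \<longleftrightarrow>
     polyhedron P \<and>
     (\<forall>F. F face_of P \<longrightarrow> F = convex hull (F \<inter> int_lattice)) \<and>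
     (\<exists>c p. (\<forall>x\<in>int_lattice. 0 \<le> c + p \<bullet> x + qform A x) \<and>
            {x \<in> int_lattice. c + p \<bullet> x + qform A x = 0} = P \<inter> int_lattice)"

definition delaunay_tiling :: "real^'n^'n \<Rightarrow> (real^'n) set set" where
  "delaunay_tiling A = {P. delaunay_cell A P}"

definition L_domain :: "real^'n^'n \<Rightarrow> (real^'n^'n) set" where
  "L_domain A = {B \<in> pqf. delaunay_tiling B = delaunay_tiling A}"

definition L_type_partition :: "(real^'n^'n) set set" where
  "L_type_partition = L_domain ` pqf"

(* For positive definite A the infimum is attained, i.e. it is a minimum, and
   minimal_vectors A is finite. *)
definition arithmetic_minimum :: "real^'n^'n \<Rightarrow> real" where
  "arithmetic_minimum A = Inf (qform A ` (int_lattice - {0}))"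

definition minimal_vectors :: "real^'n^'n \<Rightarrow> (real^'n) set" where
  "minimal_vectors A = {v \<in> int_lattice. qform A v = arithmetic_minimum A}"

definition perfect_form :: "real^'n^'n \<Rightarrow> bool" where
  "perfect_form A \<longleftrightarrow> positive_definite A \<and>
     (\<forall>B\<in>sym_matrices. (\<forall>v\<in>minimal_vectors A. qform B v = arithmetic_minimum A) \<longrightarrow> B = A)"

definition square_form :: "real^'n \<Rightarrow> real^'n^'n" where
  "square_form v = (\<chi> i j. v $ i * v $ j)"

lemma qform_square_form: "qform (square_form v) x = (v \<bullet> x)\<^sup>2"
  by (simp add: qform_def square_form_def matrix_vector_mult_def inner_vec_def
      power2_eq_square sum_product sum_distrib_left mult_ac)

definition perfect_domain :: "real^'n^'n \<Rightarrow> (real^'n^'n) set" where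
  "perfect_domain A =
     {(\<Sum>v\<in>minimal_vectors A. w v *\<^sub>R square_form v) | w. \<forall>v\<in>minimal_vectors A. 0 \<le> w v}"

definition perfect_partition :: "(real^'n^'n) set set" where
  "perfect_partition =
     {rel_interior F | F A. perfect_form A \<and> F face_of perfect_domain A \<and> F \<noteq> {}}"

end

theory Submission
  imports Defs
begin

text \<open>
The idea is to exhibit two positive definite forms with the same Delaunay tiling, exactly one of which
lies in a certain perfect domain \<open>D\<close>.  Take the smallest face of \<open>D\<close> containing that one.  Its relative
interior is a cone of the perfect partition that contains one of the two forms but not the other, so it is
not a union of convex L-domains, finite or not.

The forms live on the root lattice \<open>E6\<close>, described in layers over a hexagonal lattice.  Let \<open>O\<close> be the ring of
Hurwitz quaternions, which is the lattice dual to \<open>D4\<close> and contains it, and let \<open>H\<close> be the hexagonal lattice of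
minimum 1, with points \<open>i h1 + j h2\<close> and norm \<open>N = i^2 + i j + j^2\<close>.  Both \<open>O / D4\<close> and \<open>H / 2H\<close> are Klein
four-groups, and \<open>E6\<close> consists of the pairs \<open>(x, \<eta>)\<close> in \<open>O \<times> H\<close> whose two classes correspond, with
norm \<open>|x|^2 + N(\<eta>)\<close>.  Compressing the hexagonal directions gives forms \<open>A\<^sub>r = |x|^2 + r N(\<eta>)\<close>, with \<open>A\<^sub>1\<close> the
form of \<open>E6\<close>.

Perfect side.  \<open>D\<close> is the perfect domain of the form \<open>E6_dual_form\<close> of the dual lattice, which has 27 pairs of
minimal vectors.  Dropping three of them that lie in the plane of \<open>H\<close>, the squares of the remaining 24 sum to
a multiple of \<open>A\<^sub>2\<^sub>/\<^sub>3\<close> (\<open>sum_facet_vectors\<close>), while the linear functional \<open>facet_functional\<close> is nonnegative on \<open>D\<close> and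
negative on \<open>A\<^sub>3\<^sub>/\<^sub>5\<close>.  So the family \<open>A\<^sub>r\<close> meets the boundary of \<open>D\<close> at \<open>r = 2/3\<close>.

Delaunay side.  The full-dimensional Delaunay cells of \<open>E6\<close> are Schlaefli polytopes with 27 vertices.  The main point is
\<open>in_E6_cell_zeros\<close>: every Delaunay cell of \<open>A\<^sub>3\<^sub>/\<^sub>5\<close> is contained in one of them.  Adding the quadratic function
of the surrounding Schlaefli polytope to the one of the small cell shows that each cell of \<open>A\<^sub>3\<^sub>/\<^sub>5\<close> is also a cell of
\<open>5 A\<^sub>3\<^sub>/\<^sub>5 + A\<^sub>1 = 6 A\<^sub>2\<^sub>/\<^sub>3\<close>; since the cells of \<open>A\<^sub>3\<^sub>/\<^sub>5\<close> cover space, the two tilings coincide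
(\<open>delaunay_tiling_add\<close>).

For the containment let \<open>(\<alpha>, \<beta>)\<close> be the centre of a cell of \<open>A\<^sub>3\<^sub>/\<^sub>5\<close>.  After a translation and possibly a
central symmetry, 0 is a point of \<open>O\<close> nearest to \<open>\<alpha>\<close> and \<open>\<beta>\<close> lies in the triangle with vertices \<open>0, 2 h1, 2 h2\<close>
of \<open>2H\<close>.  A vertex of the cell with trivial class is then \<open>(0, v)\<close> with \<open>v\<close> a corner of the triangle, and a vertex of any other class is
\<open>(e, m)\<close> with \<open>e\<close> a unit of \<open>O\<close> and \<open>m\<close> the midpoint of an edge (\<open>zero_in_cell\<close>): these are the 27 vertices of a
Schlaefli polytope.  The only obstructions are ties.  A tie for \<open>\<beta>\<close> at the midpoint of an edge is excluded because
\<open>r > 1/2\<close>.  A tie between 0 and another point of \<open>D4\<close> forces \<open>\<alpha>\<close> to be a deep hole of \<open>O\<close>, so points of all four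
classes are nearest to \<open>\<alpha>\<close>; one of the classes has no vertices in the cell, and translating a nearest point
of that class to the origin makes the tie harmless (\<open>in_E6_cell_if_nearest\<close>).
\<close>

section \<open>Delaunay tilings of positive definite forms\<close>

lemma qform_scaleR: "qform A (c *\<^sub>R x) = c\<^sup>2 * qform A x"
  by (simp add: qform_def matrix_vector_mult_scaleR power2_eq_square)

lemma qform_add_matrix: "qform (A + B) x = qform A x + qform B x"
  by (simp add: qform_def matrix_vector_mult_add_rdistrib inner_add_right)

lemma qform_zero [simp]: "qform A 0 = 0"
  by (simp add: qform_def)

lemma qform_convex_comb:
  fixes u v :: real
  assumes "u + v = 1"
  shows "qform A (u *\<^sub>R x + v *\<^sub>R y) = u * qform A x + v * qform A y - u * v * qform A (x - y)"
proof -
  have v: "v = 1 - u" using assms by simp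
  show ?thesis unfolding v
    by (simp add: qform_def matrix_vector_mult_diff_distrib matrix_vector_right_distrib matrix_vector_mult_scaleR
      inner_diff_left inner_add_left inner_diff_right inner_add_right algebra_simps)
qed

lemma continuous_on_qform: "continuous_on S (qform A)"
  unfolding qform_def by (intro continuous_intros linear_continuous_on matrix_vector_mul_bounded_linear)

lemma positive_definite_lower_bound:
  fixes A :: "real^'n^'n"
  assumes "positive_definite A"
  obtains m where "0 < m" "\<And>x. m * (norm x)\<^sup>2 \<le> qform A x"
proof -
  have "compact (sphere (0::real^'n) 1)" "sphere (0::real^'n) 1 \<noteq> {}" by auto
  then obtain x0 :: "real^'n" where x0: "x0 \<in> sphere 0 1" "\<And>x. x \<in> sphere 0 1 \<Longrightarrow> qform A x0 \<le> qform A x"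
    using continuous_attains_inf[OF _ _ continuous_on_qform[of "sphere 0 1" A]] by metis
  show ?thesis
  proof (rule that[of "qform A x0"])
    have "x0 \<noteq> 0" using x0(1) by auto
    then show "0 < qform A x0" using assms by (auto simp: positive_definite_def)
    show "qform A x0 * (norm x)\<^sup>2 \<le> qform A x" for x
    proof (cases "x = 0")
      case False
      have "qform A x0 \<le> qform A ((1 / norm x) *\<^sub>R x)" using False by (intro x0(2)) simp
      then show ?thesis using False by (simp add: qform_scaleR power_divide field_simps)
    qed simp
  qed
qed

lemma finite_int_lattice_bounded:
  "finite {x \<in> int_lattice :: (real^'n) set. norm x \<le> R}"
proof -
  define S where "S = (real_of_int ` {-\<lceil>R\<rceil>..\<lceil>R\<rceil>})"
  have "{x \<in> int_lattice :: (real^'n) set. norm x \<le> R} \<subseteq> {x. \<forall>i. x $ i \<in> S}"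
  proof (clarsimp simp: int_lattice_def)
    fix x :: "real^'n" and i assume x: "\<forall>i. x $ i \<in> \<int>" "norm x \<le> R"
    obtain n where n: "x $ i = of_int n" using x(1) by (auto elim: Ints_cases)
    have "\<bar>x $ i\<bar> \<le> R" using component_le_norm_cart[of x i] x(2) by linarith
    then have "n \<in> {-\<lceil>R\<rceil>..\<lceil>R\<rceil>}" unfolding n by (auto; linarith)
    then show "x $ i \<in> S" unfolding S_def n by blast
  qed
  moreover have "finite {x :: real^'n. \<forall>i. x $ i \<in> S}"
  proof (rule finite_subset)
    show "{x :: real^'n. \<forall>i. x $ i \<in> S} \<subseteq> vec_lambda ` {f. \<forall>i. (i \<in> UNIV \<longrightarrow> f i \<in> S) \<and> (i \<notin> UNIV \<longrightarrow> f i = 0)}"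
    proof
      fix x :: "real^'n" assume "x \<in> {x. \<forall>i. x $ i \<in> S}"
      then show "x \<in> vec_lambda ` {f. \<forall>i. (i \<in> UNIV \<longrightarrow> f i \<in> S) \<and> (i \<notin> UNIV \<longrightarrow> f i = 0)}"
        by (intro image_eqI[of _ _ "vec_nth x"]) (simp_all add: vec_nth_inverse)
    qed
    show "finite (vec_lambda ` {f :: 'n \<Rightarrow> real. \<forall>i. (i \<in> UNIV \<longrightarrow> f i \<in> S) \<and> (i \<notin> UNIV \<longrightarrow> f i = 0)})"
      by (intro finite_imageI finite_set_of_finite_funs) (simp_all add: S_def)
  qed
  ultimately show ?thesis by (rule finite_subset)
qed


text \<open>A positive definite form beats every affine function outside a ball; with discreteness of the lattice this
reduces statements about all lattice points to finitely many of them.\<close>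
lemma quadratic_growth:
  fixes A :: "real^'n^'n"
  assumes "positive_definite A"
  obtains R where "\<And>z. R \<le> norm z \<Longrightarrow> \<bar>b + a \<bullet> z\<bar> < c + p \<bullet> z + qform A z"
proof -
  obtain m where m: "0 < m" "\<And>x. m * (norm x)\<^sup>2 \<le> qform A x" using positive_definite_lower_bound[OF assms] by blast
  define K where "K = norm p + norm a + \<bar>c\<bar> + \<bar>b\<bar> + 1"
  show ?thesis
  proof (rule that[of "K / m + 1"])
    fix z :: "real^'n" assume R: "K / m + 1 \<le> norm z"
    have "0 \<le> K" unfolding K_def by simp
    then have "0 \<le> K / m" using m(1) by simp
    then have "1 \<le> norm z" "K / m \<le> norm z" using R by linarith+
    then have "K \<le> m * norm z" using m(1) by (simp add: pos_divide_le_eq mult.commute)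
    have "K * norm z \<le> m * norm z * norm z" by (rule mult_right_mono) (use \<open>K \<le> m * norm z\<close> in auto)
    also have "\<dots> \<le> qform A z" using m(2)[of z] by (simp add: power2_eq_square mult.assoc)
    finally have 1: "K * norm z \<le> qform A z" .
    have "(\<bar>c\<bar> + \<bar>b\<bar> + 1) * 1 \<le> (\<bar>c\<bar> + \<bar>b\<bar> + 1) * norm z" by (rule mult_left_mono[OF \<open>1 \<le> norm z\<close>]) simp
    then have 2: "norm p * norm z + norm a * norm z + \<bar>c\<bar> + \<bar>b\<bar> + 1 \<le> K * norm z"
      unfolding K_def by (simp add: algebra_simps)
    have "\<bar>p \<bullet> z\<bar> \<le> norm p * norm z" "\<bar>a \<bullet> z\<bar> \<le> norm a * norm z" by (rule Cauchy_Schwarz_ineq2)+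
    then show "\<bar>b + a \<bullet> z\<bar> < c + p \<bullet> z + qform A z" using 1 2 by linarith
  qed
qed

lemma finite_lattice_zeros:
  fixes A :: "real^'n^'n"
  assumes "positive_definite A"
  shows "finite {z \<in> int_lattice. c + p \<bullet> z + qform A z = 0}"
proof -
  obtain R where R: "\<And>z. R \<le> norm z \<Longrightarrow> \<bar>0 + 0 \<bullet> z\<bar> < c + p \<bullet> z + qform A z"
    using quadratic_growth[OF assms, of 0 0 c p] by blast
  have "{z \<in> int_lattice. c + p \<bullet> z + qform A z = 0} \<subseteq> {z \<in> int_lattice. norm z \<le> R}"
  proof clarify
    fix z :: "real^'n" assume "c + p \<bullet> z + qform A z = 0"
    then show "norm z \<le> R" using R[of z] by (cases "R \<le> norm z") auto
  qed
  then show ?thesis using finite_int_lattice_bounded finite_subset by blast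
qed

text \<open>Perturbing the affine part slightly keeps the positive values on the lattice positive, so only the zeros
need attention. This is what moves between a cell and its faces.\<close>
lemma lattice_perturbation:
  fixes A :: "real^'n^'n"
  assumes "positive_definite A"
  obtains \<epsilon> where "0 < \<epsilon>"
    "\<And>z. z \<in> int_lattice \<Longrightarrow> 0 < c + p \<bullet> z + qform A z \<Longrightarrow> 0 < c + p \<bullet> z + qform A z + \<epsilon> * (b + a \<bullet> z)"
proof -
  obtain R where R: "\<And>z. R \<le> norm z \<Longrightarrow> \<bar>b + a \<bullet> z\<bar> < c + p \<bullet> z + qform A z"
    using quadratic_growth[OF assms, of b a c p] by blast
  define f where "f z = c + p \<bullet> z + qform A z" for z
  define T where "T = {z \<in> int_lattice. norm z \<le> R \<and> 0 < f z}"
  have "finite T" unfolding T_def by (rule finite_subset[OF _ finite_int_lattice_bounded[of R]]) auto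
  define \<epsilon> where "\<epsilon> = Min (insert 1 ((\<lambda>z. f z / (\<bar>b + a \<bullet> z\<bar> + 1)) ` T))"
  have "\<epsilon> \<in> insert 1 ((\<lambda>z. f z / (\<bar>b + a \<bullet> z\<bar> + 1)) ` T)"
    unfolding \<epsilon>_def by (rule Min_in) (use \<open>finite T\<close> in auto)
  then have pos: "0 < \<epsilon>" by (auto simp: T_def intro!: divide_pos_pos)
  have le1: "\<epsilon> \<le> 1" unfolding \<epsilon>_def by (rule Min_le) (use \<open>finite T\<close> in auto)
  show ?thesis
  proof (rule that[OF pos])
    fix z :: "real^'n" assume z: "z \<in> int_lattice" "0 < c + p \<bullet> z + qform A z"
    have "\<epsilon> * \<bar>b + a \<bullet> z\<bar> < f z"
    proof (cases "norm z \<le> R")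
      case True
      then have "z \<in> T" using z by (simp add: T_def f_def)
      then have "\<epsilon> \<le> f z / (\<bar>b + a \<bullet> z\<bar> + 1)" unfolding \<epsilon>_def by (intro Min_le) (use \<open>finite T\<close> in auto)
      then have "\<epsilon> * \<bar>b + a \<bullet> z\<bar> + \<epsilon> \<le> f z" by (simp add: field_simps)
      then show ?thesis using pos by linarith
    next
      case False
      have "\<epsilon> * \<bar>b + a \<bullet> z\<bar> \<le> 1 * \<bar>b + a \<bullet> z\<bar>" by (rule mult_right_mono[OF le1]) simp
      also have "\<dots> < f z" using R[of z] False by (simp add: f_def)
      finally show ?thesis .
    qed
    moreover have "- (\<epsilon> * \<bar>b + a \<bullet> z\<bar>) \<le> \<epsilon> * (b + a \<bullet> z)"
      using pos abs_ge_minus_self[of "\<epsilon> * (b + a \<bullet> z)"] by (simp add: abs_mult)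
    ultimately show "0 < c + p \<bullet> z + qform A z + \<epsilon> * (b + a \<bullet> z)" unfolding f_def by linarith
  qed
qed

lemma convex_quadratic_sublevel:
  fixes A :: "real^'n^'n"
  assumes "A \<in> pqf"
  shows "convex {x. c + p \<bullet> x + qform A x \<le> 0}"
proof (rule convexI)
  fix x y :: "real^'n" and u v :: real
  assume xy: "x \<in> {x. c + p \<bullet> x + qform A x \<le> 0}" "y \<in> {x. c + p \<bullet> x + qform A x \<le> 0}" and uv: "0 \<le> u" "0 \<le> v" "u + v = 1"
  have "0 \<le> u * v * qform A (x - y)" using assms uv by (simp add: pqf_def)
  moreover have "u * (c + p \<bullet> x + qform A x) \<le> 0" by (rule mult_nonneg_nonpos) (use uv xy in auto)
  moreover have "v * (c + p \<bullet> y + qform A y) \<le> 0" by (rule mult_nonneg_nonpos) (use uv xy in auto)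
  moreover have "c = u * c + v * c" using uv(3) by (metis distrib_right mult_1)
  ultimately show "u *\<^sub>R x + v *\<^sub>R y \<in> {x. c + p \<bullet> x + qform A x \<le> 0}"
    by (simp add: qform_convex_comb[OF uv(3)] inner_add_right algebra_simps)
qed

lemma positive_definite_imp_pqf: "positive_definite A \<Longrightarrow> A \<in> pqf"
  by (auto simp: positive_definite_def pqf_def) (metis less_eq_real_def qform_zero)

text \<open>The convexity of the quadratic function prevents lattice points other than zeros from entering the hull.\<close>
lemma delaunay_cell_hull_zeros:
  fixes A :: "real^'n^'n"
  assumes A: "positive_definite A" and nonneg: "\<And>z. z \<in> int_lattice \<Longrightarrow> 0 \<le> c + p \<bullet> z + qform A z"
  shows "delaunay_cell A (convex hull {z \<in> int_lattice. c + p \<bullet> z + qform A z = 0})"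
proof -
  define Z where "Z = {z \<in> int_lattice. c + p \<bullet> z + qform A z = 0}"
  have fin: "finite Z" unfolding Z_def by (rule finite_lattice_zeros[OF A])
  have "convex hull Z \<subseteq> {x. c + p \<bullet> x + qform A x \<le> 0}"
    by (rule hull_minimal) (auto simp: Z_def intro: convex_quadratic_sublevel positive_definite_imp_pqf[OF A])
  then have le: "c + p \<bullet> z + qform A z \<le> 0" if "z \<in> convex hull Z" for z using that by blast
  have Z: "Z = convex hull Z \<inter> int_lattice"
  proof (intro equalityI subsetI)
    fix z assume "z \<in> Z"
    then show "z \<in> convex hull Z \<inter> int_lattice" by (simp add: hull_inc Z_def)
  next
    fix z assume z: "z \<in> convex hull Z \<inter> int_lattice"
    then have "c + p \<bullet> z + qform A z = 0" using le[of z] nonneg[of z] by (intro antisym) auto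
    then show "z \<in> Z" using z by (simp add: Z_def)
  qed
  have "F = convex hull (F \<inter> int_lattice)" if F: "F face_of convex hull Z" for F
  proof -
    obtain S where S: "S \<subseteq> Z" "F = convex hull S"
      using face_of_convex_hull_subset[OF finite_imp_compact[OF fin] F] by blast
    have "S \<subseteq> F \<inter> int_lattice" using S hull_subset[of S convex] by (auto simp: Z_def)
    then have "F \<subseteq> convex hull (F \<inter> int_lattice)" unfolding S(2) by (metis S(2) hull_mono)
    moreover have "convex hull (F \<inter> int_lattice) \<subseteq> F"
      by (rule hull_minimal) (use face_of_imp_convex[OF F] in auto)
    ultimately show ?thesis by blast
  qed
  moreover have "polyhedron (convex hull Z)"
    using fin by (simp add: polytope_convex_hull polytope_imp_polyhedron)
  ultimately show ?thesis using nonneg Z unfolding delaunay_cell_def Z_def by blast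
qed

text \<open>Among the functions \<open>c + p \<bullet> (z - y) + A(z)\<close> that are nonnegative on the lattice, choose one with the least value of
\<open>c\<close>, the contribution of the affine part at \<open>y\<close>. If \<open>y\<close> were not in the hull of its zeros, a separating affine function, added with a
small factor, would decrease \<open>c\<close>.\<close>
lemma delaunay_cell_exists:
  fixes A :: "real^'n^'n" and y :: "real^'n"
  assumes A: "positive_definite A"
  obtains P where "delaunay_cell A P" "y \<in> P"
proof -
  define S where "S = {(c :: real, p :: real^'n). c \<le> 0 \<and> (\<forall>z\<in>int_lattice. 0 \<le> c + p \<bullet> (z - y) + qform A z)}"
  define D where "D = 2 * real CARD('n)"
  obtain K where K: "\<And>z. z \<in> cball y D \<Longrightarrow> qform A z \<le> K"
  proof -
    have "cball y D \<noteq> {}" by (simp add: D_def)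
    then show ?thesis using continuous_attains_sup[OF compact_cball _ continuous_on_qform[of "cball y D" A]] that by blast
  qed
  have bound: "norm p \<le> c + K" if "(c, p) \<in> S" for c p
  proof -
    \<comment> \<open>This lattice point lies opposite to \<open>p\<close> as seen from \<open>y\<close>, at distance at least 1 in each coordinate, so the constraint at \<open>z\<close> bounds \<open>p\<close>.\<close>
    define z :: "real^'n" where "z = (\<chi> i. if 0 < p $ i then of_int (\<lfloor>y $ i\<rfloor> - 1) else of_int (\<lceil>y $ i\<rceil> + 1))"
    have "z \<in> int_lattice" by (simp add: z_def int_lattice_def)
    have "\<bar>(z - y) $ i\<bar> \<le> 2" for i by (simp add: z_def abs_le_iff) linarith
    then have "norm (z - y) \<le> D"
      using norm_le_l1_cart[of "z - y"] sum_bounded_above[of UNIV "\<lambda>i. \<bar>(z - y) $ i\<bar>" 2] by (simp add: D_def)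
    then have "qform A z \<le> K" by (intro K) (simp add: dist_norm norm_minus_commute)
    moreover have "p $ i * (z - y) $ i \<le> - \<bar>p $ i\<bar>" for i
    proof (cases "0 < p $ i")
      case True
      have "(z - y) $ i \<le> -1" using True by (simp add: z_def)
      then show ?thesis using True mult_left_mono[of "(z - y) $ i" "-1" "p $ i"] by simp
    next
      case False
      have "1 \<le> (z - y) $ i" using False by (simp add: z_def)
      then show ?thesis using False mult_left_mono_neg[of 1 "(z - y) $ i" "p $ i"] by simp
    qed
    then have "p \<bullet> (z - y) \<le> (\<Sum>i\<in>UNIV. - \<bar>p $ i\<bar>)" unfolding inner_vec_def by (intro sum_mono) simp
    then have "p \<bullet> (z - y) \<le> - norm p" using norm_le_l1_cart[of p] by (simp add: sum_negf)
    moreover have "0 \<le> c + p \<bullet> (z - y) + qform A z" using that \<open>z \<in> int_lattice\<close> by (auto simp: S_def)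
    ultimately show ?thesis by linarith
  qed
  have "S = (\<Inter>z\<in>int_lattice. {x. 0 \<le> fst x + snd x \<bullet> (z - y) + qform A z}) \<inter> {x. fst x \<le> 0}"
    unfolding S_def by auto
  moreover have "closed \<dots>" by (intro closed_Int closed_INT ballI closed_Collect_le continuous_intros)
  ultimately have "closed S" by simp
  moreover have "bounded S"
  proof (rule bounded_subset)
    show "bounded ({-K..0} \<times> cball (0::real^'n) K)" by (intro bounded_Times bounded_closed_interval bounded_cball)
    show "S \<subseteq> {-K..0} \<times> cball 0 K"
    proof clarify
      fix c p assume cp: "(c, p) \<in> S"
      moreover have "c \<le> 0" using cp by (simp add: S_def)
      ultimately show "c \<in> {-K..0} \<and> p \<in> cball 0 K" using bound[OF cp] norm_ge_zero[of p] by (auto simp del: norm_ge_zero)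
    qed
  qed
  ultimately have "compact S" by (simp add: compact_eq_bounded_closed)
  moreover have "(0, 0) \<in> S" using positive_definite_imp_pqf[OF A] by (simp add: S_def pqf_def)
  moreover have "continuous_on S fst" by (intro continuous_intros)
  ultimately obtain x where x: "x \<in> S" "\<And>x'. x' \<in> S \<Longrightarrow> fst x \<le> fst x'"
    using continuous_attains_inf[of S fst] by (metis empty_iff)
  obtain c p where cp: "x = (c, p)" by (cases x)
  have nonneg: "0 \<le> (c - p \<bullet> y) + p \<bullet> z + qform A z" if "z \<in> int_lattice" for z
  proof -
    have "0 \<le> c + p \<bullet> (z - y) + qform A z" using x(1) that unfolding cp S_def by auto
    then show ?thesis by (simp add: inner_diff_right)
  qed
  define Z where "Z = {z \<in> int_lattice. (c - p \<bullet> y) + p \<bullet> z + qform A z = 0}"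
  have "y \<in> convex hull Z"
  proof (rule ccontr)
    assume "y \<notin> convex hull Z"
    moreover have "closed (convex hull Z)"
      unfolding Z_def by (intro compact_imp_closed finite_imp_compact_convex_hull finite_lattice_zeros A)
    ultimately obtain a b where ab: "a \<bullet> y < b" "\<And>x. x \<in> convex hull Z \<Longrightarrow> b < a \<bullet> x"
      using separating_hyperplane_closed_point[OF convex_convex_hull] by blast
    obtain \<epsilon> where eps: "0 < \<epsilon>" "\<And>z. z \<in> int_lattice \<Longrightarrow> 0 < (c - p \<bullet> y) + p \<bullet> z + qform A z
        \<Longrightarrow> 0 < (c - p \<bullet> y) + p \<bullet> z + qform A z + \<epsilon> * (- b + a \<bullet> z)"
      using lattice_perturbation[OF A, of "c - p \<bullet> y" p "-b" a] by blast
    have neg: "\<epsilon> * (a \<bullet> y - b) < 0" using eps(1) ab(1) by (simp add: mult_less_0_iff)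
    have "0 \<le> (c + \<epsilon> * (a \<bullet> y - b)) + (p + \<epsilon> *\<^sub>R a) \<bullet> (z - y) + qform A z" if z: "z \<in> int_lattice" for z
    proof -
      have "0 \<le> (c - p \<bullet> y) + p \<bullet> z + qform A z + \<epsilon> * (- b + a \<bullet> z)"
      proof (cases "z \<in> Z")
        case True
        then have "b < a \<bullet> z" by (intro ab(2) hull_inc)
        then show ?thesis using eps(1) True by (simp add: Z_def)
      next
        case False
        then show ?thesis using eps(2)[OF z] nonneg[OF z] z by (force simp: Z_def)
      qed
      then show ?thesis by (simp add: inner_diff_right inner_add_left algebra_simps)
    qed
    moreover have "c \<le> 0" using x(1) by (simp add: cp S_def)
    ultimately have "(c + \<epsilon> * (a \<bullet> y - b), p + \<epsilon> *\<^sub>R a) \<in> S" using neg by (simp add: S_def)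
    from x(2)[OF this] neg show False by (simp add: cp)
  qed
  with delaunay_cell_hull_zeros[OF A nonneg] that show ?thesis unfolding Z_def by blast
qed

text \<open>The functions of two cells of the same form differ by an affine function, which supports both cells from opposite
sides. If the cells meet in a relative interior point of one of them, this one is a face of the other. A face of
a cell of \<open>A\<close> is a cell of \<open>A\<close> by a perturbation.\<close>
lemma delaunay_cell_of_common_cell:
  fixes A B :: "real^'n^'n"
  assumes A: "positive_definite A" and PA: "delaunay_cell A P" and PB: "delaunay_cell B P" and Q: "delaunay_cell B Q"
    and y: "y \<in> rel_interior Q" "y \<in> P"
  shows "delaunay_cell A Q"
proof -
  from PA obtain cA pA where fA: "\<And>z. z \<in> int_lattice \<Longrightarrow> 0 \<le> cA + pA \<bullet> z + qform A z"
    "{z \<in> int_lattice. cA + pA \<bullet> z + qform A z = 0} = P \<inter> int_lattice"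
    unfolding delaunay_cell_def by blast
  from PB obtain cB pB where fB: "\<And>z. z \<in> int_lattice \<Longrightarrow> 0 \<le> cB + pB \<bullet> z + qform B z"
    "{z \<in> int_lattice. cB + pB \<bullet> z + qform B z = 0} = P \<inter> int_lattice"
    unfolding delaunay_cell_def by blast
  from Q obtain cQ pQ where fQ: "\<And>z. z \<in> int_lattice \<Longrightarrow> 0 \<le> cQ + pQ \<bullet> z + qform B z"
    "{z \<in> int_lattice. cQ + pQ \<bullet> z + qform B z = 0} = Q \<inter> int_lattice"
    unfolding delaunay_cell_def by blast
  have cell: "convex R" "F face_of R \<Longrightarrow> F = convex hull (F \<inter> int_lattice)" "R = convex hull (R \<inter> int_lattice)"
    if "delaunay_cell B R" for R F
    using that polyhedron_imp_convex face_of_refl unfolding delaunay_cell_def by blast+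
  define a b where "a = pQ - pB" "b = cB - cQ"
  have diff: "cQ + pQ \<bullet> z + qform B z = cB + pB \<bullet> z + qform B z + (a \<bullet> z - b)" for z
    unfolding a_b_def by (simp add: inner_diff_left)
  have "a \<bullet> z \<le> b" if "z \<in> Q \<inter> int_lattice" for z
  proof -
    have "cQ + pQ \<bullet> z + qform B z = 0" "0 \<le> cB + pB \<bullet> z + qform B z" using that fQ(2) fB(1) by blast+
    then show ?thesis using diff[of z] by linarith
  qed
  then have "convex hull (Q \<inter> int_lattice) \<subseteq> {x. a \<bullet> x \<le> b}"
    by (intro hull_minimal convex_halfspace_le) auto
  then have Q_le: "\<And>x. x \<in> Q \<Longrightarrow> a \<bullet> x \<le> b" using cell(3)[OF Q] by blast
  have "b \<le> a \<bullet> z" if "z \<in> P \<inter> int_lattice" for z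
  proof -
    have "cB + pB \<bullet> z + qform B z = 0" "0 \<le> cQ + pQ \<bullet> z + qform B z" using that fB(2) fQ(1) by blast+
    then show ?thesis using diff[of z] by linarith
  qed
  then have "convex hull (P \<inter> int_lattice) \<subseteq> {x. a \<bullet> x \<ge> b}"
    by (intro hull_minimal convex_halfspace_ge) auto
  then have P_ge: "\<And>x. x \<in> P \<Longrightarrow> b \<le> a \<bullet> x" using cell(3)[OF PB] by blast
  have "y \<in> Q" using y(1) rel_interior_subset by blast
  then have "a \<bullet> y = b" using Q_le P_ge y(2) by force
  have "Q \<inter> {x. a \<bullet> x = b} face_of Q"
    by (rule face_of_Int_supporting_hyperplane_le) (use cell(1)[OF Q] Q_le in auto)
  then have "Q \<subseteq> Q \<inter> {x. a \<bullet> x = b}"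
    by (rule subset_of_face_of) (use y \<open>y \<in> Q\<close> \<open>a \<bullet> y = b\<close> in auto)
  then have Q_eq: "\<And>x. x \<in> Q \<Longrightarrow> a \<bullet> x = b" by blast
  define G where "G = P \<inter> {x. a \<bullet> x = b}"
  have "G face_of P"
    unfolding G_def by (rule face_of_Int_supporting_hyperplane_ge) (use cell(1)[OF PB] P_ge in auto)
  then have G: "G = convex hull (G \<inter> int_lattice)" by (rule cell(2)[OF PB])
  have "Q \<inter> int_lattice = G \<inter> int_lattice"
  proof (intro equalityI subsetI)
    fix z assume z: "z \<in> Q \<inter> int_lattice"
    then have "cQ + pQ \<bullet> z + qform B z = 0" "a \<bullet> z = b" using fQ(2) Q_eq by blast+
    then have "cB + pB \<bullet> z + qform B z = 0" using diff[of z] by linarith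
    then show "z \<in> G \<inter> int_lattice" using z fB(2) \<open>a \<bullet> z = b\<close> unfolding G_def by blast
  next
    fix z assume z: "z \<in> G \<inter> int_lattice"
    then have "cB + pB \<bullet> z + qform B z = 0" "a \<bullet> z = b" using fB(2) unfolding G_def by blast+
    then have "cQ + pQ \<bullet> z + qform B z = 0" using diff[of z] by linarith
    then show "z \<in> Q \<inter> int_lattice" using z fQ(2) by blast
  qed
  then have QG: "Q = G" using G cell(3)[OF Q] by metis
  obtain \<epsilon> where eps: "0 < \<epsilon>" "\<And>z. z \<in> int_lattice \<Longrightarrow> 0 < cA + pA \<bullet> z + qform A z
        \<Longrightarrow> 0 < cA + pA \<bullet> z + qform A z + \<epsilon> * (- b + a \<bullet> z)"
    using lattice_perturbation[OF A, of cA pA "-b" a] by blast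
  have new: "(cA - \<epsilon> * b) + (pA + \<epsilon> *\<^sub>R a) \<bullet> z + qform A z = cA + pA \<bullet> z + qform A z + \<epsilon> * (- b + a \<bullet> z)" for z
    by (simp add: inner_add_left algebra_simps)
  have val: "0 \<le> cA + pA \<bullet> z + qform A z + \<epsilon> * (- b + a \<bullet> z) \<and>
      (cA + pA \<bullet> z + qform A z + \<epsilon> * (- b + a \<bullet> z) = 0 \<longleftrightarrow> z \<in> Q)" if z: "z \<in> int_lattice" for z
  proof (cases "cA + pA \<bullet> z + qform A z = 0")
    case True
    then have "z \<in> P" using z fA(2) by blast
    then have "b \<le> a \<bullet> z" "z \<in> Q \<longleftrightarrow> a \<bullet> z = b" using P_ge QG by (auto simp: G_def)
    then show ?thesis using eps(1) True by simp
  next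
    case False
    then have "z \<notin> P" using z fA(2) by blast
    then have "z \<notin> Q" using QG by (simp add: G_def)
    moreover have "0 < cA + pA \<bullet> z + qform A z + \<epsilon> * (- b + a \<bullet> z)"
      using eps(2)[OF z] fA(1)[OF z] False by linarith
    ultimately show ?thesis by simp
  qed
  have "(\<forall>z\<in>int_lattice. 0 \<le> (cA - \<epsilon> * b) + (pA + \<epsilon> *\<^sub>R a) \<bullet> z + qform A z)
      \<and> {z \<in> int_lattice. (cA - \<epsilon> * b) + (pA + \<epsilon> *\<^sub>R a) \<bullet> z + qform A z = 0} = Q \<inter> int_lattice"
    unfolding new using val by auto
  then show ?thesis using Q unfolding delaunay_cell_def by blast
qed

lemma delaunay_cell_empty:
  assumes "A \<in> pqf"
  shows "delaunay_cell A {}"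
proof -
  have "(\<forall>z\<in>int_lattice. 0 \<le> 1 + 0 \<bullet> z + qform A z) \<and> {z \<in> int_lattice. 1 + 0 \<bullet> z + qform A z = 0} = {} \<inter> int_lattice"
    using assms by (auto simp: pqf_def) (smt (verit))
  then have "\<exists>c p. (\<forall>z\<in>int_lattice. 0 \<le> c + p \<bullet> z + qform A z) \<and> {z \<in> int_lattice. c + p \<bullet> z + qform A z = 0} = {} \<inter> int_lattice"
    by blast
  then show ?thesis unfolding delaunay_cell_def by (simp add: polyhedron_empty)
qed

text \<open>The hypothesis says that each cell of \<open>A\<close> is contained in a cell of \<open>E\<close>. The functions of the two
cells add up to a function for \<open>A + E\<close> with the same zeros as the function of the smaller cell. Cells of \<open>A + E\<close> cannot differ
from these, because the cells of \<open>A\<close> already cover the space.\<close>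
theorem delaunay_tiling_add:
  fixes A E :: "real^'n^'n"
  assumes A: "positive_definite A"
    and refine: "\<And>c p. (\<And>z. z \<in> int_lattice \<Longrightarrow> 0 \<le> c + p \<bullet> z + qform A z) \<Longrightarrow>
      \<exists>c' p'. \<forall>z\<in>int_lattice. 0 \<le> c' + p' \<bullet> z + qform E z \<and>
        (c + p \<bullet> z + qform A z = 0 \<longrightarrow> c' + p' \<bullet> z + qform E z = 0)"
  shows "delaunay_tiling (A + E) = delaunay_tiling A"
proof -
  have AB: "delaunay_cell (A + E) P" if P: "delaunay_cell A P" for P
  proof -
    from P obtain c p where f: "\<And>z. z \<in> int_lattice \<Longrightarrow> 0 \<le> c + p \<bullet> z + qform A z"
      "{z \<in> int_lattice. c + p \<bullet> z + qform A z = 0} = P \<inter> int_lattice"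
      unfolding delaunay_cell_def by blast
    from refine[OF f(1)] obtain c' p' where q: "\<forall>z\<in>int_lattice. 0 \<le> c' + p' \<bullet> z + qform E z \<and>
        (c + p \<bullet> z + qform A z = 0 \<longrightarrow> c' + p' \<bullet> z + qform E z = 0)" by blast
    have eq: "(c + c') + (p + p') \<bullet> z + qform (A + E) z = (c + p \<bullet> z + qform A z) + (c' + p' \<bullet> z + qform E z)" for z
      by (simp add: qform_add_matrix inner_add_left)
    have "(\<forall>z\<in>int_lattice. 0 \<le> (c + c') + (p + p') \<bullet> z + qform (A + E) z) \<and>
      {z \<in> int_lattice. (c + c') + (p + p') \<bullet> z + qform (A + E) z = 0} = P \<inter> int_lattice"
      unfolding eq f(2)[symmetric] using f(1) q by (auto simp: add_nonneg_eq_0_iff)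
    then show ?thesis using P unfolding delaunay_cell_def by blast
  qed
  moreover have "delaunay_cell A Q" if Q: "delaunay_cell (A + E) Q" for Q
  proof (cases "Q = {}")
    case True
    then show ?thesis using delaunay_cell_empty[OF positive_definite_imp_pqf[OF A]] by simp
  next
    case False
    have "convex Q" using Q polyhedron_imp_convex unfolding delaunay_cell_def by blast
    then obtain y where y: "y \<in> rel_interior Q" using False rel_interior_eq_empty by blast
    obtain P where "delaunay_cell A P" "y \<in> P" using delaunay_cell_exists[OF A] by blast
    then show ?thesis using delaunay_cell_of_common_cell[OF A _ AB Q y] by blast
  qed
  ultimately show ?thesis unfolding delaunay_tiling_def by blast
qed

text \<open>The smallest face containing the point works: a supporting hyperplane at a relative boundary point would cut out
a smaller one.\<close>
lemma obtain_face_rel_interior: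
  fixes S :: "'a::euclidean_space set"
  assumes "convex S" "x \<in> S"
  obtains F where "F face_of S" "x \<in> rel_interior F"
proof -
  define F where "F = \<Inter>{T. T face_of S \<and> x \<in> T}"
  have ne: "{T. T face_of S \<and> x \<in> T} \<noteq> {}" using face_of_refl[OF assms(1)] assms(2) by blast
  have F: "F face_of S" unfolding F_def by (rule face_of_Inter[OF ne]) auto
  have "x \<in> F" unfolding F_def by blast
  have "x \<in> rel_interior F"
  proof (rule ccontr)
    assume "x \<notin> rel_interior F"
    have "convex F" using face_of_imp_convex[OF F] .
    obtain a where a: "\<And>y. y \<in> F \<Longrightarrow> a \<bullet> x \<le> a \<bullet> y" "\<And>y. y \<in> rel_interior F \<Longrightarrow> a \<bullet> x < a \<bullet> y"
      using supporting_hyperplane_rel_boundary[OF \<open>convex F\<close> \<open>x \<in> F\<close> \<open>x \<notin> rel_interior F\<close>] by metis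
    have "F \<inter> {y. a \<bullet> y = a \<bullet> x} face_of F"
      by (rule face_of_Int_supporting_hyperplane_ge[OF \<open>convex F\<close>]) (use a(1) in blast)
    then have "F \<inter> {y. a \<bullet> y = a \<bullet> x} face_of S" using F face_of_trans by blast
    then have "F \<subseteq> F \<inter> {y. a \<bullet> y = a \<bullet> x}" using \<open>x \<in> F\<close> unfolding F_def by blast
    moreover obtain y where "y \<in> rel_interior F" using \<open>x \<in> F\<close> rel_interior_eq_empty[OF \<open>convex F\<close>] by blast
    ultimately show False using a(2)[of y] rel_interior_subset by fastforce
  qed
  with F that show ?thesis by blast
qed

section \<open>Nearest points in the hexagonal lattice and in orthonormal frames\<close>

lemma int_quad_lower_bounds:
  fixes x :: int and y :: real
  assumes "\<bar>y\<bar> \<le> 1"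
  shows "0 \<le> (real_of_int x)\<^sup>2 - y * x"
    and "2 \<le> \<bar>x\<bar> \<Longrightarrow> 2 \<le> (real_of_int x)\<^sup>2 - y * x"
proof -
  have a: "y * x \<le> \<bar>real_of_int x\<bar>"
    using mult_right_mono[OF assms, of "\<bar>real_of_int x\<bar>"] abs_ge_self[of "y * x"]
    by (simp add: abs_mult)
  have b: "(real_of_int x)\<^sup>2 = \<bar>real_of_int x\<bar> * \<bar>real_of_int x\<bar>"
    by (simp add: power2_eq_square)
  have "x = 0 \<or> 1 \<le> \<bar>real_of_int x\<bar>" by linarith
  then have "\<bar>real_of_int x\<bar> \<le> \<bar>real_of_int x\<bar> * \<bar>real_of_int x\<bar>"
    using mult_left_mono[of 1 "\<bar>real_of_int x\<bar>" "\<bar>real_of_int x\<bar>"] by auto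
  then show "0 \<le> (real_of_int x)\<^sup>2 - y * x" using a b by linarith
  assume "2 \<le> \<bar>x\<bar>"
  then have "2 \<le> \<bar>real_of_int x\<bar>" by linarith
  then have "2 * \<bar>real_of_int x\<bar> \<le> \<bar>real_of_int x\<bar> * \<bar>real_of_int x\<bar>" by (intro mult_right_mono) auto
  then show "2 \<le> (real_of_int x)\<^sup>2 - y * x" using a b \<open>2 \<le> \<bar>real_of_int x\<bar>\<close> by linarith
qed

text \<open>In an orthonormal frame, write \<open>y / 2\<close> for a point of the 24-cell with vertices at half the roots of \<open>D4\<close>; the bounds on \<open>y\<close> are its facet inequalities.
Among the integer vectors with odd coordinate sum, the unit vectors are the only ones that can be nearest to
\<open>y / 2\<close>: a coordinate of size 2 costs at least 2, and three coordinates of size 1 cost at least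
\<open>3 - \<Sum>|y\<^sub>k| \<ge> 1\<close>, whereas a unit costs \<open>1 - |y\<^sub>k|\<close>; equality would force \<open>y = 0\<close>, where the cost is 3.\<close>
lemma nearest_odd_vector_is_unit:
  fixes x1 x2 x3 x4 :: int and y1 y2 y3 y4 :: real
  defines "g \<equiv> (real_of_int x1)\<^sup>2 - y1 * x1 + ((real_of_int x2)\<^sup>2 - y2 * x2)
              + ((real_of_int x3)\<^sup>2 - y3 * x3) + ((real_of_int x4)\<^sup>2 - y4 * x4)"
  assumes y: "\<bar>y1\<bar> \<le> 1" "\<bar>y2\<bar> \<le> 1" "\<bar>y3\<bar> \<le> 1" "\<bar>y4\<bar> \<le> 1"
    and y_sum: "\<bar>y1\<bar> + \<bar>y2\<bar> + \<bar>y3\<bar> + \<bar>y4\<bar> \<le> 2"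
    and odd: "odd (x1 + x2 + x3 + x4)"
    and le: "g \<le> 1 - \<bar>y1\<bar>" "g \<le> 1 - \<bar>y2\<bar>" "g \<le> 1 - \<bar>y3\<bar>" "g \<le> 1 - \<bar>y4\<bar>"
  shows "x1\<^sup>2 + x2\<^sup>2 + x3\<^sup>2 + x4\<^sup>2 = 1"
proof -
  note n = int_quad_lower_bounds(1)[OF y(1), of x1] int_quad_lower_bounds(1)[OF y(2), of x2]
    int_quad_lower_bounds(1)[OF y(3), of x3] int_quad_lower_bounds(1)[OF y(4), of x4]
  have "g \<le> 1" using le(1) abs_ge_zero[of y1] by linarith
  have "\<not> 2 \<le> \<bar>x1\<bar>" using int_quad_lower_bounds(2)[OF y(1), of x1] n(2,3,4) \<open>g \<le> 1\<close> unfolding g_def by linarith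
  moreover have "\<not> 2 \<le> \<bar>x2\<bar>" using int_quad_lower_bounds(2)[OF y(2), of x2] n(1,3,4) \<open>g \<le> 1\<close> unfolding g_def by linarith
  moreover have "\<not> 2 \<le> \<bar>x3\<bar>" using int_quad_lower_bounds(2)[OF y(3), of x3] n(1,2,4) \<open>g \<le> 1\<close> unfolding g_def by linarith
  moreover have "\<not> 2 \<le> \<bar>x4\<bar>" using int_quad_lower_bounds(2)[OF y(4), of x4] n(1,2,3) \<open>g \<le> 1\<close> unfolding g_def by linarith
  moreover have "x = -1 \<or> x = 0 \<or> x = 1" if "\<not> 2 \<le> \<bar>x\<bar>" for x :: int using that by linarith
  ultimately have c: "x1 = -1 \<or> x1 = 0 \<or> x1 = 1" "x2 = -1 \<or> x2 = 0 \<or> x2 = 1"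
     "x3 = -1 \<or> x3 = 0 \<or> x3 = 1" "x4 = -1 \<or> x4 = 0 \<or> x4 = 1" by blast+
  have bound: "real_of_int (x\<^sup>2) - \<bar>y\<bar> \<le> (real_of_int x)\<^sup>2 - y * x"
    if "x = -1 \<or> x = 0 \<or> x = 1" for x :: int and y :: real
    using that by (elim disjE) auto
  have unit: "x\<^sup>2 = 0 \<or> x\<^sup>2 = 1" if "x = -1 \<or> x = 0 \<or> x = 1" for x :: int
    using that by auto
  have lin: False
    if "m - Y1 - Y2 - Y3 - Y4 \<le> g" "3 \<le> m" "g \<le> 1 - Y1" "g \<le> 1 - Y2" "g \<le> 1 - Y3" "g \<le> 1 - Y4"
       "Y1 + Y2 + Y3 + Y4 \<le> 2" for m Y1 Y2 Y3 Y4 g :: real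
    using that by linarith
  have "real_of_int (x1\<^sup>2 + x2\<^sup>2 + x3\<^sup>2 + x4\<^sup>2) - \<bar>y1\<bar> - \<bar>y2\<bar> - \<bar>y3\<bar> - \<bar>y4\<bar> \<le> g"
    using add_mono[OF add_mono[OF bound[OF c(1), of y1] bound[OF c(2), of y2]]
        add_mono[OF bound[OF c(3), of y3] bound[OF c(4), of y4]]]
    unfolding g_def by (simp add: algebra_simps)
  then have "\<not> 3 \<le> real_of_int (x1\<^sup>2 + x2\<^sup>2 + x3\<^sup>2 + x4\<^sup>2)"
    using lin[OF _ _ le y_sum] by blast
  then have "x1\<^sup>2 + x2\<^sup>2 + x3\<^sup>2 + x4\<^sup>2 < 3" by linarith
  moreover have "odd (x1\<^sup>2 + x2\<^sup>2 + x3\<^sup>2 + x4\<^sup>2)" using odd by simp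
  moreover have "0 \<le> x1\<^sup>2 + x2\<^sup>2 + x3\<^sup>2 + x4\<^sup>2" by simp
  moreover have "m = 1" if "m < 3" "odd m" "0 \<le> m" for m :: int using that by presburger
  ultimately show ?thesis by blast
qed

lemma tie_gives_unit_coordinate:
  fixes x1 x2 x3 x4 :: int and y1 y2 y3 y4 :: real
  assumes y: "\<bar>y1\<bar> \<le> 1" "\<bar>y2\<bar> \<le> 1" "\<bar>y3\<bar> \<le> 1" "\<bar>y4\<bar> \<le> 1"
    and nz: "\<not> (x1 = 0 \<and> x2 = 0 \<and> x3 = 0 \<and> x4 = 0)"
    and le: "(real_of_int x1)\<^sup>2 - y1 * x1 + ((real_of_int x2)\<^sup>2 - y2 * x2)
              + ((real_of_int x3)\<^sup>2 - y3 * x3) + ((real_of_int x4)\<^sup>2 - y4 * x4) \<le> 0"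
  shows "\<bar>y1\<bar> = 1 \<or> \<bar>y2\<bar> = 1 \<or> \<bar>y3\<bar> = 1 \<or> \<bar>y4\<bar> = 1"
proof -
  have one: "\<bar>y\<bar> = 1" if "\<bar>y\<bar> \<le> 1" "x \<noteq> 0" "(real_of_int x)\<^sup>2 - y * x \<le> 0" for x :: int and y :: real
  proof -
    have "\<not> 2 \<le> \<bar>x\<bar>" using int_quad_lower_bounds(2)[OF that(1), of x] that(3) by linarith
    then have "x = 1 \<or> x = -1" using that(2) by linarith
    then show ?thesis using that by auto
  qed
  note n = int_quad_lower_bounds(1)[OF y(1), of x1] int_quad_lower_bounds(1)[OF y(2), of x2]
    int_quad_lower_bounds(1)[OF y(3), of x3] int_quad_lower_bounds(1)[OF y(4), of x4]
  show ?thesis using nz n le one[OF y(1), of x1] one[OF y(2), of x2] one[OF y(3), of x3] one[OF y(4), of x4]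
    by (smt (verit))
qed

text \<open>The squared distance of \<open>i h1 + j h2\<close> and \<open>s h1 + t h2\<close> for unit vectors \<open>h1\<close>, \<open>h2\<close> at an angle of 60 degrees.\<close>
definition hex_dist :: "real \<Rightarrow> real \<Rightarrow> real \<Rightarrow> real \<Rightarrow> real" where
  "hex_dist s t i j = (i - s)\<^sup>2 + (i - s) * (j - t) + (j - t)\<^sup>2"

text \<open>The six shortest vectors of the hexagonal lattice, scaled by \<open>c\<close>.\<close>
definition hex_steps :: "real \<Rightarrow> (real \<times> real) set" where
  "hex_steps c = {(c,0), (-c,0), (0,c), (0,-c), (c,-c), (-c,c)}"

text \<open>A point at least as near as its six neighbours has the other point in its Voronoi hexagon; the bounds are sums of
two facet inequalities each.\<close>
lemma hex_nearest_bounds: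
  assumes "0 < c" and near: "\<forall>(k,l) \<in> hex_steps c. hex_dist s t i j \<le> hex_dist s t (i+k) (j+l)"
  shows "3*i - 3* s \<le> 2*c" "3* s - 3*i \<le> 2*c" "3*j - 3*t \<le> 2*c" "3*t - 3*j \<le> 2*c"
    "3*i + 3*j - 3* s - 3*t \<le> 2*c" "3* s + 3*t - 3*i - 3*j \<le> 2*c"
proof -
  have "c * (2*(s-i)+(t-j)) \<le> c * c" "c * (-(2*(s-i)+(t-j))) \<le> c * c"
    "c * ((s-i)+2*(t-j)) \<le> c * c" "c * (-((s-i)+2*(t-j))) \<le> c * c"
    "c * ((s-i)-(t-j)) \<le> c * c" "c * (-((s-i)-(t-j))) \<le> c * c"
    using near by (simp_all add: hex_steps_def hex_dist_def power2_eq_square algebra_simps)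
  then have "2*(s-i)+(t-j) \<le> c" "-(2*(s-i)+(t-j)) \<le> c" "(s-i)+2*(t-j) \<le> c" "-((s-i)+2*(t-j)) \<le> c"
     "(s-i)-(t-j) \<le> c" "-((s-i)-(t-j)) \<le> c"
    unfolding mult_le_cancel_left_pos[OF \<open>0 < c\<close>] .
  then show "3*i - 3* s \<le> 2*c" "3* s - 3*i \<le> 2*c" "3*j - 3*t \<le> 2*c" "3*t - 3*j \<le> 2*c"
    "3*i + 3*j - 3* s - 3*t \<le> 2*c" "3* s + 3*t - 3*i - 3*j \<le> 2*c"
    by (simp_all add: algebra_simps)
qed

lemma hex_dist_swap: "hex_dist s t i j = hex_dist t s j i"
  by (simp add: hex_dist_def)

lemma nearest_even_point_is_vertex:
  fixes s t :: real and i j :: int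
  assumes st: "0 \<le> s" "0 \<le> t" "s + t \<le> 2" and ev: "even i" "even j"
    and near: "\<forall>(k,l) \<in> hex_steps 2. hex_dist s t i j \<le> hex_dist s t (i+k) (j+l)"
  shows "(i, j) \<in> {(0,0), (2,0), (0,2)}"
proof -
  note b = hex_nearest_bounds[OF zero_less_numeral near]
  obtain i' j' where e: "i = 2 * i'" "j = 2 * j'" using ev by (auto elim!: evenE)
  then have r: "real_of_int i = 2 * real_of_int i'" "real_of_int j = 2 * real_of_int j'" by simp_all
  have "-1 < real_of_int i'" "real_of_int i' < 2" "-1 < real_of_int j'" "real_of_int j' < 2"
    "real_of_int i' + j' < 2"
    using b st r by - linarith+
  then have "i' \<in> {0,1}" "j' \<in> {0,1}" "i' + j' < 2" by auto
  then show ?thesis using e by auto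
qed

text \<open>The points with \<open>i\<close> odd and \<open>j\<close> even contain one midpoint of an edge of the triangle. Near the opposite corner another
such point may be nearer, but then the corner itself is nearer still; on the boundary this leaves two exceptional
cases, in which \<open>(s, t)\<close> is the midpoint of another edge.\<close>
lemma nearest_odd_point_is_midpoint:
  fixes s t :: real and i j :: int
  assumes st: "0 \<le> s" "0 \<le> t" "s + t \<le> 2" and par: "odd i" "even j"
    and near: "\<forall>(k,l) \<in> hex_steps 2. hex_dist s t i j \<le> hex_dist s t (i+k) (j+l)"
    and le: "hex_dist s t i j \<le> hex_dist s t 0 0" "hex_dist s t i j \<le> hex_dist s t 2 0" "hex_dist s t i j \<le> hex_dist s t 0 2"
  shows "i = 1 \<and> j = 0 \<or> s = 1 \<and> t = 1 \<and> i = 1 \<and> j = 2 \<or> s = 0 \<and> t = 1 \<and> i = -1 \<and> j = 2"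
proof -
  note b = hex_nearest_bounds[OF zero_less_numeral near]
  obtain i' j' where e: "i = 2 * i' + 1" "j = 2 * j'" using par by (auto elim!: evenE oddE)
  then have r: "real_of_int i = 2 * real_of_int i' + 1" "real_of_int j = 2 * real_of_int j'" by simp_all
  have "-2 < real_of_int i'" "real_of_int i' < 2" "-1 < real_of_int j'" "real_of_int j' < 2"
    using b st r by - linarith+
  then have ij: "i' = -1 \<or> i' = 0 \<or> i' = 1" "j' = 0 \<or> j' = 1" by - linarith+
  have l: "i * i + i * j + j * j \<le> i * (2* s+t) + j * (s+2*t)"
    "i * i + i * j + j * j \<le> i * (2* s+t) + j * (s+2*t) + (4 - 4* s - 2*t)"
    "i * i + i * j + j * j \<le> i * (2* s+t) + j * (s+2*t) + (4 - 2* s - 4*t)"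
    using le by (simp_all add: hex_dist_def power2_eq_square algebra_simps)
  from ij show ?thesis
  proof (elim disjE)
    assume "i' = -1" "j' = 1"
    then have "s = 0" "t = 1" using l st unfolding e by simp_all
    then show ?thesis using e \<open>i' = -1\<close> \<open>j' = 1\<close> by simp
  next
    assume "i' = 0" "j' = 1"
    then have "s = 1" "t = 1" using l st unfolding e by simp_all
    then show ?thesis using e \<open>i' = 0\<close> \<open>j' = 1\<close> by simp
  qed (use l st e in simp_all)
qed

lemma hex_nearest_points_adjacent:
  fixes i j i' j' :: int
  assumes "\<forall>(k,l) \<in> hex_steps 1. hex_dist s t i j \<le> hex_dist s t (i+k) (j+l)"
    and "\<forall>(k,l) \<in> hex_steps 1. hex_dist s t i' j' \<le> hex_dist s t (i'+k) (j'+l)"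
  shows "\<bar>i - i'\<bar> \<le> 1" "\<bar>j - j'\<bar> \<le> 1" "\<bar>(i + j) - (i' + j')\<bar> \<le> 1"
proof -
  note b = hex_nearest_bounds[OF zero_less_one assms(1)] hex_nearest_bounds[OF zero_less_one assms(2)]
  have "real_of_int (i - i') < 2" "real_of_int (i' - i) < 2" "real_of_int (j - j') < 2" "real_of_int (j' - j) < 2"
    "real_of_int ((i + j) - (i' + j')) < 2" "real_of_int ((i' + j') - (i + j)) < 2"
    using b unfolding of_int_diff of_int_add by - linarith+
  then show "\<bar>i - i'\<bar> \<le> 1" "\<bar>j - j'\<bar> \<le> 1" "\<bar>(i + j) - (i' + j')\<bar> \<le> 1" by - linarith+
qed

text \<open>Points of the hexagonal lattice nearest to a common point are pairwise adjacent, and there are no four pairwise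
adjacent points.\<close>
lemma no_four_nearest_classes:
  fixes i0 j0 i1 j1 i2 j2 i3 j3 :: int
  assumes par: "even i0" "even j0" "odd i1" "even j1" "even i2" "odd j2" "odd i3" "odd j3"
   and near: "\<And>i j :: int. (i,j) \<in> {(i0,j0),(i1,j1),(i2,j2),(i3,j3)} \<Longrightarrow>
      \<forall>(k,l) \<in> hex_steps 1. hex_dist s t i j \<le> hex_dist s t (i+k) (j+l)"
  shows False
proof -
  have d: "\<bar>i - i'\<bar> \<le> 1" "\<bar>j - j'\<bar> \<le> 1" "\<bar>(i + j) - (i' + j')\<bar> \<le> 1"
    if "(i,j) \<in> {(i0,j0),(i1,j1),(i2,j2),(i3,j3)}" "(i',j') \<in> {(i0,j0),(i1,j1),(i2,j2),(i3,j3)}" for i j i' j'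
    by (rule hex_nearest_points_adjacent[OF near[OF that(1)] near[OF that(2)]])+
  have same: "i = i'" if "\<bar>i - i'\<bar> \<le> 1" "even i = even i'" for i i' :: int using that by presburger
  have opp: "i = i' + 1 \<or> i = i' - 1" if "\<bar>i - i'\<bar> \<le> 1" "even i \<noteq> even i'" for i i' :: int using that by presburger
  have "i2 = i0" by (rule same[OF d(1)[of i2 j2 i0 j0]]) (use par in auto)
  moreover have "i3 = i1" by (rule same[OF d(1)[of i3 j3 i1 j1]]) (use par in auto)
  moreover have "j1 = j0" by (rule same[OF d(2)[of i1 j1 i0 j0]]) (use par in auto)
  moreover have "j3 = j2" by (rule same[OF d(2)[of i3 j3 i2 j2]]) (use par in auto)
  moreover have "i1 = i0 + 1 \<or> i1 = i0 - 1" by (rule opp[OF d(1)[of i1 j1 i0 j0]]) (use par in auto)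
  moreover have "j2 = j0 + 1 \<or> j2 = j0 - 1" by (rule opp[OF d(2)[of i2 j2 i0 j0]]) (use par in auto)
  moreover have "\<bar>(i1 + j1) - (i2 + j2)\<bar> \<le> 1" "\<bar>(i3 + j3) - (i0 + j0)\<bar> \<le> 1"
    by (rule d(3); simp)+
  ultimately show False by auto
qed
section \<open>The lattice E6 in layered coordinates\<close>

text \<open>The pairs \<open>(x, \<eta>)\<close> with \<open>x = (a, b, c, d)\<close> a Hurwitz quaternion and \<open>\<eta> = i h1 + j h2\<close>, of corresponding class. The class of \<open>x\<close> modulo
\<open>D4\<close> is given by whether the coordinates are half-integers and by the parity of their sum, the class of \<open>\<eta>\<close>
by the parities of \<open>j\<close> and \<open>i\<close>. The six integers are coordinates with respect to a lattice basis.\<close>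
definition E6_point :: "real \<Rightarrow> real \<Rightarrow> real \<Rightarrow> real \<Rightarrow> real \<Rightarrow> real \<Rightarrow> bool" where
  "E6_point a b c d i j \<longleftrightarrow> (\<exists>(A::int) (B::int) (C::int) (D::int) (M::int) (J::int). a = A + J/2 \<and> b = B + J/2 \<and> c = C + J/2 \<and> d = D + J/2
     \<and> i = real_of_int (A + B + C + D + 2 * M) \<and> j = real_of_int J)"

lemma E6_pointI:
  fixes A B C D M J :: int and a b c d i j :: real
  assumes "a = A + J/2" "b = B + J/2" "c = C + J/2" "d = D + J/2" "i = real_of_int (A + B + C + D + 2 * M)" "j = real_of_int J"
  shows "E6_point a b c d i j"
  unfolding E6_point_def using assms by blast

lemma E6_point_integral:
  fixes A B C D I J :: int
  assumes "even J" "even (A + B + C + D - I)"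
  shows "E6_point A B C D I J"
proof -
  obtain J' where J: "J = 2 * J'" using assms(1) by (rule evenE)
  obtain M where M: "A + B + C + D - I = 2 * M" using assms(2) by (rule evenE)
  have I: "I = A + B + C + D - 2 * M" using M by linarith
  show ?thesis
    by (rule E6_pointI[where A="A - J'" and B="B - J'" and C="C - J'" and D="D - J'" and M="2 * J' - M" and J=J])
       (simp_all add: I J)
qed

lemma E6_point_half_integral:
  fixes A B C D I J :: int
  assumes "odd J" "even (A + B + C + D - I)"
  shows "E6_point (A + 1/2) (B + 1/2) (C + 1/2) (D + 1/2) I J"
proof -
  obtain J' where J: "J = 2 * J' + 1" using assms(1) by (rule oddE)
  obtain M where M: "A + B + C + D - I = 2 * M" using assms(2) by (rule evenE)
  have I: "I = A + B + C + D - 2 * M" using M by linarith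
  show ?thesis
    by (rule E6_pointI[where A="A - J'" and B="B - J'" and C="C - J'" and D="D - J'" and M="2 * J' - M" and J=J])
       (simp_all add: I J add_divide_distrib)
qed

lemma E6_point_cases:
  fixes a b c d i j :: real
  assumes "E6_point a b c d i j"
  obtains A B C D I J :: int where "even J" "even (A + B + C + D - I)"
      "a = A" "b = B" "c = C" "d = D" "i = I" "j = J"
  | A B C D I J :: int where "odd J" "even (A + B + C + D - I)"
      "a = A + 1/2" "b = B + 1/2" "c = C + 1/2" "d = D + 1/2" "i = I" "j = J"
proof -
  from assms obtain A B C D M J :: int where e: "a = A + J/2" "b = B + J/2" "c = C + J/2" "d = D + J/2"
     "i = real_of_int (A + B + C + D + 2 * M)" "j = J" unfolding E6_point_def by blast
  show ?thesis
  proof (cases "even J")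
    case True
    then obtain J' where J: "J = 2 * J'" by (auto elim: evenE)
    show ?thesis
      by (rule that(1)[of J "A+J'" "B+J'" "C+J'" "D+J'" "A + B + C + D + 2 * M"]) (use e J in \<open>(simp | presburger)+\<close>)
  next
    case False
    then obtain J' where J: "J = 2 * J' + 1" by (auto elim: oddE)
    show ?thesis
      by (rule that(2)[of J "A+J'" "B+J'" "C+J'" "D+J'" "A + B + C + D + 2 * M"]) (use e J in \<open>(simp add: add_divide_distrib | presburger)+\<close>)
  qed
qed

text \<open>Over each of the three nonzero classes of \<open>\<eta>\<close> lie eight units of \<open>O\<close>: plus and minus an orthonormal frame. The
frames are named \<open>v\<close>, \<open>s\<close>, \<open>c\<close> after the vector and the two spinor classes of \<open>D4\<close>.\<close>
lemma E6_point_units_v: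
  fixes I J :: int
  assumes "odd I" "even J"
  shows "E6_point 1 0 0 0 I J" "E6_point (-1) 0 0 0 I J" "E6_point 0 1 0 0 I J" "E6_point 0 (-1) 0 0 I J"
    "E6_point 0 0 1 0 I J" "E6_point 0 0 (-1) 0 I J" "E6_point 0 0 0 1 I J" "E6_point 0 0 0 (-1) I J"
  using E6_point_integral[of J 1 0 0 0 I] E6_point_integral[of J "-1" 0 0 0 I] E6_point_integral[of J 0 1 0 0 I]
    E6_point_integral[of J 0 "-1" 0 0 I] E6_point_integral[of J 0 0 1 0 I] E6_point_integral[of J 0 0 "-1" 0 I]
    E6_point_integral[of J 0 0 0 1 I] E6_point_integral[of J 0 0 0 "-1" I] assms
  by simp_all

lemma E6_point_units_s:
  fixes I J :: int
  assumes "even I" "odd J"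
  shows "E6_point (1/2) (1/2) (1/2) (1/2) I J" "E6_point (-1/2) (-1/2) (-1/2) (-1/2) I J"
    "E6_point (1/2) (1/2) (-1/2) (-1/2) I J" "E6_point (-1/2) (-1/2) (1/2) (1/2) I J"
    "E6_point (1/2) (-1/2) (1/2) (-1/2) I J" "E6_point (-1/2) (1/2) (-1/2) (1/2) I J"
    "E6_point (1/2) (-1/2) (-1/2) (1/2) I J" "E6_point (-1/2) (1/2) (1/2) (-1/2) I J"
  using E6_point_half_integral[of J 0 0 0 0 I] E6_point_half_integral[of J "-1" "-1" "-1" "-1" I]
    E6_point_half_integral[of J 0 0 "-1" "-1" I] E6_point_half_integral[of J "-1" "-1" 0 0 I]
    E6_point_half_integral[of J 0 "-1" 0 "-1" I] E6_point_half_integral[of J "-1" 0 "-1" 0 I]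
    E6_point_half_integral[of J 0 "-1" "-1" 0 I] E6_point_half_integral[of J "-1" 0 0 "-1" I] assms
  by simp_all

lemma E6_point_units_c:
  fixes I J :: int
  assumes "odd I" "odd J"
  shows "E6_point (-1/2) (1/2) (1/2) (1/2) I J" "E6_point (1/2) (-1/2) (-1/2) (-1/2) I J"
    "E6_point (1/2) (-1/2) (1/2) (1/2) I J" "E6_point (-1/2) (1/2) (-1/2) (-1/2) I J"
    "E6_point (1/2) (1/2) (-1/2) (1/2) I J" "E6_point (-1/2) (-1/2) (1/2) (-1/2) I J"
    "E6_point (1/2) (1/2) (1/2) (-1/2) I J" "E6_point (-1/2) (-1/2) (-1/2) (1/2) I J"
  using E6_point_half_integral[of J "-1" 0 0 0 I] E6_point_half_integral[of J 0 "-1" "-1" "-1" I]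
    E6_point_half_integral[of J 0 "-1" 0 0 I] E6_point_half_integral[of J "-1" 0 "-1" "-1" I]
    E6_point_half_integral[of J 0 0 "-1" 0 I] E6_point_half_integral[of J "-1" "-1" 0 "-1" I]
    E6_point_half_integral[of J 0 0 0 "-1" I] E6_point_half_integral[of J "-1" "-1" "-1" 0 I] assms
  by simp_all

lemma E6_point_origin:
  fixes I J :: int
  assumes "even I" "even J"
  shows "E6_point 0 0 0 0 I J"
  using E6_point_integral[of J 0 0 0 0 I] assms by simp

lemma E6_point_step:
  assumes "E6_point a b c d i j" "(k,l) \<in> hex_steps 2"
  shows "E6_point a b c d (i + k) (j + l)"
  using assms(1)
proof (cases rule: E6_point_cases)
  case (1 A B C D I J)
  then show ?thesis
    using assms(2) E6_point_integral[of "J" A B C D "I+2"] E6_point_integral[of "J" A B C D "I-2"]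
     E6_point_integral[of "J+2" A B C D "I"] E6_point_integral[of "J-2" A B C D "I"]
     E6_point_integral[of "J-2" A B C D "I+2"] E6_point_integral[of "J+2" A B C D "I-2"]
    by (auto simp: hex_steps_def)
next
  case (2 A B C D I J)
  then show ?thesis
    using assms(2) E6_point_half_integral[of "J" A B C D "I+2"] E6_point_half_integral[of "J" A B C D "I-2"]
     E6_point_half_integral[of "J+2" A B C D "I"] E6_point_half_integral[of "J-2" A B C D "I"]
     E6_point_half_integral[of "J-2" A B C D "I+2"] E6_point_half_integral[of "J+2" A B C D "I-2"]
    by (auto simp: hex_steps_def)
qed

section \<open>Cells of the compressed form lie in cells of E6\<close>

text \<open>A zero of a nonzero class, in the frame of this class, with the triangle moved so that the midpoint of this
class is \<open>(1, 0)\<close>. Here \<open>x\<close> is nearest in its class, hence a unit; the corners of the triangle lie over the point 0 of \<open>O\<close>,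
which is nearest to the centre, so none of them is nearer to \<open>(s, t)\<close> than \<open>(i, j)\<close>. In the
exceptional cases a corner ties with \<open>(i, j)\<close>, which makes the coordinate of \<open>y\<close> at the unit equal to 1 in size; the last
four hypotheses, coming from the class of the midpoint \<open>(s, t)\<close>, bound it by \<open>4/5\<close>.\<close>
lemma class_zero_at_midpoint:
  fixes x1 x2 x3 x4 i j :: int and Y1 Y2 Y3 Y4 s t k :: real
  defines "g \<equiv> (real_of_int x1)\<^sup>2 - Y1 * x1 + ((real_of_int x2)\<^sup>2 - Y2 * x2)
              + ((real_of_int x3)\<^sup>2 - Y3 * x3) + ((real_of_int x4)\<^sup>2 - Y4 * x4)"
  assumes Y: "\<bar>Y1\<bar> \<le> 1" "\<bar>Y2\<bar> \<le> 1" "\<bar>Y3\<bar> \<le> 1" "\<bar>Y4\<bar> \<le> 1"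
    and Y_sum: "\<bar>Y1\<bar> + \<bar>Y2\<bar> + \<bar>Y3\<bar> + \<bar>Y4\<bar> \<le> 2"
    and odd: "odd (x1 + x2 + x3 + x4)"
    and st: "0 \<le> s" "0 \<le> t" "s + t \<le> 2" and par: "odd i" "even j"
    and zero: "5 * g + 3 * hex_dist s t i j + k = 0"
    and units: "0 \<le> 5 * (1 - \<bar>Y1\<bar>) + 3 * hex_dist s t i j + k" "0 \<le> 5 * (1 - \<bar>Y2\<bar>) + 3 * hex_dist s t i j + k"
      "0 \<le> 5 * (1 - \<bar>Y3\<bar>) + 3 * hex_dist s t i j + k" "0 \<le> 5 * (1 - \<bar>Y4\<bar>) + 3 * hex_dist s t i j + k"
    and near: "\<forall>(k,l) \<in> hex_steps 2. hex_dist s t i j \<le> hex_dist s t (i+k) (j+l)"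
    and vert: "0 \<le> 3 * hex_dist s t 0 0 + k" "0 \<le> 3 * hex_dist s t 2 0 + k" "0 \<le> 3 * hex_dist s t 0 2 + k"
    and tie: "s = 1 \<and> t = 1 \<or> s = 0 \<and> t = 1 \<Longrightarrow> 5 * \<bar>Y1\<bar> \<le> 10 + 2 * k"
      "s = 1 \<and> t = 1 \<or> s = 0 \<and> t = 1 \<Longrightarrow> 5 * \<bar>Y2\<bar> \<le> 10 + 2 * k"
      "s = 1 \<and> t = 1 \<or> s = 0 \<and> t = 1 \<Longrightarrow> 5 * \<bar>Y3\<bar> \<le> 10 + 2 * k"
      "s = 1 \<and> t = 1 \<or> s = 0 \<and> t = 1 \<Longrightarrow> 5 * \<bar>Y4\<bar> \<le> 10 + 2 * k"
  shows "x1\<^sup>2 + x2\<^sup>2 + x3\<^sup>2 + x4\<^sup>2 = 1 \<and> i = 1 \<and> j = 0"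
proof -
  have g0: "0 \<le> g"
    using int_quad_lower_bounds(1)[OF Y(1), of x1] int_quad_lower_bounds(1)[OF Y(2), of x2]
      int_quad_lower_bounds(1)[OF Y(3), of x3] int_quad_lower_bounds(1)[OF Y(4), of x4]
    unfolding g_def by simp
  have "g \<le> 1 - \<bar>Y1\<bar>" using units(1) zero by argo
  moreover have "g \<le> 1 - \<bar>Y2\<bar>" using units(2) zero by argo
  moreover have "g \<le> 1 - \<bar>Y3\<bar>" using units(3) zero by argo
  moreover have "g \<le> 1 - \<bar>Y4\<bar>" using units(4) zero by argo
  ultimately have unit: "x1\<^sup>2 + x2\<^sup>2 + x3\<^sup>2 + x4\<^sup>2 = 1"
    using nearest_odd_vector_is_unit[OF Y Y_sum odd] unfolding g_def by blast
  have le: "hex_dist s t i j \<le> hex_dist s t 0 0" "hex_dist s t i j \<le> hex_dist s t 2 0" "hex_dist s t i j \<le> hex_dist s t 0 2"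
    using vert zero g0 by - linarith+
  \<comment> \<open>In both exceptional cases \<open>(s, t)\<close> has distance 1 from \<open>(i, j)\<close> and from a corner of the triangle.\<close>
  have False if b: "s = 1 \<and> t = 1 \<and> i = 1 \<and> j = 2 \<or> s = 0 \<and> t = 1 \<and> i = -1 \<and> j = 2"
  proof -
    have "hex_dist s t i j = 1" "hex_dist s t 0 0 = 1 \<or> hex_dist s t 2 0 = 1" using b by (auto simp: hex_dist_def)
    then have "k \<ge> -3" "5 * g = -3 - k" using vert zero by auto
    then have "k = -3" "g = 0" using g0 by auto
    have st': "s = 1 \<and> t = 1 \<or> s = 0 \<and> t = 1" using b by blast
    note T = tie(1)[OF st'] tie(2)[OF st'] tie(3)[OF st'] tie(4)[OF st']
    have "\<not> (x1 = 0 \<and> x2 = 0 \<and> x3 = 0 \<and> x4 = 0)" using unit by auto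
    with tie_gives_unit_coordinate[OF Y, of x1 x2 x3 x4] \<open>g = 0\<close>
    have "\<bar>Y1\<bar> = 1 \<or> \<bar>Y2\<bar> = 1 \<or> \<bar>Y3\<bar> = 1 \<or> \<bar>Y4\<bar> = 1" unfolding g_def by simp
    then show False using T \<open>k = -3\<close> by auto
  qed
  with nearest_odd_point_is_midpoint[OF st par near le] unit show ?thesis by blast
qed

text \<open>The function of a cell of \<open>5 |x|^2 + 3 N(\<eta>)\<close> in completed form: its centre is \<open>(y / 2, s h1 + t h2)\<close>, and \<open>k\<close> absorbs the
constant.\<close>
definition layered_fun :: "real \<Rightarrow> real \<Rightarrow> real \<Rightarrow> real \<Rightarrow> real \<Rightarrow> real \<Rightarrow> real \<Rightarrow>
    real \<Rightarrow> real \<Rightarrow> real \<Rightarrow> real \<Rightarrow> real \<Rightarrow> real \<Rightarrow> real" where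
  "layered_fun y1 y2 y3 y4 s t k a b c d i j =
     5 * (a\<^sup>2 + b\<^sup>2 + c\<^sup>2 + d\<^sup>2 - (y1 * a + y2 * b + y3 * c + y4 * d)) + 3 * hex_dist s t i j + k"

lemma abs_half_sum:
  fixes p q r u x e :: real
  assumes x: "2 * x = p + q + r + u" and e: "5 * \<bar>p\<bar> \<le> e" "5 * \<bar>q\<bar> \<le> e" "5 * \<bar>r\<bar> \<le> e" "5 * \<bar>u\<bar> \<le> e"
  shows "5 * \<bar>x\<bar> \<le> 2 * e"
proof -
  have "\<bar>2 * x\<bar> \<le> \<bar>p\<bar> + \<bar>q\<bar> + \<bar>r\<bar> + \<bar>u\<bar>"
    unfolding x using abs_triangle_ineq[of "p + q + r" u] abs_triangle_ineq[of "p + q" r] abs_triangle_ineq[of p q]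
    by linarith
  moreover have "\<bar>2 * x\<bar> = 2 * \<bar>x\<bar>" by (simp add: abs_mult)
  ultimately show ?thesis using e by linarith
qed

text \<open>The 24-cell given by \<open>|y\<^sub>k| \<le> 1\<close> and \<open>\<Sum>|y\<^sub>k| \<le> 2\<close> is described by the same inequalities in the frame of
spinor units: the triality of \<open>D4\<close>.\<close>
lemma frame_bounds:
  fixes y1 y2 y3 y4 :: real
  assumes y: "\<bar>y1\<bar> \<le> 1" "\<bar>y2\<bar> \<le> 1" "\<bar>y3\<bar> \<le> 1" "\<bar>y4\<bar> \<le> 1"
    and sum: "\<bar>y1\<bar> + \<bar>y2\<bar> + \<bar>y3\<bar> + \<bar>y4\<bar> \<le> 2"
    and Y: "2 * Y1 = y1 + y2 + y3 + y4" "2 * Y2 = y1 + y2 - y3 - y4" "2 * Y3 = y1 - y2 + y3 - y4" "2 * Y4 = y1 - y2 - y3 + y4"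
  shows "\<bar>Y1\<bar> \<le> 1" "\<bar>Y2\<bar> \<le> 1" "\<bar>Y3\<bar> \<le> 1" "\<bar>Y4\<bar> \<le> 1" "\<bar>Y1\<bar> + \<bar>Y2\<bar> + \<bar>Y3\<bar> + \<bar>Y4\<bar> \<le> 2"
proof -
  have n: "- \<bar>y\<bar> \<le> y" "y \<le> \<bar>y\<bar>" for y :: real by simp_all
  note m = n[of y1] n[of y2] n[of y3] n[of y4]
  have e: "Y1 \<le> 1" "-Y1 \<le> 1" "Y2 \<le> 1" "-Y2 \<le> 1" "Y3 \<le> 1" "-Y3 \<le> 1" "Y4 \<le> 1" "-Y4 \<le> 1"
    using m sum Y by - linarith+
  then show "\<bar>Y1\<bar> \<le> 1" "\<bar>Y2\<bar> \<le> 1" "\<bar>Y3\<bar> \<le> 1" "\<bar>Y4\<bar> \<le> 1" by simp_all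
  have l: "y1 \<le> 1" "-y1 \<le> 1" "y2 \<le> 1" "-y2 \<le> 1" "y3 \<le> 1" "-y3 \<le> 1" "y4 \<le> 1" "-y4 \<le> 1"
    using y by simp_all
  have s: "y1 + y2 + y3 + y4 \<le> 2" "y1 + y2 + y3 - y4 \<le> 2" "y1 + y2 - y3 + y4 \<le> 2" "y1 + y2 - y3 - y4 \<le> 2"
    "y1 - y2 + y3 + y4 \<le> 2" "y1 - y2 + y3 - y4 \<le> 2" "y1 - y2 - y3 + y4 \<le> 2" "y1 - y2 - y3 - y4 \<le> 2"
    "- y1 + y2 + y3 + y4 \<le> 2" "- y1 + y2 + y3 - y4 \<le> 2" "- y1 + y2 - y3 + y4 \<le> 2" "- y1 + y2 - y3 - y4 \<le> 2"
    "- y1 - y2 + y3 + y4 \<le> 2" "- y1 - y2 + y3 - y4 \<le> 2" "- y1 - y2 - y3 + y4 \<le> 2" "- y1 - y2 - y3 - y4 \<le> 2"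
    using m sum by - linarith+
  have "\<bar>Y1\<bar> = Y1 \<or> \<bar>Y1\<bar> = - Y1" "\<bar>Y2\<bar> = Y2 \<or> \<bar>Y2\<bar> = - Y2" "\<bar>Y3\<bar> = Y3 \<or> \<bar>Y3\<bar> = - Y3" "\<bar>Y4\<bar> = Y4 \<or> \<bar>Y4\<bar> = - Y4"
    by (simp_all add: abs_if)
  then show "\<bar>Y1\<bar> + \<bar>Y2\<bar> + \<bar>Y3\<bar> + \<bar>Y4\<bar> \<le> 2"
    by (elim disjE) (use l s Y in linarith)+
qed

text \<open>The reflection of the triangle \<open>0, 2 h1, 2 h2\<close> that exchanges \<open>0\<close> and \<open>2 h2\<close>. Together with the swap of the
coordinates it moves every edge midpoint to \<open>h1\<close>, so that one of the three nonzero classes stands for all.\<close>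
lemma hex_dist_reflect:  "hex_dist s t i j = hex_dist s (2 - s - t) i (2 - i - j)"
  by (simp add: hex_dist_def power2_eq_square algebra_simps)

lemma scaled_difference_regroup:
  fixes N L h k :: real
  assumes "P1 + P2 + P3 + P4 = N" "Q1 + Q2 + Q3 + Q4 = L" "5 * (N - L) + h + k = 0"
  shows "5 * (P1 - Q1 + (P2 - Q2) + (P3 - Q3) + (P4 - Q4)) + h + k = 0"
  using assms(3) unfolding assms(1,2)[symmetric] by (simp add: algebra_simps)

lemma of_int_sum_squares:
  fixes p q r u :: int
  assumes "p\<^sup>2 + q\<^sup>2 + r\<^sup>2 + u\<^sup>2 = 1"
  shows "(real_of_int p)\<^sup>2 + (real_of_int q)\<^sup>2 + (real_of_int r)\<^sup>2 + (real_of_int u)\<^sup>2 = 1"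
proof -
  have "real_of_int (p\<^sup>2 + q\<^sup>2 + r\<^sup>2 + u\<^sup>2) = 1" unfolding assms by simp
  then show ?thesis by simp
qed

text \<open>The quadratic expression in the conclusion is the function of the Schlaefli polytope centred at the
centroid of the triangle. A zero of trivial class sits at a corner of the triangle; each other class is brought to the
standard position of \<open>class_zero_at_midpoint\<close> by its own frame and a symmetry of the triangle.\<close>
lemma zero_in_cell:
  fixes y1 y2 y3 y4 s t k a b c d i j :: real
  defines "F \<equiv> layered_fun y1 y2 y3 y4 s t k"
  assumes nonneg: "\<And>a b c d i j. E6_point a b c d i j \<Longrightarrow> 0 \<le> F a b c d i j"
    and y: "\<bar>y1\<bar> \<le> 1" "\<bar>y2\<bar> \<le> 1" "\<bar>y3\<bar> \<le> 1" "\<bar>y4\<bar> \<le> 1"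
    and y_sum: "\<bar>y1\<bar> + \<bar>y2\<bar> + \<bar>y3\<bar> + \<bar>y4\<bar> \<le> 2"
    and st: "0 \<le> s" "0 \<le> t" "s + t \<le> 2"
    and uniq: "\<And>a b c d (i::int) (j::int). E6_point a b c d i j \<Longrightarrow> even i \<Longrightarrow> even j \<Longrightarrow> F a b c d i j = 0
        \<Longrightarrow> a = 0 \<and> b = 0 \<and> c = 0 \<and> d = 0"
    and z: "E6_point a b c d i j" "F a b c d i j = 0"
  shows "a\<^sup>2 + b\<^sup>2 + c\<^sup>2 + d\<^sup>2 + i\<^sup>2 + i * j + j\<^sup>2 - 2 * i - 2 * j = 0"
proof -
  have near: "\<forall>(k,l) \<in> hex_steps 2. hex_dist s t i j \<le> hex_dist s t (i+k) (j+l)"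
  proof clarify
    fix k' l assume "(k', l) \<in> hex_steps 2"
    from nonneg[OF E6_point_step[OF z(1) this]] z(2) show "hex_dist s t i j \<le> hex_dist s t (i+k') (j+l)"
      unfolding F_def layered_fun_def by linarith
  qed
  have v: "0 \<le> 3 * hex_dist s t 0 0 + k" "0 \<le> 3 * hex_dist s t 2 0 + k" "0 \<le> 3 * hex_dist s t 0 2 + k"
    using nonneg[OF E6_point_origin[of 0 0]] nonneg[OF E6_point_origin[of 2 0]] nonneg[OF E6_point_origin[of 0 2]]
    by (simp_all add: F_def layered_fun_def)
  have uv: "5 * \<bar>y1\<bar> \<le> 5 + 3 * hex_dist s t I J + k" "5 * \<bar>y2\<bar> \<le> 5 + 3 * hex_dist s t I J + k"
    "5 * \<bar>y3\<bar> \<le> 5 + 3 * hex_dist s t I J + k" "5 * \<bar>y4\<bar> \<le> 5 + 3 * hex_dist s t I J + k"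
    if "odd I" "even J" for I J :: int
    using E6_point_units_v[OF that, THEN nonneg] unfolding F_def layered_fun_def by (simp_all add: abs_if)
  define S1 S2 S3 S4 C1 C2 C3 C4 where S_def: "S1 = (y1 + y2 + y3 + y4) / 2" "S2 = (y1 + y2 - y3 - y4) / 2"
      "S3 = (y1 - y2 + y3 - y4) / 2" "S4 = (y1 - y2 - y3 + y4) / 2"
    and C_def: "C1 = (- y1 + y2 + y3 + y4) / 2" "C2 = (y1 - y2 + y3 + y4) / 2"
      "C3 = (y1 + y2 - y3 + y4) / 2" "C4 = (y1 + y2 + y3 - y4) / 2"
  have us: "5 * \<bar>S1\<bar> \<le> 5 + 3 * hex_dist s t I J + k" "5 * \<bar>S2\<bar> \<le> 5 + 3 * hex_dist s t I J + k"
    "5 * \<bar>S3\<bar> \<le> 5 + 3 * hex_dist s t I J + k" "5 * \<bar>S4\<bar> \<le> 5 + 3 * hex_dist s t I J + k"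
    if "even I" "odd J" for I J :: int
    using E6_point_units_s[OF that, THEN nonneg] unfolding F_def layered_fun_def S_def
    by (simp_all add: abs_if power2_eq_square field_simps)
  have uc: "5 * \<bar>C1\<bar> \<le> 5 + 3 * hex_dist s t I J + k" "5 * \<bar>C2\<bar> \<le> 5 + 3 * hex_dist s t I J + k"
    "5 * \<bar>C3\<bar> \<le> 5 + 3 * hex_dist s t I J + k" "5 * \<bar>C4\<bar> \<le> 5 + 3 * hex_dist s t I J + k"
    if "odd I" "odd J" for I J :: int
    using E6_point_units_c[OF that, THEN nonneg] unfolding F_def layered_fun_def C_def
    by (simp_all add: abs_if power2_eq_square field_simps)
  have SY: "2 * S1 = y1 + y2 + y3 + y4" "2 * S2 = y1 + y2 - y3 - y4" "2 * S3 = y1 - y2 + y3 - y4" "2 * S4 = y1 - y2 - y3 + y4"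
    by (simp_all add: S_def)
  have Sb: "\<bar>S1\<bar> \<le> 1" "\<bar>S2\<bar> \<le> 1" "\<bar>S3\<bar> \<le> 1" "\<bar>S4\<bar> \<le> 1" "\<bar>S1\<bar> + \<bar>S2\<bar> + \<bar>S3\<bar> + \<bar>S4\<bar> \<le> 2"
    by (rule frame_bounds[OF y y_sum SY])+
  have CY: "2 * C1 = - y1 + y2 + y3 + y4" "2 * - C2 = - y1 + y2 - y3 - y4" "2 * - C3 = - y1 - y2 + y3 - y4" "2 * - C4 = - y1 - y2 - y3 + y4"
    unfolding C_def by (simp_all add: field_simps)
  have ny: "\<bar>- y1\<bar> \<le> 1" "\<bar>- y1\<bar> + \<bar>y2\<bar> + \<bar>y3\<bar> + \<bar>y4\<bar> \<le> 2" using y y_sum by simp_all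
  have Cb: "\<bar>C1\<bar> \<le> 1" "\<bar>C2\<bar> \<le> 1" "\<bar>C3\<bar> \<le> 1" "\<bar>C4\<bar> \<le> 1" "\<bar>C1\<bar> + \<bar>C2\<bar> + \<bar>C3\<bar> + \<bar>C4\<bar> \<le> 2"
    using frame_bounds[OF ny(1) y(2-4) ny(2) CY] by (simp_all only: abs_minus_cancel)
  have tv: "5 * \<bar>Y\<bar> \<le> 10 + 2 * k" if "s = 1" "t = 0" "Y \<in> {S1,S2,S3,S4,C1,C2,C3,C4}" for Y
  proof -
    have h: "hex_dist s t 1 0 = 0" using that by (simp add: hex_dist_def)
    have u: "5 * \<bar>y1\<bar> \<le> 5 + k" "5 * \<bar>y2\<bar> \<le> 5 + k" "5 * \<bar>y3\<bar> \<le> 5 + k" "5 * \<bar>y4\<bar> \<le> 5 + k"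
      using uv[of 1 0] h by simp_all
    have u': "5 * \<bar>- y1\<bar> \<le> 5 + k" "5 * \<bar>- y2\<bar> \<le> 5 + k" "5 * \<bar>- y3\<bar> \<le> 5 + k" "5 * \<bar>- y4\<bar> \<le> 5 + k" using u by simp_all
    have "5 * \<bar>S1\<bar> \<le> 2 * (5 + k)" by (rule abs_half_sum[OF _ u(1,2,3,4)]) (simp add: S_def C_def field_simps)
    moreover have "5 * \<bar>S2\<bar> \<le> 2 * (5 + k)" by (rule abs_half_sum[OF _ u(1,2) u'(3,4)]) (simp add: S_def C_def field_simps)
    moreover have "5 * \<bar>S3\<bar> \<le> 2 * (5 + k)" by (rule abs_half_sum[OF _ u(1) u'(2) u(3) u'(4)]) (simp add: S_def C_def field_simps)
    moreover have "5 * \<bar>S4\<bar> \<le> 2 * (5 + k)" by (rule abs_half_sum[OF _ u(1) u'(2,3) u(4)]) (simp add: S_def C_def field_simps)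
    moreover have "5 * \<bar>C1\<bar> \<le> 2 * (5 + k)" by (rule abs_half_sum[OF _ u'(1) u(2,3,4)]) (simp add: S_def C_def field_simps)
    moreover have "5 * \<bar>C2\<bar> \<le> 2 * (5 + k)" by (rule abs_half_sum[OF _ u(1) u'(2) u(3,4)]) (simp add: S_def C_def field_simps)
    moreover have "5 * \<bar>C3\<bar> \<le> 2 * (5 + k)" by (rule abs_half_sum[OF _ u(1,2) u'(3) u(4)]) (simp add: S_def C_def field_simps)
    moreover have "5 * \<bar>C4\<bar> \<le> 2 * (5 + k)" by (rule abs_half_sum[OF _ u(1,2,3) u'(4)]) (simp add: S_def C_def field_simps)
    ultimately have "5 * \<bar>Y\<bar> \<le> 2 * (5 + k)" using that(3) by (elim insertE emptyE) (simp_all only:)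
    then show ?thesis by (simp add: distrib_left)
  qed
  have ts: "5 * \<bar>Y\<bar> \<le> 10 + 2 * k" if "s = 0" "t = 1" "Y \<in> {y1,y2,y3,y4,C1,C2,C3,C4}" for Y
  proof -
    have h: "hex_dist s t 0 1 = 0" using that by (simp add: hex_dist_def)
    have u: "5 * \<bar>S1\<bar> \<le> 5 + k" "5 * \<bar>S2\<bar> \<le> 5 + k" "5 * \<bar>S3\<bar> \<le> 5 + k" "5 * \<bar>S4\<bar> \<le> 5 + k"
      using us[of 0 1] h by simp_all
    have u': "5 * \<bar>- S1\<bar> \<le> 5 + k" "5 * \<bar>- S2\<bar> \<le> 5 + k" "5 * \<bar>- S3\<bar> \<le> 5 + k" "5 * \<bar>- S4\<bar> \<le> 5 + k" using u by simp_all
    have "5 * \<bar>y1\<bar> \<le> 2 * (5 + k)" by (rule abs_half_sum[OF _ u(1,2,3,4)]) (simp add: S_def C_def field_simps)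
    moreover have "5 * \<bar>y2\<bar> \<le> 2 * (5 + k)" by (rule abs_half_sum[OF _ u(1,2) u'(3,4)]) (simp add: S_def C_def field_simps)
    moreover have "5 * \<bar>y3\<bar> \<le> 2 * (5 + k)" by (rule abs_half_sum[OF _ u(1) u'(2) u(3) u'(4)]) (simp add: S_def C_def field_simps)
    moreover have "5 * \<bar>y4\<bar> \<le> 2 * (5 + k)" by (rule abs_half_sum[OF _ u(1) u'(2,3) u(4)]) (simp add: S_def C_def field_simps)
    moreover have "5 * \<bar>C1\<bar> \<le> 2 * (5 + k)" by (rule abs_half_sum[OF _ u(1) u'(2,3,4)]) (simp add: S_def C_def field_simps)
    moreover have "5 * \<bar>C2\<bar> \<le> 2 * (5 + k)" by (rule abs_half_sum[OF _ u(1) u'(2) u(3,4)]) (simp add: S_def C_def field_simps)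
    moreover have "5 * \<bar>C3\<bar> \<le> 2 * (5 + k)" by (rule abs_half_sum[OF _ u(1,2) u'(3) u(4)]) (simp add: S_def C_def field_simps)
    moreover have "5 * \<bar>C4\<bar> \<le> 2 * (5 + k)" by (rule abs_half_sum[OF _ u(1,2,3) u'(4)]) (simp add: S_def C_def field_simps)
    ultimately have "5 * \<bar>Y\<bar> \<le> 2 * (5 + k)" using that(3) by (elim insertE emptyE) (simp_all only:)
    then show ?thesis by (simp add: distrib_left)
  qed
  have tc: "5 * \<bar>Y\<bar> \<le> 10 + 2 * k" if "s = 1" "t = 1" "Y \<in> {y1,y2,y3,y4,S1,S2,S3,S4}" for Y
  proof -
    have h: "hex_dist s t 1 1 = 0" using that by (simp add: hex_dist_def)
    have u: "5 * \<bar>C1\<bar> \<le> 5 + k" "5 * \<bar>C2\<bar> \<le> 5 + k" "5 * \<bar>C3\<bar> \<le> 5 + k" "5 * \<bar>C4\<bar> \<le> 5 + k"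
      using uc[of 1 1] h by simp_all
    have u': "5 * \<bar>- C1\<bar> \<le> 5 + k" "5 * \<bar>- C2\<bar> \<le> 5 + k" "5 * \<bar>- C3\<bar> \<le> 5 + k" "5 * \<bar>- C4\<bar> \<le> 5 + k" using u by simp_all
    have "5 * \<bar>y1\<bar> \<le> 2 * (5 + k)" by (rule abs_half_sum[OF _ u'(1) u(2,3,4)]) (simp add: S_def C_def field_simps)
    moreover have "5 * \<bar>y2\<bar> \<le> 2 * (5 + k)" by (rule abs_half_sum[OF _ u(1) u'(2) u(3,4)]) (simp add: S_def C_def field_simps)
    moreover have "5 * \<bar>y3\<bar> \<le> 2 * (5 + k)" by (rule abs_half_sum[OF _ u(1,2) u'(3) u(4)]) (simp add: S_def C_def field_simps)
    moreover have "5 * \<bar>y4\<bar> \<le> 2 * (5 + k)" by (rule abs_half_sum[OF _ u(1,2,3) u'(4)]) (simp add: S_def C_def field_simps)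
    moreover have "5 * \<bar>S1\<bar> \<le> 2 * (5 + k)" by (rule abs_half_sum[OF _ u(1,2,3,4)]) (simp add: S_def C_def field_simps)
    moreover have "5 * \<bar>S2\<bar> \<le> 2 * (5 + k)" by (rule abs_half_sum[OF _ u'(1,2) u(3,4)]) (simp add: S_def C_def field_simps)
    moreover have "5 * \<bar>S3\<bar> \<le> 2 * (5 + k)" by (rule abs_half_sum[OF _ u'(1) u(2) u'(3) u(4)]) (simp add: S_def C_def field_simps)
    moreover have "5 * \<bar>S4\<bar> \<le> 2 * (5 + k)" by (rule abs_half_sum[OF _ u'(1) u(2,3) u'(4)]) (simp add: S_def C_def field_simps)
    ultimately have "5 * \<bar>Y\<bar> \<le> 2 * (5 + k)" using that(3) by (elim insertE emptyE) (simp_all only:)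
    then show ?thesis by (simp add: distrib_left)
  qed
  show ?thesis
    using z(1)
  proof (cases rule: E6_point_cases)
    case (1 A B C D I J)
    show ?thesis
    proof (cases "even I")
      case True
      have "a = 0 \<and> b = 0 \<and> c = 0 \<and> d = 0"
        using uniq[of a b c d I J] z True 1 by simp
      moreover have "(I, J) \<in> {(0,0), (2,0), (0,2)}"
        by (rule nearest_even_point_is_vertex[OF st True 1(1)]) (use near 1 in simp)
      ultimately show ?thesis using 1 by auto
    next
      case False
      have "A\<^sup>2 + B\<^sup>2 + C\<^sup>2 + D\<^sup>2 = 1 \<and> I = 1 \<and> J = 0"
      proof (rule class_zero_at_midpoint[of y1 y2 y3 y4 A B C D s t I J k, OF y y_sum _ st False 1(1)])
        show "odd (A + B + C + D)" using 1(2) False by simp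
        show "5 * ((real_of_int A)\<^sup>2 - y1 * A + ((real_of_int B)\<^sup>2 - y2 * B) + ((real_of_int C)\<^sup>2 - y3 * C)
            + ((real_of_int D)\<^sup>2 - y4 * D)) + 3 * hex_dist s t I J + k = 0"
          using z(2) 1 unfolding F_def layered_fun_def by (simp add: algebra_simps)
        show "\<forall>(k,l) \<in> hex_steps 2. hex_dist s t I J \<le> hex_dist s t (I+k) (J+l)" using near 1 by simp
      qed (use uv[OF False 1(1)] v tc ts in \<open>auto\<close>)
      moreover from this have "(real_of_int A)\<^sup>2 + (real_of_int B)\<^sup>2 + (real_of_int C)\<^sup>2 + (real_of_int D)\<^sup>2 = 1"
        by (intro of_int_sum_squares) blast
      ultimately show ?thesis using 1 by simp
    qed
  next
    case (2 A B C D I J)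
    show ?thesis
    proof (cases "even I")
      case True
      have "even (A + B + C + D)" using 2(2) True by simp
      then obtain m where m: "A + B + C + D = 2 * m" by (rule evenE)
      have A: "A = 2 * m - B - C - D" using m by linarith
      have r: "(real_of_int (m + 1))\<^sup>2 + (real_of_int (m - C - D))\<^sup>2 + (real_of_int (m - B - D))\<^sup>2 + (real_of_int (m - B - C))\<^sup>2
           = a\<^sup>2 + b\<^sup>2 + c\<^sup>2 + d\<^sup>2"
        unfolding 2 A by (simp add: power2_eq_square field_simps)
      have "(m + 1)\<^sup>2 + (m - C - D)\<^sup>2 + (m - B - D)\<^sup>2 + (m - B - C)\<^sup>2 = 1 \<and> J = 1 \<and> I = 0"
      proof (rule class_zero_at_midpoint[of S1 S2 S3 S4 "m + 1" "m - C - D" "m - B - D" "m - B - C" t s J I k, OF Sb _ st(2,1) _ 2(1) True])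
        show "odd (m + 1 + (m - C - D) + (m - B - D) + (m - B - C))" by simp
        show "t + s \<le> 2" using st by simp
        have "S1 * (m + 1) + S2 * (m - C - D) + S3 * (m - B - D) + S4 * (m - B - C) = y1 * a + y2 * b + y3 * c + y4 * d"
          unfolding 2 A S_def by (simp add: field_simps)
        then show "5 * ((real_of_int (m + 1))\<^sup>2 - S1 * (m + 1) + ((real_of_int (m - C - D))\<^sup>2 - S2 * (m - C - D))
           + ((real_of_int (m - B - D))\<^sup>2 - S3 * (m - B - D))
            + ((real_of_int (m - B - C))\<^sup>2 - S4 * (m - B - C))) + 3 * hex_dist t s J I + k = 0"
          by (rule scaled_difference_regroup[OF r]) (use z(2) 2(7,8) in \<open>simp only: F_def layered_fun_def hex_dist_swap[of t s J I]\<close>)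
        show "\<forall>(k,l) \<in> hex_steps 2. hex_dist t s J I \<le> hex_dist t s (J+k) (I+l)" using near 2(7,8)
          unfolding hex_dist_swap[of t s] hex_steps_def by auto
      qed (use us[OF True 2(1)] v tc tv in \<open>auto simp: hex_dist_swap[of t s]\<close>)
      moreover from this have "(real_of_int (m + 1))\<^sup>2 + (real_of_int (m - C - D))\<^sup>2 + (real_of_int (m - B - D))\<^sup>2 + (real_of_int (m - B - C))\<^sup>2 = 1"
        by (intro of_int_sum_squares) blast
      ultimately show ?thesis using r 2(7,8) by simp
    next
      case False
      have "odd (A + B + C + D)" using 2(2) False by simp
      then obtain m where m: "A + B + C + D = 2 * m + 1" by (rule oddE)
      have A: "A = 2 * m + 1 - B - C - D" using m by linarith
      have r: "(real_of_int (m + 1 - A))\<^sup>2 + (real_of_int (m + 1 - B))\<^sup>2 + (real_of_int (m + 1 - C))\<^sup>2 + (real_of_int (m + 1 - D))\<^sup>2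
           = a\<^sup>2 + b\<^sup>2 + c\<^sup>2 + d\<^sup>2"
        unfolding 2 A by (simp add: power2_eq_square field_simps)
      have "(m + 1 - A)\<^sup>2 + (m + 1 - B)\<^sup>2 + (m + 1 - C)\<^sup>2 + (m + 1 - D)\<^sup>2 = 1 \<and> I = 1 \<and> 2 - I - J = 0"
      proof (rule class_zero_at_midpoint[of C1 C2 C3 C4 "m + 1 - A" "m + 1 - B" "m + 1 - C" "m + 1 - D" s "2 - s - t" I "2 - I - J" k, OF Cb _ st(1) _ _ False])
        show "odd (m + 1 - A + (m + 1 - B) + (m + 1 - C) + (m + 1 - D))" unfolding A by simp
        show "0 \<le> 2 - s - t" "s + (2 - s - t) \<le> 2" "even (2 - I - J)" using st False 2(1) by simp_all
        have "C1 * (m + 1 - A) + C2 * (m + 1 - B) + C3 * (m + 1 - C) + C4 * (m + 1 - D) = y1 * a + y2 * b + y3 * c + y4 * d"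
          unfolding 2 A C_def by (simp add: field_simps)
        moreover have "hex_dist s (2 - s - t) I (real_of_int (2 - I - J)) = hex_dist s t i j"
          using hex_dist_reflect[of s t i j] 2(7,8) by simp
        ultimately show "5 * ((real_of_int (m + 1 - A))\<^sup>2 - C1 * (m + 1 - A) + ((real_of_int (m + 1 - B))\<^sup>2 - C2 * (m + 1 - B))
           + ((real_of_int (m + 1 - C))\<^sup>2 - C3 * (m + 1 - C))
            + ((real_of_int (m + 1 - D))\<^sup>2 - C4 * (m + 1 - D))) + 3 * hex_dist s (2 - s - t) I (real_of_int (2 - I - J)) + k = 0"
          by (intro scaled_difference_regroup[OF r]) (use z(2) in \<open>simp_all only: F_def layered_fun_def\<close>)
        show "\<forall>(k,l) \<in> hex_steps 2. hex_dist s (2 - s - t) I (real_of_int (2 - I - J)) \<le> hex_dist s (2 - s - t) (I+k) (real_of_int (2 - I - J)+l)"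
          using near 2(7,8) unfolding hex_dist_reflect[of s "2 - s - t"] hex_steps_def by (auto simp: algebra_simps)
      qed (use uc[OF False 2(1)] v ts tv in \<open>auto simp: hex_dist_reflect[of s "2 - s - t"]\<close>)
      moreover from this have "(real_of_int (m + 1 - A))\<^sup>2 + (real_of_int (m + 1 - B))\<^sup>2 + (real_of_int (m + 1 - C))\<^sup>2 + (real_of_int (m + 1 - D))\<^sup>2 = 1"
        by (intro of_int_sum_squares) blast
      moreover from calculation have "J = 1" by simp
      ultimately show ?thesis using r 2(7,8) by simp
    qed
  qed
qed

lemma hex_int_ineq:
  fixes p q :: int
  shows "0 \<le> p\<^sup>2 + p * q + q\<^sup>2 - p - q"
proof -
  have "2 * p\<^sup>2 + 2 * (p * q) + 2 * q\<^sup>2 - 2 * p - 2 * q = (p + q - 1)\<^sup>2 + p\<^sup>2 + q\<^sup>2 - 1"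
    by (simp add: power2_eq_square algebra_simps)
  moreover have "1 \<le> (p + q - 1)\<^sup>2 + p\<^sup>2 + q\<^sup>2"
  proof (cases "p = 0 \<and> q = 0")
    case False
    then have "p\<^sup>2 + q\<^sup>2 \<noteq> 0" by (simp add: sum_power2_eq_zero_iff)
    moreover have "0 \<le> p\<^sup>2 + q\<^sup>2" "0 \<le> (p + q - 1)\<^sup>2" by simp_all
    ultimately show ?thesis by linarith
  qed simp
  ultimately show ?thesis by linarith
qed

lemma hex_int_ineq_shifted:
  fixes p q :: int
  shows "-1 \<le> p\<^sup>2 + p * q + q\<^sup>2 - 2 * p - 2 * q"
proof -
  have "4 * p\<^sup>2 + 4 * (p * q) + 4 * q\<^sup>2 - 8 * p - 8 * q = (2 * p + q - 2)\<^sup>2 + 3 * q\<^sup>2 - 4 * q - 4"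
    by (simp add: power2_eq_square algebra_simps)
  moreover have "-1 \<le> 3 * q\<^sup>2 - 4 * q"
  proof -
    have "q \<le> 0 \<or> 1 \<le> q" by linarith
    then have "0 \<le> (3 * q - 1) * (q - 1)" by (auto simp: zero_le_mult_iff)
    then show ?thesis by (simp add: power2_eq_square algebra_simps)
  qed
  moreover have "0 \<le> (2 * p + q - 2)\<^sup>2" by simp
  ultimately show ?thesis by linarith
qed

text \<open>The function of a Schlaefli polytope of \<open>E6\<close>, centred over the centroid of the triangle \<open>0, 2 h1, 2 h2\<close>. Over \<open>x = 0\<close>
it is nonnegative on \<open>2H\<close> with the corners as zeros; elsewhere \<open>|x|^2 \<ge> 1\<close> compensates the minimum \<open>-1\<close> of the other part.\<close>
lemma hole_function_nonneg:
  assumes "E6_point a b c d i j"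
  shows "0 \<le> a\<^sup>2 + b\<^sup>2 + c\<^sup>2 + d\<^sup>2 + i\<^sup>2 + i * j + j\<^sup>2 - 2 * i - 2 * j"
proof -
  have h: "-1 \<le> (real_of_int p)\<^sup>2 + p * q + (real_of_int q)\<^sup>2 - 2 * p - 2 * q" for p q :: int
  proof -
    have "real_of_int (-1) \<le> real_of_int (p\<^sup>2 + p * q + q\<^sup>2 - 2 * p - 2 * q)"
      using hex_int_ineq_shifted[of p q] by (simp only: of_int_le_iff)
    then show ?thesis by simp
  qed
  from assms show ?thesis
  proof (cases rule: E6_point_cases)
    case (1 A B C D I J)
    show ?thesis
    proof (cases "A = 0 \<and> B = 0 \<and> C = 0 \<and> D = 0")
      case True
      then have "even I" using 1(2) by simp
      then obtain p where p: "I = 2 * p" by (rule evenE)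
      obtain q where q: "J = 2 * q" using 1(1) by (rule evenE)
      have "0 \<le> real_of_int (4 * (p\<^sup>2 + p * q + q\<^sup>2 - p - q))"
        by (intro of_int_nonneg mult_nonneg_nonneg hex_int_ineq) simp
      then show ?thesis using True 1(3-8) p q by (simp add: power2_eq_square algebra_simps)
    next
      case False
      then have "A\<^sup>2 + B\<^sup>2 + C\<^sup>2 + D\<^sup>2 \<noteq> 0"
        by (simp add: add_nonneg_eq_0_iff)
      moreover have "0 \<le> A\<^sup>2 + B\<^sup>2 + C\<^sup>2 + D\<^sup>2" by simp
      ultimately have "1 \<le> A\<^sup>2 + B\<^sup>2 + C\<^sup>2 + D\<^sup>2" by linarith
      then have "real_of_int 1 \<le> real_of_int (A\<^sup>2 + B\<^sup>2 + C\<^sup>2 + D\<^sup>2)" by (simp only: of_int_le_iff)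
      then show ?thesis using h[of I J] 1(3-8) by simp
    qed
  next
    case (2 A B C D I J)
    have "1/4 \<le> (real_of_int n + 1/2)\<^sup>2" for n :: int
    proof -
      have "0 \<le> n \<or> n \<le> -1" by linarith
      then have "0 \<le> n * (n + 1)" by (auto simp: zero_le_mult_iff)
      then have "real_of_int 0 \<le> real_of_int (n * (n + 1))" by (simp only: of_int_le_iff)
      then show ?thesis by (simp add: power2_eq_square algebra_simps)
    qed
    from this[of A] this[of B] this[of C] this[of D] show ?thesis using h[of I J] 2(3-8) by simp
  qed
qed

lemma E6_point_add:
  assumes "E6_point a b c d i j" "E6_point a' b' c' d' i' j'"
  shows "E6_point (a + a') (b + b') (c + c') (d + d') (i + i') (j + j')"
proof -
  from assms(1) obtain A B C D M J :: int where 1: "a = A + J/2" "b = B + J/2" "c = C + J/2" "d = D + J/2"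
     "i = real_of_int (A + B + C + D + 2 * M)" "j = real_of_int J" unfolding E6_point_def by blast
  from assms(2) obtain A' B' C' D' M' J' :: int where 2: "a' = A' + J'/2" "b' = B' + J'/2" "c' = C' + J'/2" "d' = D' + J'/2"
     "i' = real_of_int (A' + B' + C' + D' + 2 * M')" "j' = real_of_int J'" unfolding E6_point_def by blast
  show ?thesis
    by (rule E6_pointI[where A="A + A'" and B="B + B'" and C="C + C'" and D="D + D'" and M="M + M'" and J="J + J'"])
      (simp_all add: 1 2 add_divide_distrib)
qed

lemma E6_point_minus:
  assumes "E6_point a b c d i j"
  shows "E6_point (- a) (- b) (- c) (- d) (- i) (- j)"
proof -
  from assms(1) obtain A B C D M J :: int where 1: "a = A + J/2" "b = B + J/2" "c = C + J/2" "d = D + J/2"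
     "i = real_of_int (A + B + C + D + 2 * M)" "j = real_of_int J" unfolding E6_point_def by blast
  show ?thesis
    by (rule E6_pointI[where A="- A" and B="- B" and C="- C" and D="- D" and M="- M" and J="- J"])
      (simp_all add: 1)
qed

lemma E6_point_diff:
  assumes "E6_point a b c d i j" "E6_point a' b' c' d' i' j'"
  shows "E6_point (a - a') (b - b') (c - c') (d - d') (i - i') (j - j')"
  using E6_point_add[OF assms(1) E6_point_minus[OF assms(2)]] by simp

text \<open>The points satisfying \<open>Z\<close> lie in a common Delaunay cell of \<open>E6\<close>. Stated for coordinate predicates, so that it is
visibly invariant under the translations and the central symmetry of the lattice.\<close>
definition in_E6_cell :: "(real \<Rightarrow> real \<Rightarrow> real \<Rightarrow> real \<Rightarrow> real \<Rightarrow> real \<Rightarrow> bool) \<Rightarrow> bool" where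
  "in_E6_cell Z \<longleftrightarrow> (\<exists>m1 m2 m3 m4 n1 n2 e. \<forall>a b c d i j. E6_point a b c d i j \<longrightarrow>
     0 \<le> a\<^sup>2 + b\<^sup>2 + c\<^sup>2 + d\<^sup>2 + i\<^sup>2 + i * j + j\<^sup>2 + (m1 * a + m2 * b + m3 * c + m4 * d + n1 * i + n2 * j + e) \<and>
     (Z a b c d i j \<longrightarrow>
       a\<^sup>2 + b\<^sup>2 + c\<^sup>2 + d\<^sup>2 + i\<^sup>2 + i * j + j\<^sup>2 + (m1 * a + m2 * b + m3 * c + m4 * d + n1 * i + n2 * j + e) = 0))"

lemma in_E6_cell_translate:
  assumes w: "E6_point w1 w2 w3 w4 e1 e2"
    and "in_E6_cell (\<lambda>a b c d i j. Z (a + w1) (b + w2) (c + w3) (d + w4) (i + e1) (j + e2))"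
  shows "in_E6_cell Z"
proof -
  from assms(2) obtain m1 m2 m3 m4 n1 n2 e where H: "\<And>a b c d i j. E6_point a b c d i j \<Longrightarrow>
     0 \<le> a\<^sup>2 + b\<^sup>2 + c\<^sup>2 + d\<^sup>2 + i\<^sup>2 + i * j + j\<^sup>2 + (m1 * a + m2 * b + m3 * c + m4 * d + n1 * i + n2 * j + e) \<and>
     (Z (a + w1) (b + w2) (c + w3) (d + w4) (i + e1) (j + e2) \<longrightarrow>
       a\<^sup>2 + b\<^sup>2 + c\<^sup>2 + d\<^sup>2 + i\<^sup>2 + i * j + j\<^sup>2 + (m1 * a + m2 * b + m3 * c + m4 * d + n1 * i + n2 * j + e) = 0)"
    unfolding in_E6_cell_def by blast
  define e' where "e' = e + w1\<^sup>2 + w2\<^sup>2 + w3\<^sup>2 + w4\<^sup>2 + e1\<^sup>2 + e1 * e2 + e2\<^sup>2 - (m1 * w1 + m2 * w2 + m3 * w3 + m4 * w4 + n1 * e1 + n2 * e2)"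
  have eq: "a\<^sup>2 + b\<^sup>2 + c\<^sup>2 + d\<^sup>2 + i\<^sup>2 + i * j + j\<^sup>2 + ((m1 - 2 * w1) * a + (m2 - 2 * w2) * b + (m3 - 2 * w3) * c
        + (m4 - 2 * w4) * d + (n1 - 2 * e1 - e2) * i + (n2 - e1 - 2 * e2) * j + e')
     = (a - w1)\<^sup>2 + (b - w2)\<^sup>2 + (c - w3)\<^sup>2 + (d - w4)\<^sup>2 + (i - e1)\<^sup>2 + (i - e1) * (j - e2) + (j - e2)\<^sup>2
        + (m1 * (a - w1) + m2 * (b - w2) + m3 * (c - w3) + m4 * (d - w4) + n1 * (i - e1) + n2 * (j - e2) + e)"
    for a b c d i j
    by (simp add: e'_def power2_eq_square algebra_simps)
  show ?thesis unfolding in_E6_cell_def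
    apply (rule exI[of _ "m1 - 2 * w1"], rule exI[of _ "m2 - 2 * w2"], rule exI[of _ "m3 - 2 * w3"], rule exI[of _ "m4 - 2 * w4"],
        rule exI[of _ "n1 - 2 * e1 - e2"], rule exI[of _ "n2 - e1 - 2 * e2"], rule exI[of _ e'])
    unfolding eq
    using H[OF E6_point_diff[OF _ w]] by simp
qed

lemma in_E6_cell_minus:
  assumes "in_E6_cell (\<lambda>a b c d i j. Z (- a) (- b) (- c) (- d) (- i) (- j))"
  shows "in_E6_cell Z"
proof -
  from assms obtain m1 m2 m3 m4 n1 n2 e where H: "\<And>a b c d i j. E6_point a b c d i j \<Longrightarrow>
     0 \<le> a\<^sup>2 + b\<^sup>2 + c\<^sup>2 + d\<^sup>2 + i\<^sup>2 + i * j + j\<^sup>2 + (m1 * a + m2 * b + m3 * c + m4 * d + n1 * i + n2 * j + e) \<and>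
     (Z (- a) (- b) (- c) (- d) (- i) (- j) \<longrightarrow>
       a\<^sup>2 + b\<^sup>2 + c\<^sup>2 + d\<^sup>2 + i\<^sup>2 + i * j + j\<^sup>2 + (m1 * a + m2 * b + m3 * c + m4 * d + n1 * i + n2 * j + e) = 0)"
    unfolding in_E6_cell_def by blast
  show ?thesis unfolding in_E6_cell_def
    apply (rule exI[of _ "- m1"], rule exI[of _ "- m2"], rule exI[of _ "- m3"], rule exI[of _ "- m4"],
        rule exI[of _ "- n1"], rule exI[of _ "- n2"], rule exI[of _ e])
    using H[OF E6_point_minus] by simp
qed

text \<open>The Voronoi cell of \<open>O\<close> at 0 is a 24-cell; its facets come from the 24 units.\<close>
lemma nearest_origin_bounds:
  assumes "\<And>a b c d i j. E6_point a b c d i j \<Longrightarrow> 0 \<le> a\<^sup>2 + b\<^sup>2 + c\<^sup>2 + d\<^sup>2 - (y1 * a + y2 * b + y3 * c + y4 * d)"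
  shows "\<bar>y1\<bar> \<le> 1" "\<bar>y2\<bar> \<le> 1" "\<bar>y3\<bar> \<le> 1" "\<bar>y4\<bar> \<le> 1" "\<bar>y1\<bar> + \<bar>y2\<bar> + \<bar>y3\<bar> + \<bar>y4\<bar> \<le> 2"
proof -
  show "\<bar>y1\<bar> \<le> 1" "\<bar>y2\<bar> \<le> 1" "\<bar>y3\<bar> \<le> 1" "\<bar>y4\<bar> \<le> 1"
    using E6_point_units_v[of 1 0, THEN assms] by (simp_all add: abs_le_iff)
  have s1: "y1 + y2 + y3 + y4 \<le> 2" using assms[OF E6_point_units_s(1)[of 0 1]] by (simp add: power2_eq_square field_simps)
  have s2: "- y1 - y2 - y3 - y4 \<le> 2" using assms[OF E6_point_units_s(2)[of 0 1]] by (simp add: power2_eq_square field_simps)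
  have s3: "y1 + y2 - y3 - y4 \<le> 2" using assms[OF E6_point_units_s(3)[of 0 1]] by (simp add: power2_eq_square field_simps)
  have s4: "- y1 - y2 + y3 + y4 \<le> 2" using assms[OF E6_point_units_s(4)[of 0 1]] by (simp add: power2_eq_square field_simps)
  have s5: "y1 - y2 + y3 - y4 \<le> 2" using assms[OF E6_point_units_s(5)[of 0 1]] by (simp add: power2_eq_square field_simps)
  have s6: "- y1 + y2 - y3 + y4 \<le> 2" using assms[OF E6_point_units_s(6)[of 0 1]] by (simp add: power2_eq_square field_simps)
  have s7: "y1 - y2 - y3 + y4 \<le> 2" using assms[OF E6_point_units_s(7)[of 0 1]] by (simp add: power2_eq_square field_simps)
  have s8: "- y1 + y2 + y3 - y4 \<le> 2" using assms[OF E6_point_units_s(8)[of 0 1]] by (simp add: power2_eq_square field_simps)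
  have c1: "- y1 + y2 + y3 + y4 \<le> 2" using assms[OF E6_point_units_c(1)[of 1 1]] by (simp add: power2_eq_square field_simps)
  have c2: "y1 - y2 - y3 - y4 \<le> 2" using assms[OF E6_point_units_c(2)[of 1 1]] by (simp add: power2_eq_square field_simps)
  have c3: "y1 - y2 + y3 + y4 \<le> 2" using assms[OF E6_point_units_c(3)[of 1 1]] by (simp add: power2_eq_square field_simps)
  have c4: "- y1 + y2 - y3 - y4 \<le> 2" using assms[OF E6_point_units_c(4)[of 1 1]] by (simp add: power2_eq_square field_simps)
  have c5: "y1 + y2 - y3 + y4 \<le> 2" using assms[OF E6_point_units_c(5)[of 1 1]] by (simp add: power2_eq_square field_simps)
  have c6: "- y1 - y2 + y3 - y4 \<le> 2" using assms[OF E6_point_units_c(6)[of 1 1]] by (simp add: power2_eq_square field_simps)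
  have c7: "y1 + y2 + y3 - y4 \<le> 2" using assms[OF E6_point_units_c(7)[of 1 1]] by (simp add: power2_eq_square field_simps)
  have c8: "- y1 - y2 - y3 + y4 \<le> 2" using assms[OF E6_point_units_c(8)[of 1 1]] by (simp add: power2_eq_square field_simps)
  have "\<bar>y1\<bar> = y1 \<or> \<bar>y1\<bar> = - y1" "\<bar>y2\<bar> = y2 \<or> \<bar>y2\<bar> = - y2" "\<bar>y3\<bar> = y3 \<or> \<bar>y3\<bar> = - y3" "\<bar>y4\<bar> = y4 \<or> \<bar>y4\<bar> = - y4"
    by (simp_all add: abs_if)
  then show "\<bar>y1\<bar> + \<bar>y2\<bar> + \<bar>y3\<bar> + \<bar>y4\<bar> \<le> 2"
    by (elim disjE) (use s1 s2 s3 s4 s5 s6 s7 s8 c1 c2 c3 c4 c5 c6 c7 c8 in linarith)+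
qed

text \<open>A translation by \<open>2H\<close> and possibly a central symmetry move the projection of the centre into the standard triangle,
without changing the class of any point.\<close>
lemma in_E6_cell_nearest_origin:
  assumes nonneg: "\<And>a b c d i j. E6_point a b c d i j \<Longrightarrow> 0 \<le> layered_fun y1 y2 y3 y4 s t k a b c d i j"
    and near: "\<And>a b c d i j. E6_point a b c d i j \<Longrightarrow> 0 \<le> a\<^sup>2 + b\<^sup>2 + c\<^sup>2 + d\<^sup>2 - (y1 * a + y2 * b + y3 * c + y4 * d)"
    and uniq: "\<And>a b c d (i::int) (j::int). E6_point a b c d i j \<Longrightarrow> even i \<Longrightarrow> even j \<Longrightarrow>
        layered_fun y1 y2 y3 y4 s t k a b c d i j = 0 \<Longrightarrow> a = 0 \<and> b = 0 \<and> c = 0 \<and> d = 0"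
  shows "in_E6_cell (\<lambda>a b c d i j. layered_fun y1 y2 y3 y4 s t k a b c d i j = 0)"
proof -
  \<comment> \<open>The condition \<open>0 \<le> s, t < 2\<close> describes a rhombus that is a fundamental domain of \<open>2H\<close>; its short diagonal cuts it into two triangles, exchanged by a central symmetry.\<close>
  define P Q where "P = \<lfloor>s / 2\<rfloor>" "Q = \<lfloor>t / 2\<rfloor>"
  have b: "0 \<le> s - 2 * P" "s - 2 * P < 2" "0 \<le> t - 2 * Q" "t - 2 * Q < 2"
    unfolding P_Q_def by linarith+
  have even_lat: "E6_point 0 0 0 0 (2 * P) (2 * Q)" "E6_point 0 0 0 0 (real_of_int (2 * P + 2)) (real_of_int (2 * Q + 2))" for P Q :: int
    using E6_point_origin[of "2 * P" "2 * Q"] E6_point_origin[of "2 * P + 2" "2 * Q + 2"] by simp_all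
  note y = nearest_origin_bounds[OF near]
  show ?thesis
  proof (cases "(s - 2 * P) + (t - 2 * Q) \<le> 2")
    case True
    have eq: "layered_fun y1 y2 y3 y4 (s - 2 * P) (t - 2 * Q) k a b c d i j = layered_fun y1 y2 y3 y4 s t k (a + 0) (b + 0) (c + 0) (d + 0) (i + 2 * P) (j + 2 * Q)"
      for a b c d i j by (simp add: layered_fun_def hex_dist_def algebra_simps)
    have H: "in_E6_cell (\<lambda>a b c d i j. layered_fun y1 y2 y3 y4 (s - 2 * P) (t - 2 * Q) k a b c d i j = 0)"
    proof (unfold in_E6_cell_def, rule exI[of _ 0], rule exI[of _ 0], rule exI[of _ 0], rule exI[of _ 0], rule exI[of _ "-2"], rule exI[of _ "-2"], rule exI[of _ 0],
        intro allI impI conjI)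
      fix a b c d i j assume z: "E6_point a b c d i j"
      show "0 \<le> a\<^sup>2 + b\<^sup>2 + c\<^sup>2 + d\<^sup>2 + i\<^sup>2 + i * j + j\<^sup>2 + (0 * a + 0 * b + 0 * c + 0 * d + -2 * i + -2 * j + 0)"
        using hole_function_nonneg[OF z] by simp
      assume 0: "layered_fun y1 y2 y3 y4 (s - 2 * P) (t - 2 * Q) k a b c d i j = 0"
      have "a\<^sup>2 + b\<^sup>2 + c\<^sup>2 + d\<^sup>2 + i\<^sup>2 + i * j + j\<^sup>2 - 2 * i - 2 * j = 0"
      proof (rule zero_in_cell[OF _ y b(1) b(3) True _ z 0])
        show "0 \<le> layered_fun y1 y2 y3 y4 (s - 2 * P) (t - 2 * Q) k a b c d i j" if "E6_point a b c d i j" for a b c d i j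
          unfolding eq by (rule nonneg[OF E6_point_add[OF that even_lat(1)]])
        show "a = 0 \<and> b = 0 \<and> c = 0 \<and> d = 0" if "E6_point a b c d i j" "even i" "even j"
          "layered_fun y1 y2 y3 y4 (s - 2 * P) (t - 2 * Q) k a b c d i j = 0" for a b c d and i j :: int
          using uniq[of a b c d "i + 2 * P" "j + 2 * Q"] E6_point_add[OF that(1) even_lat(1)[of P Q]] that(2-4) unfolding eq by simp
      qed
      then show "a\<^sup>2 + b\<^sup>2 + c\<^sup>2 + d\<^sup>2 + i\<^sup>2 + i * j + j\<^sup>2 + (0 * a + 0 * b + 0 * c + 0 * d + -2 * i + -2 * j + 0) = 0" by simp
    qed
    show ?thesis
      by (rule in_E6_cell_translate[OF even_lat(1)[of P Q]]) (use H in \<open>simp only: eq\<close>)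
  next
    case False
    have eq': "layered_fun (-y1) (-y2) (-y3) (-y4) (2 * P + 2 - s) (2 * Q + 2 - t) k a b c d i j
        = layered_fun y1 y2 y3 y4 s t k ((-a) + 0) ((-b) + 0) ((-c) + 0) ((-d) + 0) ((-i) + real_of_int (2 * P + 2)) ((-j) + real_of_int (2 * Q + 2))"
      for a b c d i j :: real by (simp add: layered_fun_def hex_dist_def power2_eq_square algebra_simps)
    have y': "\<bar>-y1\<bar> \<le> 1" "\<bar>-y2\<bar> \<le> 1" "\<bar>-y3\<bar> \<le> 1" "\<bar>-y4\<bar> \<le> 1" "\<bar>-y1\<bar> + \<bar>-y2\<bar> + \<bar>-y3\<bar> + \<bar>-y4\<bar> \<le> 2"
      using y by simp_all
    have b': "0 \<le> 2 * P + 2 - s" "0 \<le> 2 * Q + 2 - t" "(2 * P + 2 - s) + (2 * Q + 2 - t) \<le> 2"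
      using b False by - linarith+
    have H: "in_E6_cell (\<lambda>a b c d i j. layered_fun (-y1) (-y2) (-y3) (-y4) (2 * P + 2 - s) (2 * Q + 2 - t) k a b c d i j = 0)"
    proof (unfold in_E6_cell_def, rule exI[of _ 0], rule exI[of _ 0], rule exI[of _ 0], rule exI[of _ 0], rule exI[of _ "-2"], rule exI[of _ "-2"], rule exI[of _ 0],
        intro allI impI conjI)
      fix a b c d i j assume z: "E6_point a b c d i j"
      show "0 \<le> a\<^sup>2 + b\<^sup>2 + c\<^sup>2 + d\<^sup>2 + i\<^sup>2 + i * j + j\<^sup>2 + (0 * a + 0 * b + 0 * c + 0 * d + -2 * i + -2 * j + 0)"
        using hole_function_nonneg[OF z] by simp
      assume 0: "layered_fun (-y1) (-y2) (-y3) (-y4) (2 * P + 2 - s) (2 * Q + 2 - t) k a b c d i j = 0"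
      have "a\<^sup>2 + b\<^sup>2 + c\<^sup>2 + d\<^sup>2 + i\<^sup>2 + i * j + j\<^sup>2 - 2 * i - 2 * j = 0"
      proof (rule zero_in_cell[OF _ y' b' _ z 0])
        show "0 \<le> layered_fun (-y1) (-y2) (-y3) (-y4) (2 * P + 2 - s) (2 * Q + 2 - t) k a b c d i j" if "E6_point a b c d i j" for a b c d i j
          unfolding eq' by (rule nonneg[OF E6_point_add[OF E6_point_minus[OF that] even_lat(2)]])
        show "a = 0 \<and> b = 0 \<and> c = 0 \<and> d = 0" if "E6_point a b c d i j" "even i" "even j"
          "layered_fun (-y1) (-y2) (-y3) (-y4) (2 * P + 2 - s) (2 * Q + 2 - t) k a b c d i j = 0" for a b c d and i j :: int
          using uniq[of "-a" "-b" "-c" "-d" "-i + (2 * P + 2)" "-j + (2 * Q + 2)"]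
            E6_point_add[OF E6_point_minus[OF that(1)] even_lat(2)[of P Q]] that(2-4) unfolding eq' by simp
      qed
      then show "a\<^sup>2 + b\<^sup>2 + c\<^sup>2 + d\<^sup>2 + i\<^sup>2 + i * j + j\<^sup>2 + (0 * a + 0 * b + 0 * c + 0 * d + -2 * i + -2 * j + 0) = 0" by simp
    qed
    show ?thesis
      by (rule in_E6_cell_translate[OF even_lat(2)[of P Q]], rule in_E6_cell_minus) (use H in \<open>simp only: eq'\<close>)
  qed
qed

lemma layered_fun_translate:
  "layered_fun y1 y2 y3 y4 s t k (a + w1) (b + w2) (c + w3) (d + w4) (i + e1) (j + e2)
    = layered_fun (y1 - 2 * w1) (y2 - 2 * w2) (y3 - 2 * w3) (y4 - 2 * w4) (s - e1) (t - e2)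
        (k + 5 * (w1\<^sup>2 + w2\<^sup>2 + w3\<^sup>2 + w4\<^sup>2 - (y1 * w1 + y2 * w2 + y3 * w3 + y4 * w4))) a b c d i j"
  by (simp add: layered_fun_def hex_dist_def power2_eq_square algebra_simps)

lemma dist_translate:
  fixes a b c d y1 y2 y3 y4 w1 w2 w3 w4 :: real
  shows "a\<^sup>2 + b\<^sup>2 + c\<^sup>2 + d\<^sup>2 - ((y1 - 2 * w1) * a + (y2 - 2 * w2) * b + (y3 - 2 * w3) * c + (y4 - 2 * w4) * d)
   = ((a + w1)\<^sup>2 + (b + w2)\<^sup>2 + (c + w3)\<^sup>2 + (d + w4)\<^sup>2 - (y1 * (a + w1) + y2 * (b + w2) + y3 * (c + w3) + y4 * (d + w4)))
     - (w1\<^sup>2 + w2\<^sup>2 + w3\<^sup>2 + w4\<^sup>2 - (y1 * w1 + y2 * w2 + y3 * w3 + y4 * w4))"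
  by (simp add: power2_eq_square algebra_simps)

lemma nearest_int:
  fixes y :: real
  obtains n :: int where "\<And>m :: int. (real_of_int n)\<^sup>2 - y * n \<le> (real_of_int m)\<^sup>2 - y * m"
proof (rule that[of "round (y / 2)"])
  fix m :: int
  have "\<bar>y / 2 - real_of_int (round (y / 2))\<bar> \<le> \<bar>y / 2 - real_of_int m\<bar>" by (rule round_diff_minimal)
  then have "(y / 2 - real_of_int (round (y / 2)))\<^sup>2 \<le> (y / 2 - real_of_int m)\<^sup>2" by (simp only: abs_le_square_iff)
  then show "(real_of_int (round (y / 2)))\<^sup>2 - y * round (y / 2) \<le> (real_of_int m)\<^sup>2 - y * m"
    by (simp add: power2_eq_square algebra_simps)
qed

text \<open>Round the coordinates to integers and to half-integers; the better of the two candidates is nearest.\<close>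
lemma nearest_hurwitz:
  fixes y1 y2 y3 y4 :: real
  obtains w1 w2 w3 w4 e1 e2 where "E6_point w1 w2 w3 w4 e1 e2"
    "\<And>a b c d i j. E6_point a b c d i j \<Longrightarrow>
      w1\<^sup>2 + w2\<^sup>2 + w3\<^sup>2 + w4\<^sup>2 - (y1 * w1 + y2 * w2 + y3 * w3 + y4 * w4)
      \<le> a\<^sup>2 + b\<^sup>2 + c\<^sup>2 + d\<^sup>2 - (y1 * a + y2 * b + y3 * c + y4 * d)"
proof -
  define g where "g a b c d = a\<^sup>2 + b\<^sup>2 + c\<^sup>2 + d\<^sup>2 - (y1 * a + y2 * b + y3 * c + y4 * d)" for a b c d
  obtain n1 where n1: "\<And>m :: int. (real_of_int n1)\<^sup>2 - y1 * n1 \<le> (real_of_int m)\<^sup>2 - y1 * m" using nearest_int[of y1] by blast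
  obtain n2 where n2: "\<And>m :: int. (real_of_int n2)\<^sup>2 - y2 * n2 \<le> (real_of_int m)\<^sup>2 - y2 * m" using nearest_int[of y2] by blast
  obtain n3 where n3: "\<And>m :: int. (real_of_int n3)\<^sup>2 - y3 * n3 \<le> (real_of_int m)\<^sup>2 - y3 * m" using nearest_int[of y3] by blast
  obtain n4 where n4: "\<And>m :: int. (real_of_int n4)\<^sup>2 - y4 * n4 \<le> (real_of_int m)\<^sup>2 - y4 * m" using nearest_int[of y4] by blast
  have half: "\<exists>n. \<forall>m :: int. (real_of_int n + 1/2)\<^sup>2 - y * (real_of_int n + 1/2) \<le> (real_of_int m + 1/2)\<^sup>2 - y * (real_of_int m + 1/2)" for y :: real
  proof -
    obtain n where "\<And>m :: int. (real_of_int n)\<^sup>2 - (y - 1) * n \<le> (real_of_int m)\<^sup>2 - (y - 1) * m" using nearest_int[of "y - 1"] by blast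
    then show ?thesis by (intro exI[of _ n]) (simp add: power2_eq_square algebra_simps)
  qed
  obtain h1 where h1: "\<And>m :: int. (real_of_int h1 + 1/2)\<^sup>2 - y1 * (real_of_int h1 + 1/2) \<le> (real_of_int m + 1/2)\<^sup>2 - y1 * (real_of_int m + 1/2)" using half[of y1] by blast
  obtain h2 where h2: "\<And>m :: int. (real_of_int h2 + 1/2)\<^sup>2 - y2 * (real_of_int h2 + 1/2) \<le> (real_of_int m + 1/2)\<^sup>2 - y2 * (real_of_int m + 1/2)" using half[of y2] by blast
  obtain h3 where h3: "\<And>m :: int. (real_of_int h3 + 1/2)\<^sup>2 - y3 * (real_of_int h3 + 1/2) \<le> (real_of_int m + 1/2)\<^sup>2 - y3 * (real_of_int m + 1/2)" using half[of y3] by blast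
  obtain h4 where h4: "\<And>m :: int. (real_of_int h4 + 1/2)\<^sup>2 - y4 * (real_of_int h4 + 1/2) \<le> (real_of_int m + 1/2)\<^sup>2 - y4 * (real_of_int m + 1/2)" using half[of y4] by blast
  have N: "g n1 n2 n3 n4 \<le> g A B C D" for A B C D :: int
    using n1[of A] n2[of B] n3[of C] n4[of D] unfolding g_def by linarith
  have H: "g (h1 + 1/2) (h2 + 1/2) (h3 + 1/2) (h4 + 1/2) \<le> g (A + 1/2) (B + 1/2) (C + 1/2) (D + 1/2)" for A B C D :: int
    using h1[of A] h2[of B] h3[of C] h4[of D] unfolding g_def by linarith
  have latN: "E6_point n1 n2 n3 n4 (real_of_int (n1 + n2 + n3 + n4)) (real_of_int 0)" by (rule E6_point_integral) simp_all
  have latH: "E6_point (h1 + 1/2) (h2 + 1/2) (h3 + 1/2) (h4 + 1/2) (real_of_int (h1 + h2 + h3 + h4)) (real_of_int 1)"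
    by (rule E6_point_half_integral) simp_all
  show ?thesis
  proof (cases "g n1 n2 n3 n4 \<le> g (h1 + 1/2) (h2 + 1/2) (h3 + 1/2) (h4 + 1/2)")
    case True
    show ?thesis
    proof (rule that[OF latN], fold g_def)
      fix a b c d i j assume "E6_point a b c d i j"
      then show "g n1 n2 n3 n4 \<le> g a b c d"
      proof (cases rule: E6_point_cases)
        case (1 A B C D I J)
        then show ?thesis using N[of A B C D] by simp
      next
        case (2 A B C D I J)
        then show ?thesis using H[of A B C D] True by simp
      qed
    qed
  next
    case False
    show ?thesis
    proof (rule that[OF latH], fold g_def)
      fix a b c d i j assume "E6_point a b c d i j"
      then show "g (h1 + 1/2) (h2 + 1/2) (h3 + 1/2) (h4 + 1/2) \<le> g a b c d"
      proof (cases rule: E6_point_cases)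
        case (1 A B C D I J)
        then show ?thesis using N[of A B C D] False by simp
      next
        case (2 A B C D I J)
        then show ?thesis using H[of A B C D] by simp
      qed
    qed
  qed
qed

text \<open>If a nonzero point of \<open>D4\<close> is as near to \<open>y / 2\<close> as 0, then \<open>y\<close> is a root, \<open>y / 2\<close> is a deep hole of \<open>O\<close>, and the 8 points of \<open>O\<close> nearest
to it represent all four classes. In each frame this is read off from the coordinates of size 1.\<close>
lemma deep_hole_representatives:
  fixes y1 y2 y3 y4 :: real and A B C D I J :: int
  defines "g \<equiv> \<lambda>a b c d. a\<^sup>2 + b\<^sup>2 + c\<^sup>2 + d\<^sup>2 - (y1 * a + y2 * b + y3 * c + y4 * d)"
  assumes near: "\<And>a b c d i j. E6_point a b c d i j \<Longrightarrow> 0 \<le> g a b c d"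
    and even: "even (A + B + C + D)" and nz: "\<not> (A = 0 \<and> B = 0 \<and> C = 0 \<and> D = 0)" and tie: "g A B C D = 0"
  shows "\<exists>a b c d. E6_point a b c d I J \<and> g a b c d = 0"
proof -
  have y: "\<bar>y1\<bar> \<le> 1" "\<bar>y2\<bar> \<le> 1" "\<bar>y3\<bar> \<le> 1" "\<bar>y4\<bar> \<le> 1" "\<bar>y1\<bar> + \<bar>y2\<bar> + \<bar>y3\<bar> + \<bar>y4\<bar> \<le> 2"
    by (rule nearest_origin_bounds[of y1 y2 y3 y4], erule near[unfolded g_def])+
  have abs_1_iff: "\<bar>x\<bar> = 1 \<longleftrightarrow> x = 1 \<or> x = -1" for x :: real by auto
  obtain m where m: "A + B + C + D = 2 * m" using even by (rule evenE)
  have A: "A = 2 * m - B - C - D" using m by linarith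
  have tie0: "(real_of_int A)\<^sup>2 + (real_of_int B)\<^sup>2 + (real_of_int C)\<^sup>2 + (real_of_int D)\<^sup>2 - (y1 * A + y2 * B + y3 * C + y4 * D) = 0"
    using tie unfolding g_def .
  consider "even I" "even J" | "odd I" "even J" | "even I" "odd J" | "odd I" "odd J" by blast
  then show ?thesis
  proof cases
    case 1
    have "g 0 0 0 0 = 0" by (simp add: g_def)
    then show ?thesis using E6_point_origin[OF 1] by blast
  next
    case 2
    have "\<bar>y1\<bar> = 1 \<or> \<bar>y2\<bar> = 1 \<or> \<bar>y3\<bar> = 1 \<or> \<bar>y4\<bar> = 1"
      by (rule tie_gives_unit_coordinate[OF y(1-4) nz]) (use tie0 in \<open>simp add: algebra_simps\<close>)
    then have "g 1 0 0 0 = 0 \<or> g (-1) 0 0 0 = 0 \<or> g 0 1 0 0 = 0 \<or> g 0 (-1) 0 0 = 0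
        \<or> g 0 0 1 0 = 0 \<or> g 0 0 (-1) 0 = 0 \<or> g 0 0 0 1 = 0 \<or> g 0 0 0 (-1) = 0"
      unfolding g_def abs_1_iff by auto
    then show ?thesis using E6_point_units_v[OF 2] by blast
  next
    case 3
    define S1 S2 S3 S4 where S_def: "S1 = (y1 + y2 + y3 + y4) / 2" "S2 = (y1 + y2 - y3 - y4) / 2"
      "S3 = (y1 - y2 + y3 - y4) / 2" "S4 = (y1 - y2 - y3 + y4) / 2"
    have SY: "2 * S1 = y1 + y2 + y3 + y4" "2 * S2 = y1 + y2 - y3 - y4" "2 * S3 = y1 - y2 + y3 - y4" "2 * S4 = y1 - y2 - y3 + y4"
      by (simp_all add: S_def)
    note b = frame_bounds(1-4)[OF y SY]
    have "\<bar>S1\<bar> = 1 \<or> \<bar>S2\<bar> = 1 \<or> \<bar>S3\<bar> = 1 \<or> \<bar>S4\<bar> = 1"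
    proof (rule tie_gives_unit_coordinate[OF b])
      show "\<not> (m = 0 \<and> m - C - D = 0 \<and> m - B - D = 0 \<and> m - B - C = 0)" using nz A by auto
      show "(real_of_int m)\<^sup>2 - S1 * m + ((real_of_int (m - C - D))\<^sup>2 - S2 * (m - C - D)) + ((real_of_int (m - B - D))\<^sup>2 - S3 * (m - B - D))
         + ((real_of_int (m - B - C))\<^sup>2 - S4 * (m - B - C)) \<le> 0"
        using tie0 unfolding A S_def by (simp add: power2_eq_square field_simps)
    qed
    then have "g (1/2) (1/2) (1/2) (1/2) = 0 \<or> g (-1/2) (-1/2) (-1/2) (-1/2) = 0 \<or> g (1/2) (1/2) (-1/2) (-1/2) = 0 \<or> g (-1/2) (-1/2) (1/2) (1/2) = 0
       \<or> g (1/2) (-1/2) (1/2) (-1/2) = 0 \<or> g (-1/2) (1/2) (-1/2) (1/2) = 0 \<or> g (1/2) (-1/2) (-1/2) (1/2) = 0 \<or> g (-1/2) (1/2) (1/2) (-1/2) = 0"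
      unfolding g_def abs_1_iff S_def by (auto simp: power2_eq_square field_simps)
    then show ?thesis using E6_point_units_s[OF 3] by blast
  next
    case 4
    define C1 C2 C3 C4 where C_def: "C1 = (- y1 + y2 + y3 + y4) / 2" "C2 = (y1 - y2 + y3 + y4) / 2"
      "C3 = (y1 + y2 - y3 + y4) / 2" "C4 = (y1 + y2 + y3 - y4) / 2"
    have CY: "2 * C1 = - y1 + y2 + y3 + y4" "2 * - C2 = - y1 + y2 - y3 - y4" "2 * - C3 = - y1 - y2 + y3 - y4" "2 * - C4 = - y1 - y2 - y3 + y4"
      unfolding C_def by (simp_all add: field_simps)
    have ny: "\<bar>- y1\<bar> \<le> 1" "\<bar>- y1\<bar> + \<bar>y2\<bar> + \<bar>y3\<bar> + \<bar>y4\<bar> \<le> 2" using y by simp_all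
    have b: "\<bar>C1\<bar> \<le> 1" "\<bar>C2\<bar> \<le> 1" "\<bar>C3\<bar> \<le> 1" "\<bar>C4\<bar> \<le> 1"
      using frame_bounds(1-4)[OF ny(1) y(2-4) ny(2) CY] by (simp_all only: abs_minus_cancel)
    have "\<bar>C1\<bar> = 1 \<or> \<bar>C2\<bar> = 1 \<or> \<bar>C3\<bar> = 1 \<or> \<bar>C4\<bar> = 1"
    proof (rule tie_gives_unit_coordinate[OF b])
      show "\<not> (m - A = 0 \<and> m - B = 0 \<and> m - C = 0 \<and> m - D = 0)" using nz A by auto
      show "(real_of_int (m - A))\<^sup>2 - C1 * (m - A) + ((real_of_int (m - B))\<^sup>2 - C2 * (m - B)) + ((real_of_int (m - C))\<^sup>2 - C3 * (m - C))
         + ((real_of_int (m - D))\<^sup>2 - C4 * (m - D)) \<le> 0"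
        using tie0 unfolding A C_def by (simp add: power2_eq_square field_simps)
    qed
    then have "g (-1/2) (1/2) (1/2) (1/2) = 0 \<or> g (1/2) (-1/2) (-1/2) (-1/2) = 0 \<or> g (1/2) (-1/2) (1/2) (1/2) = 0 \<or> g (-1/2) (1/2) (-1/2) (-1/2) = 0
       \<or> g (1/2) (1/2) (-1/2) (1/2) = 0 \<or> g (-1/2) (-1/2) (1/2) (-1/2) = 0 \<or> g (1/2) (1/2) (1/2) (-1/2) = 0 \<or> g (-1/2) (-1/2) (-1/2) (1/2) = 0"
      unfolding g_def abs_1_iff C_def by (auto simp: power2_eq_square field_simps)
    then show ?thesis using E6_point_units_c[OF 4] by blast
  qed
qed

text \<open>In case of a tie all four classes have a nearest point of \<open>O\<close>, at the same distance. So whether a class contains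
a vertex of the cell depends only on the distance of its hexagonal part to the centre, and at most three classes do.
The origin may then be moved to a nearest point of a class without vertices, where the condition on
ties is void.\<close>
lemma in_E6_cell_if_nearest:
  fixes y1 y2 y3 y4 s t k :: real
  defines "g \<equiv> \<lambda>a b c d. a\<^sup>2 + b\<^sup>2 + c\<^sup>2 + d\<^sup>2 - (y1 * a + y2 * b + y3 * c + y4 * d)"
  assumes nonneg: "\<And>a b c d i j. E6_point a b c d i j \<Longrightarrow> 0 \<le> layered_fun y1 y2 y3 y4 s t k a b c d i j"
    and near: "\<And>a b c d i j. E6_point a b c d i j \<Longrightarrow> 0 \<le> g a b c d"
  shows "in_E6_cell (\<lambda>a b c d i j. layered_fun y1 y2 y3 y4 s t k a b c d i j = 0)"
proof (cases "\<exists>A B C D :: int. even (A + B + C + D) \<and> \<not> (A = 0 \<and> B = 0 \<and> C = 0 \<and> D = 0) \<and> g A B C D = 0")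
  case False
  show ?thesis
  proof (rule in_E6_cell_nearest_origin[OF nonneg near[unfolded g_def]])
    fix a b c d and i j :: int
    assume z: "E6_point a b c d i j" "even i" "even j" "layered_fun y1 y2 y3 y4 s t k a b c d i j = 0"
    have "0 \<le> 3 * hex_dist s t i j + k" using nonneg[OF E6_point_origin[OF z(2,3)]] by (simp add: layered_fun_def)
    moreover have "5 * g a b c d + 3 * hex_dist s t i j + k = 0" using z(4) by (simp add: layered_fun_def g_def)
    ultimately have g0: "g a b c d = 0" using near[OF z(1)] by linarith
    from z(1) show "a = 0 \<and> b = 0 \<and> c = 0 \<and> d = 0"
    proof (cases rule: E6_point_cases)
      case (1 A B C D I J)
      then have "even (A + B + C + D)" using z(2) by simp
      moreover have "g A B C D = 0" using g0 unfolding 1(3-6) .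
      ultimately have "A = 0 \<and> B = 0 \<and> C = 0 \<and> D = 0" using False by blast
      then show ?thesis unfolding 1(3-6) by simp
    next
      case (2 A B C D I J)
      then show ?thesis using z(3) by simp
    qed
  qed
next
  case True
  then obtain A B C D :: int where tie: "even (A + B + C + D)" "\<not> (A = 0 \<and> B = 0 \<and> C = 0 \<and> D = 0)" "g A B C D = 0" by blast
  have rep: "\<exists>a b c d. E6_point a b c d I J \<and> g a b c d = 0" for I J :: int
    unfolding g_def
    by (rule deep_hole_representatives[OF _ tie(1,2) tie(3)[unfolded g_def]], erule near[unfolded g_def])
  define active where "active i j \<longleftrightarrow> (\<exists>a b c d. E6_point a b c d i j \<and> layered_fun y1 y2 y3 y4 s t k a b c d i j = 0)" for i j
  have "\<exists>(I0::int) (J0::int). \<forall>(i::int) (j::int). even i = even I0 \<longrightarrow> even j = even J0 \<longrightarrow> \<not> active i j"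
  proof (rule ccontr)
    assume no: "\<not> ?thesis"
    have ex: "\<exists>(i::int) (j::int). even i = even I0 \<and> even j = even J0 \<and> active i j" for I0 J0 :: int
      using no by blast
    have near_unit: "\<forall>(k,l) \<in> hex_steps 1. hex_dist s t i j \<le> hex_dist s t (i+k) (j+l)"
      if z: "E6_point a b c d i j" "layered_fun y1 y2 y3 y4 s t k a b c d i j = 0" for a b c d and i j :: int
    proof -
      have le: "hex_dist s t i j \<le> hex_dist s t (real_of_int i') (real_of_int j')" for i' j' :: int
      proof -
        obtain a' b' c' d' where r: "E6_point a' b' c' d' i' j'" "g a' b' c' d' = 0" using rep by blast
        have "0 \<le> 3 * hex_dist s t i' j' + k" using nonneg[OF r(1)] r(2) by (simp add: layered_fun_def g_def)
        moreover have "5 * g a b c d + 3 * hex_dist s t i j + k = 0" using z(2) by (simp add: layered_fun_def g_def)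
        ultimately show ?thesis using near[OF z(1)] by linarith
      qed
      show ?thesis
        using le[of "i + 1" j] le[of "i - 1" j] le[of i "j + 1"] le[of i "j - 1"] le[of "i + 1" "j - 1"] le[of "i - 1" "j + 1"]
        by (auto simp: hex_steps_def)
    qed
    have ex': "\<exists>(i::int) (j::int). even i = even I0 \<and> even j = even J0 \<and>
        (\<forall>(k,l) \<in> hex_steps 1. hex_dist s t i j \<le> hex_dist s t (i+k) (j+l))" for I0 J0 :: int
    proof -
      obtain i j :: int where ij: "even i = even I0" "even j = even J0" "active i j" using ex[of I0 J0] by blast
      then obtain a b c d where "E6_point a b c d i j" "layered_fun y1 y2 y3 y4 s t k a b c d i j = 0" unfolding active_def by blast
      from near_unit[OF this] ij show ?thesis by (intro exI[of _ i] exI[of _ j] conjI)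
    qed
    obtain i0 j0 :: int where 0: "even i0 = even (0::int)" "even j0 = even (0::int)" "\<forall>(k,l) \<in> hex_steps 1. hex_dist s t i0 j0 \<le> hex_dist s t (i0+k) (j0+l)"
      using ex'[of 0 0] by blast
    obtain i1 j1 :: int where 1: "even i1 = even (1::int)" "even j1 = even (0::int)" "\<forall>(k,l) \<in> hex_steps 1. hex_dist s t i1 j1 \<le> hex_dist s t (i1+k) (j1+l)"
      using ex'[of 1 0] by blast
    obtain i2 j2 :: int where 2: "even i2 = even (0::int)" "even j2 = even (1::int)" "\<forall>(k,l) \<in> hex_steps 1. hex_dist s t i2 j2 \<le> hex_dist s t (i2+k) (j2+l)"
      using ex'[of 0 1] by blast
    obtain i3 j3 :: int where 3: "even i3 = even (1::int)" "even j3 = even (1::int)" "\<forall>(k,l) \<in> hex_steps 1. hex_dist s t i3 j3 \<le> hex_dist s t (i3+k) (j3+l)"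
      using ex'[of 1 1] by blast
    show False
    proof (rule no_four_nearest_classes[of i0 j0 i1 j1 i2 j2 i3 j3 s t])
      fix i j :: int assume "(i, j) \<in> {(i0,j0), (i1,j1), (i2,j2), (i3,j3)}"
      then show "\<forall>(k,l) \<in> hex_steps 1. hex_dist s t i j \<le> hex_dist s t (i+k) (j+l)"
        using 0(3) 1(3) 2(3) 3(3) by (elim insertE emptyE) (simp_all only: prod.inject)
    qed (use 0(1,2) 1(1,2) 2(1,2) 3(1,2) in simp_all)
  qed
  then obtain I0 J0 :: int where inactive: "\<And>(i::int) (j::int). even i = even I0 \<Longrightarrow> even j = even J0 \<Longrightarrow> \<not> active i j"
    by blast
  obtain w1 w2 w3 w4 where w: "E6_point w1 w2 w3 w4 I0 J0" "g w1 w2 w3 w4 = 0" using rep by blast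
  show ?thesis
  proof (rule in_E6_cell_translate[OF w(1)], unfold layered_fun_translate, rule in_E6_cell_nearest_origin, fold layered_fun_translate)
    fix a b c d i j assume z: "E6_point a b c d i j"
    show "0 \<le> layered_fun y1 y2 y3 y4 s t k (a + w1) (b + w2) (c + w3) (d + w4) (i + real_of_int I0) (j + real_of_int J0)"
      by (rule nonneg[OF E6_point_add[OF z w(1)]])
    show "0 \<le> a\<^sup>2 + b\<^sup>2 + c\<^sup>2 + d\<^sup>2 - ((y1 - 2 * w1) * a + (y2 - 2 * w2) * b + (y3 - 2 * w3) * c + (y4 - 2 * w4) * d)"
      unfolding dist_translate using near[OF E6_point_add[OF z w(1)]] w(2) by (simp add: g_def)
  next
    fix a b c d and i j :: int
    assume z: "E6_point a b c d i j" "even i" "even j"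
      "layered_fun y1 y2 y3 y4 s t k (a + w1) (b + w2) (c + w3) (d + w4) (real_of_int i + real_of_int I0) (real_of_int j + real_of_int J0) = 0"
    have "E6_point (a + w1) (b + w2) (c + w3) (d + w4) (real_of_int (i + I0)) (real_of_int (j + J0))"
      using E6_point_add[OF z(1) w(1)] by simp
    with z(4) have "active (real_of_int (i + I0)) (real_of_int (j + J0))" unfolding active_def by auto
    with inactive[of "i + I0" "j + J0"] z(2,3) show "a = 0 \<and> b = 0 \<and> c = 0 \<and> d = 0" by simp
  qed
qed

text \<open>Moving a point of \<open>O\<close> nearest to \<open>y / 2\<close> to the origin reduces this to the previous case. Since \<open>layered_fun\<close> is the general
quadratic function with leading part \<open>5 |x|^2 + 3 N(\<eta>)\<close>, all Delaunay cells of this form are covered.\<close>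
theorem in_E6_cell_zeros:
  assumes nonneg: "\<And>a b c d i j. E6_point a b c d i j \<Longrightarrow> 0 \<le> layered_fun y1 y2 y3 y4 s t k a b c d i j"
  shows "in_E6_cell (\<lambda>a b c d i j. layered_fun y1 y2 y3 y4 s t k a b c d i j = 0)"
proof -
  obtain w1 w2 w3 w4 e1 e2 where w: "E6_point w1 w2 w3 w4 e1 e2"
    "\<And>a b c d i j. E6_point a b c d i j \<Longrightarrow>
      w1\<^sup>2 + w2\<^sup>2 + w3\<^sup>2 + w4\<^sup>2 - (y1 * w1 + y2 * w2 + y3 * w3 + y4 * w4)
      \<le> a\<^sup>2 + b\<^sup>2 + c\<^sup>2 + d\<^sup>2 - (y1 * a + y2 * b + y3 * c + y4 * d)"
    using nearest_hurwitz[of y1 y2 y3 y4] by metis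
  show ?thesis
  proof (rule in_E6_cell_translate[OF w(1)], unfold layered_fun_translate, rule in_E6_cell_if_nearest, fold layered_fun_translate)
    fix a b c d i j assume z: "E6_point a b c d i j"
    show "0 \<le> layered_fun y1 y2 y3 y4 s t k (a + w1) (b + w2) (c + w3) (d + w4) (i + e1) (j + e2)"
      by (rule nonneg[OF E6_point_add[OF z w(1)]])
    show "0 \<le> a\<^sup>2 + b\<^sup>2 + c\<^sup>2 + d\<^sup>2 - ((y1 - 2 * w1) * a + (y2 - 2 * w2) * b + (y3 - 2 * w3) * c + (y4 - 2 * w4) * d)"
      unfolding dist_translate using w(2)[OF E6_point_add[OF z w(1)]] by simp
  qed
qed

section \<open>The forms on the integer lattice of rank 6\<close>

lemma exhaust_6:
  fixes x :: 6
  shows "x = 1 \<or> x = 2 \<or> x = 3 \<or> x = 4 \<or> x = 5 \<or> x = 6"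
proof (induct x)
  case (of_int z)
  then have "0 \<le> z" and "z < 6" by simp_all
  then have "z = 0 \<or> z = 1 \<or> z = 2 \<or> z = 3 \<or> z = 4 \<or> z = 5" by arith
  then show ?case by auto
qed

lemma UNIV_6: "UNIV = {1, 2, 3, 4, 5, 6 :: 6}"
  using exhaust_6 by auto

lemma forall_6: "(\<forall>i::6. P i) \<longleftrightarrow> P 1 \<and> P 2 \<and> P 3 \<and> P 4 \<and> P 5 \<and> P 6"
  by (metis exhaust_6)

lemma sum_6: "sum f (UNIV :: 6 set) = f 1 + f 2 + f 3 + f 4 + f 5 + f 6"
  unfolding UNIV_6 by (simp add: ac_simps)

definition vec6 :: "real \<Rightarrow> real \<Rightarrow> real \<Rightarrow> real \<Rightarrow> real \<Rightarrow> real \<Rightarrow> real^6" where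
  "vec6 a b c d e f = (\<chi> i. if i = 1 then a else if i = 2 then b else if i = 3 then c
      else if i = 4 then d else if i = 5 then e else f)"

lemma vec6_nth [simp]:
  "vec6 a b c d e f $ 1 = a" "vec6 a b c d e f $ 2 = b" "vec6 a b c d e f $ 3 = c"
  "vec6 a b c d e f $ 4 = d" "vec6 a b c d e f $ 5 = e" "vec6 a b c d e f $ 6 = f"
  by (simp_all add: vec6_def)

lemma inner_vec6: "vec6 a b c d e f \<bullet> z = a * z $ 1 + b * z $ 2 + c * z $ 3 + d * z $ 4 + e * z $ 5 + f * z $ 6"
  by (simp add: inner_vec_def sum_6)

lemma qform_6:
  fixes M :: "real^6^6"
  assumes "M \<in> sym_matrices"
  shows "qform M z = M$1$1 * (z$1)\<^sup>2 + M$2$2 * (z$2)\<^sup>2 + M$3$3 * (z$3)\<^sup>2 + M$4$4 * (z$4)\<^sup>2 + M$5$5 * (z$5)\<^sup>2 + M$6$6 * (z$6)\<^sup>2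
    + 2 * (M$1$2 * (z$1 * z$2) + M$1$3 * (z$1 * z$3) + M$1$4 * (z$1 * z$4) + M$1$5 * (z$1 * z$5) + M$1$6 * (z$1 * z$6)
      + M$2$3 * (z$2 * z$3) + M$2$4 * (z$2 * z$4) + M$2$5 * (z$2 * z$5) + M$2$6 * (z$2 * z$6)
      + M$3$4 * (z$3 * z$4) + M$3$5 * (z$3 * z$5) + M$3$6 * (z$3 * z$6)
      + M$4$5 * (z$4 * z$5) + M$4$6 * (z$4 * z$6) + M$5$6 * (z$5 * z$6))"
proof -
  have s: "M$i$j = M$j$i" for i j
    using assms unfolding sym_matrices_def transpose_def by (metis (mono_tags, lifting) mem_Collect_eq vec_lambda_beta)
  show ?thesis
    unfolding qform_def matrix_vector_mult_def inner_vec_def sum_6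
    by (simp add: sum_6 s[of 2 1] s[of 3 1] s[of 4 1] s[of 5 1] s[of 6 1] s[of 3 2] s[of 4 2] s[of 5 2] s[of 6 2]
        s[of 4 3] s[of 5 3] s[of 6 3] s[of 5 4] s[of 6 4] s[of 6 5] power2_eq_square algebra_simps)
qed

lemma square_form_sym: "square_form v \<in> sym_matrices"
  by (simp add: sym_matrices_def square_form_def transpose_def vec_eq_iff mult.commute)

lemma sym_add: "A \<in> sym_matrices \<Longrightarrow> B \<in> sym_matrices \<Longrightarrow> A + B \<in> sym_matrices"
  by (simp add: sym_matrices_def transpose_def vec_eq_iff)

lemma sym_scaleR: "A \<in> sym_matrices \<Longrightarrow> c *\<^sub>R A \<in> sym_matrices"
  by (simp add: sym_matrices_def transpose_def vec_eq_iff)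

lemma qform_scaleR_matrix: "qform (c *\<^sub>R A) x = c * qform A x"
  by (simp add: qform_def scaleR_matrix_vector_assoc[symmetric])

lemma qform_sum_matrix: "qform (\<Sum>v\<in>S. F v) x = (\<Sum>v\<in>S. qform (F v) x)"
proof (cases "finite S")
  case True
  then show ?thesis
    by (induction S rule: finite_induct) (simp_all add: qform_add_matrix, simp add: qform_def)
qed (simp add: qform_def)

text \<open>The form \<open>p |x|^2 + r N(\<eta>)\<close> in the basis of \<open>E6_point\<close>, with \<open>N\<close> written as \<open>(i + j/2)^2 + 3/4 j^2\<close>.\<close>
definition layered_form :: "real \<Rightarrow> real \<Rightarrow> real^6^6" where
  "layered_form p r = p *\<^sub>R (square_form (vec6 1 0 0 0 0 (1/2)) + square_form (vec6 0 1 0 0 0 (1/2))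
       + square_form (vec6 0 0 1 0 0 (1/2)) + square_form (vec6 0 0 0 1 0 (1/2)))
     + r *\<^sub>R (square_form (vec6 1 1 1 1 2 (1/2)) + (3/4) *\<^sub>R square_form (vec6 0 0 0 0 0 1))"

lemma qform_layered:
  "qform (layered_form p r) z =
     p * ((z$1 + z$6/2)\<^sup>2 + (z$2 + z$6/2)\<^sup>2 + (z$3 + z$6/2)\<^sup>2 + (z$4 + z$6/2)\<^sup>2)
     + r * ((z$1 + z$2 + z$3 + z$4 + 2 * z$5)\<^sup>2 + (z$1 + z$2 + z$3 + z$4 + 2 * z$5) * z$6 + (z$6)\<^sup>2)"
proof -
  define i where "i = z$1 + z$2 + z$3 + z$4 + 2 * z$5"
  have "(i + z$6/2)\<^sup>2 + 3/4 * (z$6)\<^sup>2 = i\<^sup>2 + i * z$6 + (z$6)\<^sup>2" by (simp add: power2_eq_square field_simps)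
  then show ?thesis
    by (simp add: layered_form_def qform_add_matrix qform_scaleR_matrix qform_square_form inner_vec6 i_def)
qed

lemma layered_form_sym: "layered_form p r \<in> sym_matrices"
  unfolding layered_form_def by (intro sym_add sym_scaleR square_form_sym)

lemma layered_form_positive_definite:
  assumes "0 < p" "0 < r"
  shows "positive_definite (layered_form p r)"
  unfolding positive_definite_def
proof (intro conjI allI impI layered_form_sym)
  fix z :: "real^6" assume "z \<noteq> 0"
  define i where "i = z$1 + z$2 + z$3 + z$4 + 2 * z$5"
  have i: "i\<^sup>2 + i * z$6 + (z$6)\<^sup>2 = (i + z$6/2)\<^sup>2 + 3/4 * (z$6)\<^sup>2" by (simp add: power2_eq_square field_simps)
  have q: "qform (layered_form p r) z = p * ((z$1 + z$6/2)\<^sup>2 + (z$2 + z$6/2)\<^sup>2 + (z$3 + z$6/2)\<^sup>2 + (z$4 + z$6/2)\<^sup>2)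
     + r * ((i + z$6/2)\<^sup>2 + 3/4 * (z$6)\<^sup>2)" unfolding qform_layered i_def[symmetric] i ..
  have "0 \<le> qform (layered_form p r) z" unfolding q using assms by simp
  moreover have "qform (layered_form p r) z \<noteq> 0"
  proof
    assume "qform (layered_form p r) z = 0"
    then have "p * ((z$1 + z$6/2)\<^sup>2 + (z$2 + z$6/2)\<^sup>2 + (z$3 + z$6/2)\<^sup>2 + (z$4 + z$6/2)\<^sup>2) = 0"
      "r * ((i + z$6/2)\<^sup>2 + 3/4 * (z$6)\<^sup>2) = 0"
      unfolding q using assms by (simp_all add: add_nonneg_eq_0_iff)
    then have "z$6 = 0" "i = 0" "z$1 = 0" "z$2 = 0" "z$3 = 0" "z$4 = 0"
      using assms by (simp_all add: add_nonneg_eq_0_iff)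
    then have "z = 0" by (simp add: vec_eq_iff forall_6 i_def)
    with \<open>z \<noteq> 0\<close> show False ..
  qed
  ultimately show "0 < qform (layered_form p r) z" by simp
qed

lemma int_lattice_E6_point:
  assumes "z \<in> int_lattice"
  shows "E6_point (z$1 + z$6/2) (z$2 + z$6/2) (z$3 + z$6/2) (z$4 + z$6/2) (z$1 + z$2 + z$3 + z$4 + 2 * z$5) (z$6)"
proof -
  have "\<exists>n :: int. z $ i = n" for i using assms by (auto simp: int_lattice_def elim: Ints_cases)
  then obtain n where n: "\<And>i. z $ i = real_of_int (n i)" by metis
  show ?thesis
    by (rule E6_pointI[where A="n 1" and B="n 2" and C="n 3" and D="n 4" and M="n 5" and J="n 6"]) (simp_all add: n)
qed

theorem layered_form_tiling:
  "delaunay_tiling (layered_form 5 3 + layered_form 1 1) = delaunay_tiling (layered_form 5 3)"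
proof (rule delaunay_tiling_add)
  show "positive_definite (layered_form 5 3)" by (rule layered_form_positive_definite) simp_all
next
  fix c :: real and p :: "real^6"
  assume nonneg: "\<And>z. z \<in> int_lattice \<Longrightarrow> 0 \<le> c + p \<bullet> z + qform (layered_form 5 3) z"
  have inner: "p \<bullet> z = p$1 * z$1 + p$2 * z$2 + p$3 * z$3 + p$4 * z$4 + p$5 * z$5 + p$6 * z$6" for z
    by (simp add: inner_vec_def sum_6)
  \<comment> \<open>Completing the square: \<open>l\<close> and \<open>m\<close> are the coefficients \<open>2 s + t\<close> and \<open>s + 2 t\<close> of \<open>i\<close> and \<open>j\<close>, up to the factor \<open>-3\<close>.\<close>
  define l where "l = - (p$5) / 6"
  define y1 y2 y3 y4 where "y1 = - (p$1 + 3 * l) / 5" "y2 = - (p$2 + 3 * l) / 5" "y3 = - (p$3 + 3 * l) / 5" "y4 = - (p$4 + 3 * l) / 5"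
  note y = this
  define m where "m = - (p$6 + 5/2 * (y1 + y2 + y3 + y4)) / 3"
  define s t where "s = (2 * l - m) / 3" "t = (2 * m - l) / 3"
  note st = this
  define k where "k = c - 3 * (s\<^sup>2 + s * t + t\<^sup>2)"
  have "p$5 = - 6 * l" by (simp add: l_def)
  moreover have "p$1 = - 5 * y1 - 3 * l" "p$2 = - 5 * y2 - 3 * l" "p$3 = - 5 * y3 - 3 * l" "p$4 = - 5 * y4 - 3 * l"
    unfolding y by (simp_all add: field_simps)
  moreover have "p$6 = - 5/2 * (y1 + y2 + y3 + y4) - 3 * m" by (simp add: m_def field_simps)
  moreover have "l = 2 * s + t" "m = s + 2 * t" unfolding st by (simp_all add: field_simps)
  moreover have "c = k + 3 * (s\<^sup>2 + s * t + t\<^sup>2)" by (simp add: k_def)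
  ultimately have P: "p$5 = - 6 * l" "p$1 = - 5 * y1 - 3 * l" "p$2 = - 5 * y2 - 3 * l" "p$3 = - 5 * y3 - 3 * l" "p$4 = - 5 * y4 - 3 * l"
    "p$6 = - 5/2 * (y1 + y2 + y3 + y4) - 3 * m" "l = 2 * s + t" "m = s + 2 * t" "c = k + 3 * (s\<^sup>2 + s * t + t\<^sup>2)"
    by blast+
  have eq: "c + p \<bullet> z + qform (layered_form 5 3) z = layered_fun y1 y2 y3 y4 s t k (z$1 + z$6/2) (z$2 + z$6/2) (z$3 + z$6/2) (z$4 + z$6/2)
     (z$1 + z$2 + z$3 + z$4 + 2 * z$5) (z$6)" for z
    unfolding inner qform_layered layered_fun_def hex_dist_def P by (simp add: power2_eq_square field_simps)
  have lat_nonneg: "0 \<le> layered_fun y1 y2 y3 y4 s t k a b c' d i j" if E6_point: "E6_point a b c' d i j" for a b c' d i j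
  proof -
    from E6_point obtain A B C D M J :: int where e: "a = A + J/2" "b = B + J/2" "c' = C + J/2" "d = D + J/2"
     "i = real_of_int (A + B + C + D + 2 * M)" "j = real_of_int J" unfolding E6_point_def by blast
    have "vec6 A B C D M J \<in> int_lattice" by (simp add: int_lattice_def forall_6)
    from nonneg[OF this] show ?thesis unfolding eq by (simp add: e)
  qed
  from in_E6_cell_zeros[OF lat_nonneg] obtain m1 m2 m3 m4 n1 n2 e where E: "\<And>a b c d i j. E6_point a b c d i j \<Longrightarrow>
     0 \<le> a\<^sup>2 + b\<^sup>2 + c\<^sup>2 + d\<^sup>2 + i\<^sup>2 + i * j + j\<^sup>2 + (m1 * a + m2 * b + m3 * c + m4 * d + n1 * i + n2 * j + e) \<and>
     (layered_fun y1 y2 y3 y4 s t k a b c d i j = 0 \<longrightarrow>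
       a\<^sup>2 + b\<^sup>2 + c\<^sup>2 + d\<^sup>2 + i\<^sup>2 + i * j + j\<^sup>2 + (m1 * a + m2 * b + m3 * c + m4 * d + n1 * i + n2 * j + e) = 0)"
    unfolding in_E6_cell_def by blast
  define p' where "p' = vec6 (m1 + n1) (m2 + n1) (m3 + n1) (m4 + n1) (2 * n1) ((m1 + m2 + m3 + m4) / 2 + n2)"
  have eq': "e + p' \<bullet> z + qform (layered_form 1 1) z =
     (z$1 + z$6/2)\<^sup>2 + (z$2 + z$6/2)\<^sup>2 + (z$3 + z$6/2)\<^sup>2 + (z$4 + z$6/2)\<^sup>2 + (z$1 + z$2 + z$3 + z$4 + 2 * z$5)\<^sup>2
     + (z$1 + z$2 + z$3 + z$4 + 2 * z$5) * z$6 + (z$6)\<^sup>2 + (m1 * (z$1 + z$6/2) + m2 * (z$2 + z$6/2) + m3 * (z$3 + z$6/2) + m4 * (z$4 + z$6/2)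
     + n1 * (z$1 + z$2 + z$3 + z$4 + 2 * z$5) + n2 * z$6 + e)" for z
    unfolding p'_def inner_vec6 qform_layered by (simp add: field_simps)
  show "\<exists>c' p'. \<forall>z\<in>int_lattice. 0 \<le> c' + p' \<bullet> z + qform (layered_form 1 1) z \<and>
       (c + p \<bullet> z + qform (layered_form 5 3) z = 0 \<longrightarrow> c' + p' \<bullet> z + qform (layered_form 1 1) z = 0)"
  proof (intro exI[of _ e] exI[of _ p'] ballI)
    fix z :: "real^6" assume "z \<in> int_lattice"
    from E[OF int_lattice_E6_point[OF this]] show "0 \<le> e + p' \<bullet> z + qform (layered_form 1 1) z \<and>
       (c + p \<bullet> z + qform (layered_form 5 3) z = 0 \<longrightarrow> e + p' \<bullet> z + qform (layered_form 1 1) z = 0)"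
      unfolding eq eq' .
  qed
qed

section \<open>A perfect domain separating the two forms\<close>

text \<open>Three times the form of the dual lattice of \<open>E6\<close> in the dual basis. The first four squares are those of the
quaternion part of a functional; the hexagonal part is \<open>b^2 - b q + q^2\<close> with \<open>b = v\<^sub>5\<close> and \<open>q = 2 v\<^sub>6 - (v\<^sub>1 + ... + v\<^sub>4) + 2 v\<^sub>5\<close>.\<close>
definition E6_dual_form :: "real^6^6" where
  "E6_dual_form = 3 *\<^sub>R (square_form (vec6 1 0 0 0 (-1/2) 0) + square_form (vec6 0 1 0 0 (-1/2) 0)
       + square_form (vec6 0 0 1 0 (-1/2) 0) + square_form (vec6 0 0 0 1 (-1/2) 0))
     + (square_form (vec6 (-1) (-1) (-1) (-1) (3/2) 2) + (3/4) *\<^sub>R square_form (vec6 0 0 0 0 1 0))"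

lemma E6_dual_form_sym: "E6_dual_form \<in> sym_matrices"
  unfolding E6_dual_form_def by (intro sym_add sym_scaleR square_form_sym)

lemma qform_dual_squares:
  "qform E6_dual_form v = 3 * ((v$1 - v$5/2)\<^sup>2 + (v$2 - v$5/2)\<^sup>2 + (v$3 - v$5/2)\<^sup>2 + (v$4 - v$5/2)\<^sup>2)
     + (2 * v$6 - (v$1 + v$2 + v$3 + v$4) + 3/2 * v$5)\<^sup>2 + 3/4 * (v$5)\<^sup>2"
proof -
  show ?thesis
    by (simp add: E6_dual_form_def qform_add_matrix qform_scaleR_matrix qform_square_form inner_vec6,
        simp add: power2_eq_square field_simps)
qed

lemma E6_dual_form_positive_definite: "positive_definite E6_dual_form"
  unfolding positive_definite_def
proof (intro conjI allI impI E6_dual_form_sym)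
  fix v :: "real^6" assume "v \<noteq> 0"
  have "0 \<le> qform E6_dual_form v" unfolding qform_dual_squares by simp
  moreover have "qform E6_dual_form v \<noteq> 0"
  proof
    assume "qform E6_dual_form v = 0"
    then have z: "v$5 = 0" "v$1 - v$5/2 = 0" "v$2 - v$5/2 = 0" "v$3 - v$5/2 = 0" "v$4 - v$5/2 = 0"
      "2 * v$6 - (v$1 + v$2 + v$3 + v$4) + 3/2 * v$5 = 0"
      unfolding qform_dual_squares by (simp_all add: add_nonneg_eq_0_iff)
    then have "v = 0" by (simp add: vec_eq_iff forall_6)
    with \<open>v \<noteq> 0\<close> show False ..
  qed
  ultimately show "0 < qform E6_dual_form v" by simp
qed

lemma qform_dual_int:
  fixes n :: "6 \<Rightarrow> int"
  assumes v: "\<And>i. v $ i = real_of_int (n i)"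
  defines "b \<equiv> n 5" and "q \<equiv> 2 * n 6 - (n 1 + n 2 + n 3 + n 4) + 2 * n 5"
  defines "m \<equiv> (n 1)\<^sup>2 + (n 2)\<^sup>2 + (n 3)\<^sup>2 + (n 4)\<^sup>2 - b * (n 1 + n 2 + n 3 + n 4) + b\<^sup>2"
  shows "qform E6_dual_form v = real_of_int (3 * m + (b\<^sup>2 - b * q + q\<^sup>2))"
    and "(v$1 - v$5/2)\<^sup>2 + (v$2 - v$5/2)\<^sup>2 + (v$3 - v$5/2)\<^sup>2 + (v$4 - v$5/2)\<^sup>2 = real_of_int m"
    and "4 * m = (2 * n 1 - b)\<^sup>2 + (2 * n 2 - b)\<^sup>2 + (2 * n 3 - b)\<^sup>2 + (2 * n 4 - b)\<^sup>2"
    and "4 * (b\<^sup>2 - b * q + q\<^sup>2) = (2 * q - b)\<^sup>2 + 3 * b\<^sup>2"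
  unfolding qform_dual_squares v m_def b_def q_def
  by (simp_all add: power2_eq_square field_simps)

text \<open>The quaternion part \<open>m\<close> is a nonnegative integer. If \<open>m = 0\<close>, the hexagonal part is divisible by 4. If \<open>m = 1\<close>, it is nonzero by parity.
If \<open>m \<ge> 2\<close>, the value is at least 6.\<close>
lemma E6_dual_form_min:
  assumes "v \<in> int_lattice" "v \<noteq> 0"
  shows "4 \<le> qform E6_dual_form v"
proof -
  have "\<exists>n :: int. v $ i = n" for i using assms by (auto simp: int_lattice_def elim: Ints_cases)
  then obtain n where n: "\<And>i. v $ i = real_of_int (n i)" by metis
  define b q m where "b = n 5" "q = 2 * n 6 - (n 1 + n 2 + n 3 + n 4) + 2 * n 5"
    "m = (n 1)\<^sup>2 + (n 2)\<^sup>2 + (n 3)\<^sup>2 + (n 4)\<^sup>2 - b * (n 1 + n 2 + n 3 + n 4) + b\<^sup>2"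
  note d = this
  note f = qform_dual_int[OF n, folded d(1,2), folded d(3)]
  have m0: "0 \<le> m" using f(3) zero_le_power2[of "2 * n 1 - b"] zero_le_power2[of "2 * n 2 - b"] zero_le_power2[of "2 * n 3 - b"]
      zero_le_power2[of "2 * n 4 - b"] by linarith
  define Q where "Q = b\<^sup>2 - b * q + q\<^sup>2"
  have f4: "4 * Q = (2 * q - b)\<^sup>2 + 3 * b\<^sup>2" unfolding Q_def by (rule f(4))
  then have Q0: "0 \<le> Q" using zero_le_power2[of "2 * q - b"] zero_le_power2[of b] by linarith
  have Q_zero: "b = 0 \<and> q = 0" if "Q = 0"
  proof -
    have "(2 * q - b)\<^sup>2 = 0" "b\<^sup>2 = 0" using f4 that zero_le_power2[of "2 * q - b"] zero_le_power2[of b] by linarith+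
    then show ?thesis by simp
  qed
  have "4 \<le> 3 * m + Q"
  proof -
    consider "m = 0" | "m = 1" | "2 \<le> m" using m0 by linarith
    then show ?thesis
    proof cases
      case 1
      have "(2 * n 1 - b)\<^sup>2 = 0" "(2 * n 2 - b)\<^sup>2 = 0" "(2 * n 3 - b)\<^sup>2 = 0" "(2 * n 4 - b)\<^sup>2 = 0"
        using f(3) 1 zero_le_power2[of "2 * n 1 - b"] zero_le_power2[of "2 * n 2 - b"] zero_le_power2[of "2 * n 3 - b"]
          zero_le_power2[of "2 * n 4 - b"] by linarith+
      then have e: "b = 2 * n 1" "n 2 = n 1" "n 3 = n 1" "n 4 = n 1" by simp_all
      have "q = 2 * n 6" using e unfolding d(2) by (simp add: d(1)[symmetric])
      then have Q4: "Q = 4 * ((n 1)\<^sup>2 - n 1 * n 6 + (n 6)\<^sup>2)" unfolding Q_def e(1) by (simp add: power2_eq_square algebra_simps)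
      have "Q \<noteq> 0"
      proof
        assume "Q = 0"
        then have "n 1 = 0" "n 6 = 0" "n 5 = 0" using Q_zero e(1) \<open>q = 2 * n 6\<close> d(1) by simp_all
        then have "v = 0" using e by (simp add: vec_eq_iff forall_6 n)
        with assms(2) show False ..
      qed
      then show ?thesis using Q4 Q0 1 by presburger
    next
      case 2
      have "Q \<noteq> 0"
      proof
        assume "Q = 0"
        then have z: "b = 0" "q = 0" using Q_zero by simp_all
        then have "even (n 1 + n 2 + n 3 + n 4)" using d(1,2) by (simp, presburger)
        then have "even ((n 1)\<^sup>2 + (n 2)\<^sup>2 + (n 3)\<^sup>2 + (n 4)\<^sup>2)" by simp
        moreover have "(n 1)\<^sup>2 + (n 2)\<^sup>2 + (n 3)\<^sup>2 + (n 4)\<^sup>2 = 1" using 2 z(1) unfolding d(3) by simp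
        ultimately have "even (1 :: int)" by metis
        then show False by simp
      qed
      then show ?thesis using 2 Q0 by linarith
    next
      case 3
      then show ?thesis using Q0 by linarith
    qed
  qed
  then have "real_of_int 4 \<le> real_of_int (3 * m + Q)" by (simp only: of_int_le_iff)
  then show ?thesis unfolding f(1) Q_def by simp
qed

lemma vec6_int_lattice: "vec6 a b c d e f \<in> int_lattice \<longleftrightarrow> a \<in> \<int> \<and> b \<in> \<int> \<and> c \<in> \<int> \<and> d \<in> \<int> \<and> e \<in> \<int> \<and> f \<in> \<int>"
  by (simp add: int_lattice_def forall_6)

lemma arithmetic_minimum_dual: "arithmetic_minimum E6_dual_form = 4"
  unfolding arithmetic_minimum_def
proof (rule cInf_eq_minimum)
  have "qform E6_dual_form (vec6 1 0 0 0 0 0) = 4" by (simp add: qform_dual_squares)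
  moreover have "vec6 1 0 0 0 0 0 \<in> int_lattice - {0}" by (auto simp: vec6_int_lattice vec_eq_iff forall_6)
  ultimately show "4 \<in> qform E6_dual_form ` (int_lattice - {0})" by force
qed (use E6_dual_form_min in auto)

lemma minimal_vectors_dual: "minimal_vectors E6_dual_form = {v \<in> int_lattice. qform E6_dual_form v = 4}"
  by (simp add: minimal_vectors_def arithmetic_minimum_dual)

lemma finite_minimal_vectors_dual: "finite (minimal_vectors E6_dual_form)"
  using finite_lattice_zeros[OF E6_dual_form_positive_definite, of "-4" 0]
  by (simp add: minimal_vectors_dual)

text \<open>The minimal vectors, up to sign, with quaternion part of norm 1: eight for each of the three pairs of shortest hexagonal parts.\<close>
definition facet_vectors :: "(real^6) list" where
  "facet_vectors =
    [vec6 1 0 0 0 0 0, vec6 1 0 0 0 0 1, vec6 0 1 0 0 0 0, vec6 0 1 0 0 0 1,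
     vec6 0 0 1 0 0 0, vec6 0 0 1 0 0 1, vec6 0 0 0 1 0 0, vec6 0 0 0 1 0 1,
     vec6 0 0 0 0 1 (-1), vec6 1 1 0 0 1 0, vec6 1 0 1 0 1 0, vec6 1 0 0 1 1 0,
     vec6 0 1 1 0 1 0, vec6 0 1 0 1 1 0, vec6 0 0 1 1 1 0, vec6 1 1 1 1 1 1,
     vec6 1 0 0 0 1 0, vec6 0 1 0 0 1 0, vec6 0 0 1 0 1 0, vec6 0 0 0 1 1 0,
     vec6 1 1 1 0 1 1, vec6 1 1 0 1 1 1, vec6 1 0 1 1 1 1, vec6 0 1 1 1 1 1]"

text \<open>The three pairs of minimal vectors with quaternion part 0.\<close>
definition trio_vectors :: "(real^6) list" where
  "trio_vectors = [vec6 1 1 1 1 2 0, vec6 0 0 0 0 0 1, vec6 1 1 1 1 2 1]"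

lemma facet_trio_minimal: "set (facet_vectors @ trio_vectors) \<subseteq> minimal_vectors E6_dual_form"
  unfolding facet_vectors_def trio_vectors_def minimal_vectors_dual
  by (auto simp: vec6_int_lattice qform_dual_squares power2_eq_square)

lemma sum_facet_vectors: "(\<Sum>v\<leftarrow>facet_vectors. square_form v) = layered_form 5 3 + layered_form 1 1"
  by (simp add: facet_vectors_def layered_form_def vec_eq_iff forall_6 square_form_def)

lemma E6_dual_form_perfect: "perfect_form E6_dual_form"
  unfolding perfect_form_def arithmetic_minimum_dual
proof (intro conjI E6_dual_form_positive_definite ballI impI)
  fix B :: "real^6^6" assume B: "B \<in> sym_matrices" "\<forall>v\<in>minimal_vectors E6_dual_form. qform B v = 4"
  define M where "M = B + (-1) *\<^sub>R E6_dual_form"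
  have M: "M \<in> sym_matrices" unfolding M_def by (intro sym_add sym_scaleR B(1) E6_dual_form_sym)
  have z: "qform M v = 0" if "v \<in> set (facet_vectors @ trio_vectors)" for v
  proof -
    have "qform B v = 4" "qform E6_dual_form v = 4" using that facet_trio_minimal B(2) minimal_vectors_dual by blast+
    then show ?thesis unfolding M_def qform_add_matrix qform_scaleR_matrix by simp
  qed
  have s: "M$i$j = M$j$i" for i j
    using M unfolding sym_matrices_def transpose_def by (metis (mono_tags, lifting) mem_Collect_eq vec_lambda_beta)
  \<comment> \<open>Diagonal entries and the entries in row 6 come first; all others are multiples of the entry at (5, 5), which a trio vector shows to vanish.\<close>
  have e6: "M$6$6 = 0" using z[of "vec6 0 0 0 0 0 1"] by (simp add: trio_vectors_def qform_6[OF M])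
  have d: "M$1$1 = 0" "M$2$2 = 0" "M$3$3 = 0" "M$4$4 = 0"
    using z[of "vec6 1 0 0 0 0 0"] z[of "vec6 0 1 0 0 0 0"] z[of "vec6 0 0 1 0 0 0"] z[of "vec6 0 0 0 1 0 0"]
    by (simp_all add: facet_vectors_def qform_6[OF M])
  have d6: "M$1$6 = 0" "M$2$6 = 0" "M$3$6 = 0" "M$4$6 = 0"
    using z[of "vec6 1 0 0 0 0 1"] z[of "vec6 0 1 0 0 0 1"] z[of "vec6 0 0 1 0 0 1"] z[of "vec6 0 0 0 1 0 1"]
    by (simp_all add: facet_vectors_def qform_6[OF M] d e6)
  have d5: "M$5$5 = 2 * M$5$6" "M$5$5 = - 2 * M$1$5" "M$5$5 = - 2 * M$2$5" "M$5$5 = - 2 * M$3$5" "M$5$5 = - 2 * M$4$5"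
    using z[of "vec6 0 0 0 0 1 (-1)"] z[of "vec6 1 0 0 0 1 0"] z[of "vec6 0 1 0 0 1 0"] z[of "vec6 0 0 1 0 1 0"] z[of "vec6 0 0 0 1 1 0"]
    by (simp_all add: facet_vectors_def qform_6[OF M] d e6 d6)
  have p: "2 * M$1$2 = M$5$5" "2 * M$1$3 = M$5$5" "2 * M$1$4 = M$5$5" "2 * M$2$3 = M$5$5" "2 * M$2$4 = M$5$5" "2 * M$3$4 = M$5$5"
    using z[of "vec6 1 1 0 0 1 0"] z[of "vec6 1 0 1 0 1 0"] z[of "vec6 1 0 0 1 1 0"] z[of "vec6 0 1 1 0 1 0"] z[of "vec6 0 1 0 1 1 0"] z[of "vec6 0 0 1 1 1 0"] d5
    by (simp_all add: facet_vectors_def qform_6[OF M] d e6 d6)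
  have "M$5$5 = 0"
    using z[of "vec6 1 1 1 1 2 0"] d5 p by (simp add: trio_vectors_def qform_6[OF M] d e6 d6)
  then have "M = 0" using d e6 d6 d5 p s by (simp add: vec_eq_iff forall_6)
  then show "B = E6_dual_form" by (simp add: M_def)
qed

lemma perfect_domain_add:
  assumes "X \<in> perfect_domain A" "Y \<in> perfect_domain A"
  shows "X + Y \<in> perfect_domain A"
proof -
  from assms(1) obtain w where w: "X = (\<Sum>v\<in>minimal_vectors A. w v *\<^sub>R square_form v)" "\<forall>v\<in>minimal_vectors A. 0 \<le> w v"
    unfolding perfect_domain_def by blast
  from assms(2) obtain w' where w': "Y = (\<Sum>v\<in>minimal_vectors A. w' v *\<^sub>R square_form v)" "\<forall>v\<in>minimal_vectors A. 0 \<le> w' v"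
    unfolding perfect_domain_def by blast
  have "X + Y = (\<Sum>v\<in>minimal_vectors A. (w v + w' v) *\<^sub>R square_form v)"
    unfolding w(1) w'(1) by (simp add: sum.distrib scaleR_add_left)
  then show ?thesis unfolding perfect_domain_def mem_Collect_eq using w(2) w'(2) by (intro exI[of _ "\<lambda>v. w v + w' v"]) simp
qed

lemma perfect_domain_scaleR:
  assumes "X \<in> perfect_domain A" "0 \<le> c"
  shows "c *\<^sub>R X \<in> perfect_domain A"
proof -
  from assms(1) obtain w where w: "X = (\<Sum>v\<in>minimal_vectors A. w v *\<^sub>R square_form v)" "\<forall>v\<in>minimal_vectors A. 0 \<le> w v"
    unfolding perfect_domain_def by blast
  have "c *\<^sub>R X = (\<Sum>v\<in>minimal_vectors A. (c * w v) *\<^sub>R square_form v)"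
    unfolding w(1) by (simp add: scaleR_sum_right)
  then show ?thesis unfolding perfect_domain_def mem_Collect_eq using w(2) assms(2) by (intro exI[of _ "\<lambda>v. c * w v"]) simp
qed

lemma convex_perfect_domain: "convex (perfect_domain A)"
  by (intro convexI perfect_domain_add perfect_domain_scaleR)

lemma square_form_perfect_domain:
  assumes "finite (minimal_vectors A)" "v \<in> minimal_vectors A"
  shows "square_form v \<in> perfect_domain A"
proof -
  have "square_form v = (\<Sum>u\<in>minimal_vectors A. (if u = v then 1 else 0) *\<^sub>R square_form u)"
    using assms by (simp add: if_distrib[of "\<lambda>c. c *\<^sub>R _"] sum.delta cong: if_cong)
  then show ?thesis unfolding perfect_domain_def mem_Collect_eq by (intro exI[of _ "\<lambda>u. if u = v then 1 else 0"]) simp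
qed

lemma layered_sum_in_domain: "layered_form 5 3 + layered_form 1 1 \<in> perfect_domain E6_dual_form"
proof -
  have "(\<Sum>v\<leftarrow>vs. square_form v) \<in> perfect_domain E6_dual_form" if "set vs \<subseteq> minimal_vectors E6_dual_form" for vs
    using that
  proof (induction vs)
    case Nil
    then show ?case unfolding perfect_domain_def mem_Collect_eq by (intro exI[of _ "\<lambda>u. 0"]) simp
  next
    case (Cons v vs)
    then show ?case by (simp add: perfect_domain_add square_form_perfect_domain finite_minimal_vectors_dual)
  qed
  from this[of facet_vectors] show ?thesis using facet_trio_minimal by (simp add: sum_facet_vectors)
qed

text \<open>On the square of a vector \<open>v\<close> this is the norm of its hexagonal part, in the scaling of \<open>E6_dual_form\<close>, minus the norm of its quaternion part.
It vanishes on the 24 facet vectors and is positive on the other three.\<close>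
definition facet_functional :: "real^6^6 \<Rightarrow> real" where
  "facet_functional M = qform M (vec6 (-1) (-1) (-1) (-1) (3/2) 2) + 3/4 * qform M (vec6 0 0 0 0 1 0)
    - (qform M (vec6 1 0 0 0 (-1/2) 0) + qform M (vec6 0 1 0 0 (-1/2) 0) + qform M (vec6 0 0 1 0 (-1/2) 0) + qform M (vec6 0 0 0 1 (-1/2) 0))"

text \<open>For a minimal vector \<open>3 X + Y = 4\<close> with \<open>X\<close> an integer and \<open>Y \<ge> 0\<close>. So \<open>X \<le> 1\<close> and \<open>Y - X = 4 - 4 X \<ge> 0\<close>.\<close>
lemma facet_functional_square_form:
  assumes "v \<in> minimal_vectors E6_dual_form"
  shows "0 \<le> facet_functional (square_form v)"
proof -
  have v: "v \<in> int_lattice" "qform E6_dual_form v = 4" using assms unfolding minimal_vectors_dual by auto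
  have "\<exists>n :: int. v $ i = n" for i using v by (auto simp: int_lattice_def elim: Ints_cases)
  then obtain n where n: "\<And>i. v $ i = real_of_int (n i)" by metis
  define X where "X = (v$1 - v$5/2)\<^sup>2 + (v$2 - v$5/2)\<^sup>2 + (v$3 - v$5/2)\<^sup>2 + (v$4 - v$5/2)\<^sup>2"
  define Y where "Y = (2 * v$6 - (v$1 + v$2 + v$3 + v$4) + 3/2 * v$5)\<^sup>2 + 3/4 * (v$5)\<^sup>2"
  have XY: "3 * X + Y = 4" "0 \<le> Y" using v(2) unfolding qform_dual_squares X_def Y_def by simp_all
  obtain m :: int where m: "X = m" using qform_dual_int(2)[OF n] unfolding X_def by blast
  have "real_of_int m < 2" using XY m by linarith
  then have "m \<le> 1" by linarith
  then have "X \<le> 1" unfolding m by simp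
  have "facet_functional (square_form v) = Y - X"
    unfolding facet_functional_def qform_square_form X_def Y_def
    by (simp add: inner_commute[of v] inner_vec6 power2_commute power2_eq_square algebra_simps)
  then show ?thesis using XY \<open>X \<le> 1\<close> by linarith
qed

lemma facet_functional_domain:
  assumes "X \<in> perfect_domain E6_dual_form"
  shows "0 \<le> facet_functional X"
proof -
  from assms obtain w where w: "X = (\<Sum>v\<in>minimal_vectors E6_dual_form. w v *\<^sub>R square_form v)" "\<forall>v\<in>minimal_vectors E6_dual_form. 0 \<le> w v"
    unfolding perfect_domain_def by blast
  have "facet_functional X = (\<Sum>v\<in>minimal_vectors E6_dual_form. w v * facet_functional (square_form v))"
    unfolding facet_functional_def w(1) qform_sum_matrix qform_scaleR_matrix
    by (simp add: sum.distrib sum_subtractf sum_distrib_left algebra_simps)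
  also have "\<dots> \<ge> 0" using w(2) facet_functional_square_form by (intro sum_nonneg mult_nonneg_nonneg) auto
  finally show ?thesis .
qed

lemma layered_form_not_in_domain: "layered_form 5 3 \<notin> perfect_domain E6_dual_form"
proof
  assume "layered_form 5 3 \<in> perfect_domain E6_dual_form"
  then have "0 \<le> facet_functional (layered_form 5 3)" by (rule facet_functional_domain)
  then show False by (simp add: facet_functional_def qform_layered power2_eq_square)
qed

section \<open>The two partitions\<close>

theorem mainTheorem1:
  shows "\<not> (\<forall>C \<in> (perfect_partition :: (real^6^6) set set).
              \<exists>\<D>. finite \<D> \<and> \<D> \<subseteq> L_type_partition \<and> C = \<Union>\<D>)"
proof
  assume union: "\<forall>C \<in> (perfect_partition :: (real^6^6) set set).
              \<exists>\<D>. finite \<D> \<and> \<D> \<subseteq> L_type_partition \<and> C = \<Union>\<D>"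
  let ?A = "layered_form 5 3" and ?B = "layered_form 5 3 + layered_form 1 1"
  obtain F where F: "F face_of perfect_domain E6_dual_form" "?B \<in> rel_interior F"
    using obtain_face_rel_interior[OF convex_perfect_domain layered_sum_in_domain] by blast
  then have "F \<noteq> {}" using rel_interior_subset by fastforce
  then have "rel_interior F \<in> perfect_partition"
    using F(1) E6_dual_form_perfect unfolding perfect_partition_def by blast
  then obtain \<D> where D: "\<D> \<subseteq> L_type_partition" "rel_interior F = \<Union>\<D>" using union by blast
  then obtain L where L: "L \<in> \<D>" "?B \<in> L" using F(2) by blast
  then obtain X where X: "L = L_domain X" using D(1) unfolding L_type_partition_def by blast
  have "?A \<in> pqf" by (intro positive_definite_imp_pqf layered_form_positive_definite) simp_all
  moreover have "delaunay_tiling ?A = delaunay_tiling X"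
    using L(2) unfolding X L_domain_def mem_Collect_eq by (simp only: layered_form_tiling)
  ultimately have "?A \<in> L" unfolding X L_domain_def by simp
  then have "?A \<in> F" using L(1) D(2) rel_interior_subset by blast
  then show False using face_of_imp_subset[OF F(1)] layered_form_not_in_domain by blast
qed

end
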